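(* Let $H$ be a $\chi$-critical graph and let $G$ be an $H$-free connected graph on $n\ge 2n_H$ vertices. Then: (1) when $n$ is odd, $$\lambda_2(G)\le\rho^*\Big(\frac{n-1}{2},H\Big),$$ with equality if and only if $G\in\mathcal I\big(T_{\frac{n-1}{2},\chi},T_{\frac{n-1}{2},\chi}\big)$ and $G$ is $H$-free; (2) when $n$ is even, a graph $G^{*}$ with the maximum second largest eigenvalue among all $H$-free connected graphs on $n$ vertices satisfies $$\lambda_2(G^{*})=\rho\big(T_{\frac n2,\chi}\big)-o(1)\quad\text{and}\quad G^{*}\in\mathcal E(H_1,H_2),$$ where $H_1$ and $H_2$ are some $H$-saturated graphs, each on $\frac n2$ vertices (and $o(1)$ is as $n\to\infty$).
   Context: Graphs are finite and simple. $\lambda_1(G)\ge\lambda_2(G)\ge\cdots$ are the adjacency eigenvalues of $G$, and $\rho(G)=\lambda_1(G)$. A graph $H$ is $\chi$-critical if it has chromatic number $\chi+1$ and contains an edge whose deletion reduces the chromatic number to $\chi$. For $k\ge2$, $T_{n,k}$ is the $k$-partite Turán graph on $n$ vertices (complete $k$-partite, with every part of size $\lfloor n/k\rfloor$ or $\lceil n/k\rceil$); here $\chi\ge 2$. $G$ is $H$-free if it contains no copy of $H$ as a (not necessarily induced) subgraph, and $H$-saturated if it is $H$-free but $G+e$ contains a copy of $H$ for every non-edge $e$. $\rho^*(n,H)$ is the maximum spectral radius among $H$-free graphs on $n$ vertices. $n_H$ denotes an integer, which exists by a theorem of Nikiforov and satisfies $n_H\ge e^{n_0\chi^{(2\chi+9)(\chi+1)}}$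 where $n_0=|V(H)|$, such that for all $n\ge n_H$ one has $\rho^*(n,H)=\rho(T_{n,\chi})$ and $T_{n,\chi}$ is the unique $H$-free graph on $n$ vertices with this spectral radius. For disjoint graphs $A,B$: $\mathcal I(A,B)$ is the family of connected graphs obtained from the disjoint union of $A$ and $B$ by adding one new vertex and joining it to some vertices of $A$ and some vertices of $B$; $\mathcal E(A,B)$ is the family of graphs obtained from the disjoint union of $A$ and $B$ by adding one new edge between a vertex of $A$ and a vertex of $B$. *)

theory Defs
  imports
    "Graph_Theory.Pair_Digraph"
    "Graph_Theory.Digraph_Component"
    "Graph_Theory.Digraph_Isomorphism"
    "Jordan_Normal_Form.Char_Poly"
    "HOL-Library.Landau_Symbols"
begin

text \<open>
  A finite simple graph is a \<^typ>\<open>'a pair_pre_digraph\<close> satisfying \<^const>\<open>pair_graph\<close>: an undirected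
  edge is a pair of opposite arcs.
\<close>

definition add_edge :: "'a pair_pre_digraph \<Rightarrow> 'a \<Rightarrow> 'a \<Rightarrow> 'a pair_pre_digraph" where
  "add_edge G u v = G\<lparr>parcs := parcs G \<union> {(u, v), (v, u)}\<rparr>"

definition delete_edge :: "'a pair_pre_digraph \<Rightarrow> 'a \<Rightarrow> 'a \<Rightarrow> 'a pair_pre_digraph" where
  "delete_edge G u v = G\<lparr>parcs := parcs G - {(u, v), (v, u)}\<rparr>"

definition graph_connected :: "'a pair_pre_digraph \<Rightarrow> bool" where
  "graph_connected G \<longleftrightarrow> Digraph_Component.connected (with_proj G)"

definition graph_iso :: "'a pair_pre_digraph \<Rightarrow> 'b pair_pre_digraph \<Rightarrow> bool" (infix \<open>\<cong>\<^sub>G\<close> 50) where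
  "G \<cong>\<^sub>G H \<longleftrightarrow> digraph_iso (with_proj G) (with_proj H)"


section \<open>Chromatic number\<close>

definition proper_colouring :: "'a pair_pre_digraph \<Rightarrow> nat \<Rightarrow> ('a \<Rightarrow> nat) \<Rightarrow> bool" where
  "proper_colouring G k c \<longleftrightarrow> c ` pverts G \<subseteq> {..<k} \<and> (\<forall>(u, v) \<in> parcs G. c u \<noteq> c v)"

definition chromatic_number :: "'a pair_pre_digraph \<Rightarrow> nat" where
  "chromatic_number G = (LEAST k. \<exists>c. proper_colouring G k c)"

definition colour_critical :: "nat \<Rightarrow> 'a pair_pre_digraph \<Rightarrow> bool" where
  "colour_critical \<chi> H \<longleftrightarrow>
     pair_graph H \<and> chromatic_number H = \<chi> + 1 \<and>
     (\<exists>(u, v) \<in> parcs H. chromatic_number (delete_edge H u v) = \<chi>)"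


section \<open>Forbidden subgraphs\<close>

definition contains_copy :: "'b pair_pre_digraph \<Rightarrow> 'a pair_pre_digraph \<Rightarrow> bool" where
  "contains_copy H G \<longleftrightarrow>
     (\<exists>K :: 'a pair_pre_digraph. subgraph (with_proj K) (with_proj G) \<and> H \<cong>\<^sub>G K)"

abbreviation free_of :: "'b pair_pre_digraph \<Rightarrow> 'a pair_pre_digraph \<Rightarrow> bool" where
  "free_of H G \<equiv> \<not> contains_copy H G"

definition saturated :: "'b pair_pre_digraph \<Rightarrow> 'a pair_pre_digraph \<Rightarrow> bool" where
  "saturated H G \<longleftrightarrow>
     pair_graph G \<and> free_of H G \<and>
     (\<forall>u \<in> pverts G. \<forall>v \<in> pverts G. u \<noteq> v \<and> (u, v) \<notin> parcs G \<longrightarrow> contains_copy H (add_edge G u v))"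


section \<open>Adjacency eigenvalues\<close>

definition vertex_list :: "'a pair_pre_digraph \<Rightarrow> 'a list" where
  "vertex_list G = (SOME xs. distinct xs \<and> set xs = pverts G)"

definition adjacency_matrix :: "'a pair_pre_digraph \<Rightarrow> real mat" where
  "adjacency_matrix G = (let xs = vertex_list G; n = length xs in
     mat n n (\<lambda>(i, j). if (xs ! i, xs ! j) \<in> parcs G then 1 else 0))"

text \<open>
  The characteristic polynomial does not depend on the vertex order chosen by
  \<^const>\<open>vertex_list\<close>. As the matrix is real and symmetric, the polynomial splits over the reals, so
  its roots, taken with multiplicity and in descending order, are all the eigenvalues.
\<close>

definition adjacency_eigenvalues :: "'a pair_pre_digraph \<Rightarrow> real list" where
  "adjacency_eigenvalues G =
     rev (sorted_list_of_multiset (proots (char_poly (adjacency_matrix G))))"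

text \<open>Eigenvalues are indexed from 1, the largest one being \<open>eigval 1 G\<close>.\<close>

definition eigval :: "nat \<Rightarrow> 'a pair_pre_digraph \<Rightarrow> real" where
  "eigval i G = adjacency_eigenvalues G ! (i - 1)"

abbreviation spectral_radius :: "'a pair_pre_digraph \<Rightarrow> real" where
  "spectral_radius G \<equiv> eigval 1 G"

text \<open>Up to isomorphism every finite graph has its vertices in \<^typ>\<open>nat\<close>.\<close>

definition max_spectral_radius :: "nat \<Rightarrow> 'b pair_pre_digraph \<Rightarrow> real" where
  "max_spectral_radius n H =
     Max {spectral_radius G | G :: nat pair_pre_digraph.
            pair_graph G \<and> card (pverts G) = n \<and> free_of H G}"


section \<open>Turan graphs\<close>

text \<open>The parts are the residue classes modulo \<open>k\<close>; see \<open>turan_part_card\<close> for their sizes.\<close>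

definition turan_graph :: "nat \<Rightarrow> nat \<Rightarrow> nat pair_pre_digraph" where
  "turan_graph n k =
     \<lparr>pverts = {..<n}, parcs = {(i, j). i < n \<and> j < n \<and> i mod k \<noteq> j mod k}\<rparr>"

lemma pair_graph_turan_graph: "pair_graph (turan_graph n k)"
proof
  have "parcs (turan_graph n k) \<subseteq> {..<n} \<times> {..<n}"
    by (auto simp: turan_graph_def)
  then show "finite (parcs (turan_graph n k))"
    by (rule finite_subset) simp
qed (auto simp: turan_graph_def symmetric_def intro!: symI)

lemma turan_part_card:
  assumes "r < k"
  shows "card {i \<in> pverts (turan_graph n k). i mod k = r} = n div k + (if r < n mod k then 1 else 0)"
proof -
  have "{i \<in> pverts (turan_graph n k). i mod k = r}
      = (\<lambda>q. q * k + r) ` {..<n div k + (if r < n mod k then 1 else 0)}" (is "?A = ?g ` ?B")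
  proof (intro equalityI subsetI)
    fix i assume "i \<in> ?A"
    then have i: "i < n" "i mod k = r" by (auto simp: turan_graph_def)
    have le: "i div k \<le> n div k" using i(1) by (intro div_le_mono) simp
    have "r < n mod k" if "i div k = n div k"
    proof -
      have "i div k * k + i mod k < n div k * k + n mod k"
        using i(1) by (simp only: div_mult_mod_eq)
      then show ?thesis using that i(2) by (simp only: nat_add_left_cancel_less)
    qed
    then have "i div k \<in> ?B" using le by (auto simp: le_less)
    moreover have "i = ?g (i div k)" using i(2) div_mult_mod_eq[of i k] by simp
    ultimately show "i \<in> ?g ` ?B" by blast
  next
    fix i assume "i \<in> ?g ` ?B"
    then obtain q where q: "i = q * k + r" "q \<in> ?B" by blast
    have n: "n = n div k * k + n mod k" by simp
    have "i < n"
    proof (cases "q < n div k")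
      case True
      then have "(q + 1) * k \<le> n div k * k" by (intro mult_le_mono1) simp
      then have "q * k + k \<le> n div k * k" by simp
      then show ?thesis using assms q(1) n by linarith
    next
      case False
      then have "q = n div k" "r < n mod k" using q(2) by (auto split: if_splits)
      then show ?thesis using q(1) n by (metis add_less_cancel_left)
    qed
    then show "i \<in> ?A" using q(1) assms by (simp add: turan_graph_def)
  qed
  moreover have "inj_on ?g ?B" using assms by (auto simp: inj_on_def)
  ultimately show ?thesis by (simp add: card_image)
qed


section \<open>Joining two graphs by a new vertex or a new edge\<close>

definition disjoint_union ::
  "'a pair_pre_digraph \<Rightarrow> 'b pair_pre_digraph \<Rightarrow> ('a + 'b) pair_pre_digraph" where
  "disjoint_union A B =
     \<lparr>pverts = pverts A <+> pverts B,
      parcs = map_prod Inl Inl ` parcs A \<union> map_prod Inr Inr ` parcs B\<rparr>"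

text \<open>The new vertex is \<^const>\<open>None\<close>; its neighbourhood is \<open>N\<close>.\<close>

definition add_vertex :: "'a pair_pre_digraph \<Rightarrow> 'a set \<Rightarrow> 'a option pair_pre_digraph" where
  "add_vertex G N =
     \<lparr>pverts = insert None (Some ` pverts G),
      parcs = map_prod Some Some ` parcs G \<union> {None} \<times> (Some ` N) \<union> (Some ` N) \<times> {None}\<rparr>"

definition vertex_joined ::
  "'a pair_pre_digraph \<Rightarrow> 'b pair_pre_digraph \<Rightarrow> 'c pair_pre_digraph set" where
  "vertex_joined A B = {G. pair_graph G \<and> graph_connected G \<and>
     (\<exists>S T. S \<subseteq> pverts A \<and> S \<noteq> {} \<and> T \<subseteq> pverts B \<and> T \<noteq> {} \<and>
        G \<cong>\<^sub>G add_vertex (disjoint_union A B) (S <+> T))}"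

definition edge_joined ::
  "'a pair_pre_digraph \<Rightarrow> 'b pair_pre_digraph \<Rightarrow> 'c pair_pre_digraph set" where
  "edge_joined A B = {G. pair_graph G \<and>
     (\<exists>a \<in> pverts A. \<exists>b \<in> pverts B. G \<cong>\<^sub>G add_edge (disjoint_union A B) (Inl a) (Inr b))}"


section \<open>Extremality\<close>

text \<open>
  The property, guaranteed for some \<open>N\<close> by a theorem of Nikiforov, that defines the constant
  \<open>n\<^sub>H\<close>. It is a property of \<open>N\<close> and not a fixed number: any such \<open>N\<close> is admissible.
\<close>

definition nikiforov_threshold :: "nat \<Rightarrow> 'b pair_pre_digraph \<Rightarrow> nat \<Rightarrow> bool" where
  "nikiforov_threshold \<chi> H N \<longleftrightarrow>
     real N \<ge> exp (real (card (pverts H)) * real \<chi> ^ ((2 * \<chi> + 9) * (\<chi> + 1))) \<and>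
     (\<forall>n \<ge> N.
        max_spectral_radius n H = spectral_radius (turan_graph n \<chi>) \<and>
        free_of H (turan_graph n \<chi>) \<and>
        (\<forall>G :: nat pair_pre_digraph.
           pair_graph G \<and> card (pverts G) = n \<and> free_of H G \<and>
           spectral_radius G = max_spectral_radius n H \<longrightarrow> G \<cong>\<^sub>G turan_graph n \<chi>))"

definition connected_free_graph ::
  "'b pair_pre_digraph \<Rightarrow> nat \<Rightarrow> 'a pair_pre_digraph \<Rightarrow> bool" where
  "connected_free_graph H n G \<longleftrightarrow>
     pair_graph G \<and> graph_connected G \<and> card (pverts G) = n \<and> free_of H G"

definition maximizes_second_eigenvalue ::
  "'b pair_pre_digraph \<Rightarrow> nat \<Rightarrow> 'a pair_pre_digraph \<Rightarrow> bool" where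
  "maximizes_second_eigenvalue H n G \<longleftrightarrow>
     connected_free_graph H n G \<and>
     (\<forall>G' :: nat pair_pre_digraph. connected_free_graph H n G' \<longrightarrow> eigval 2 G' \<le> eigval 2 G)"

end

theory Submission
  imports Defs "HOL-Analysis.Function_Topology" "HOL-Analysis.Convex"
begin

text \<open>
  Let \<open>x\<close> be an eigenvector for the second eigenvalue. It is orthogonal to the positive Perron
  vector, so it has positive and negative entries, and the second eigenvalue is at most the spectral
  radius of the subgraph induced by either sign part.

  If \<open>n = 2 * m + 1\<close>, one sign part has at most \<open>m\<close> vertices, which gives the bound. In the case of
  equality this part induces the Turan graph and has no edges to the other part; by connectivity the
  other part also has only \<open>m\<close> vertices, and the remaining vertex joins the two.

  If \<open>n = 2 * m\<close>, two Turan graphs joined by an edge at vertices of least Perron weight show that the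
  second eigenvalue of the maximizer is at least the spectral radius of the Turan graph minus
  \<open>1 / m\<close>. This forces both sign parts to have exactly \<open>m\<close> vertices. As \<open>m - 1\<close> may lie below the
  threshold of Nikiforov's theorem, this step needs the weaker bound \<open>(1 - 1 / r) * k\<close>, where \<open>r = \<chi>\<close>,
  for the spectral radius of a free graph on \<open>k\<close> vertices, which follows from Wilf's clique bound applied to a dense
  induced subgraph. Deleting an edge between the sign parts increases the second
  eigenvalue, so only one such edge exists. Each part is near-extremal, hence has large minimum degree,
  hence is \<open>r\<close>-colourable, and this remains so if an edge is added without creating a copy of \<open>H\<close>.
  Such an edge would therefore keep the whole graph colourable, hence free, and increase the second
  eigenvalue. So both parts are saturated.
\<close>

section \<open>Eigenbases of symmetric kernels\<close>

text \<open>Nikiforov's property supplies neither a spectral bound for orders just below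
  \<open>N\<close> nor the structure of near-extremal graphs. Both rest on one mechanism that turns
  an (r + 1)-clique into a copy of \<open>H\<close>. If all degrees are close to (1 - 1 / r) n or
  larger, the vertices of such a clique can be exchanged one at a time against linearly many others,
  until a positive proportion of all (r - 1)-tuples completes one fixed edge to a clique. A complete
  r-partite subgraph is extracted from these tuples, each extended by one more vertex; the fixed
  edge is joined to all parts but one, and \<open>H\<close> embeds with its critical edge placed
  there. The densities lost on the way multiply to (12 r)^r, which fixes \<open>F\<close>, and
  \<open>Q\<close> bounds the families needed. The size of the threshold pays for this through 4
  F^(r-1) \<le> r^((2 r + 9) (r + 1)), where the exponents of the estimates meet exactly. All
  spectral arguments are variational, whereas \<open>eigval\<close> is read off a characteristic
  polynomial; an eigenbasis with the min-max property connects the two.\<close>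

definition inner_on :: "'a set \<Rightarrow> ('a \<Rightarrow> real) \<Rightarrow> ('a \<Rightarrow> real) \<Rightarrow> real" where
  "inner_on V x y = (\<Sum>v\<in>V. x v * y v)"

text \<open>Vectors are functions on the whole type of which only the values on \<open>V\<close>
  count, so no enumeration of the vertices is needed until the characteristic polynomial has to be
  computed.\<close>

definition kernel_op :: "'a set \<Rightarrow> ('a \<Rightarrow> 'a \<Rightarrow> real) \<Rightarrow> ('a \<Rightarrow> real) \<Rightarrow> 'a \<Rightarrow> real" where
  "kernel_op V a x v = (\<Sum>w\<in>V. a v w * x w)"

abbreviation quad_form :: "'a set \<Rightarrow> ('a \<Rightarrow> 'a \<Rightarrow> real) \<Rightarrow> ('a \<Rightarrow> real) \<Rightarrow> real" where
  "quad_form V a x \<equiv> inner_on V x (kernel_op V a x)"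

lemma inner_on_commute: "inner_on V x y = inner_on V y x"
  by (simp add: inner_on_def mult.commute)

lemma inner_on_add: "inner_on V (\<lambda>v. x v + y v) z = inner_on V x z + inner_on V y z"
  "inner_on V z (\<lambda>v. x v + y v) = inner_on V z x + inner_on V z y"
  by (simp_all add: inner_on_def algebra_simps sum.distrib)

lemma inner_on_diff: "inner_on V (\<lambda>v. x v - y v) z = inner_on V x z - inner_on V y z"
  "inner_on V z (\<lambda>v. x v - y v) = inner_on V z x - inner_on V z y"
  by (simp_all add: inner_on_def algebra_simps sum_subtractf)

lemma inner_on_scale: "inner_on V (\<lambda>v. c * x v) z = c * inner_on V x z"
  "inner_on V z (\<lambda>v. c * x v) = c * inner_on V z x"
  by (simp_all add: inner_on_def sum_distrib_left mult_ac)

lemma inner_on_sum: "inner_on V (\<lambda>v. \<Sum>i\<in>I. x i v) z = (\<Sum>i\<in>I. inner_on V (x i) z)"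
  "inner_on V z (\<lambda>v. \<Sum>i\<in>I. x i v) = (\<Sum>i\<in>I. inner_on V z (x i))"
  by (simp_all add: inner_on_def sum_distrib_left sum_distrib_right sum.swap[of _ V])

lemma inner_on_self_nonneg: "inner_on V x x \<ge> 0"
  by (simp add: inner_on_def sum_nonneg)

lemma inner_on_self_eq_0_iff: "finite V \<Longrightarrow> inner_on V x x = 0 \<longleftrightarrow> (\<forall>v\<in>V. x v = 0)"
  by (simp add: inner_on_def sum_nonneg_eq_0_iff)

lemma inner_on_cong: "(\<And>v. v \<in> V \<Longrightarrow> x v = x' v) \<Longrightarrow> (\<And>v. v \<in> V \<Longrightarrow> y v = y' v) \<Longrightarrow>
    inner_on V x y = inner_on V x' y'"
  by (simp add: inner_on_def)

lemma kernel_op_cong: "(\<And>v. v \<in> V \<Longrightarrow> x v = x' v) \<Longrightarrow> kernel_op V a x = kernel_op V a x'"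
  by (simp add: kernel_op_def fun_eq_iff)

lemma kernel_op_add: "kernel_op V a (\<lambda>v. x v + y v) = (\<lambda>v. kernel_op V a x v + kernel_op V a y v)"
  by (simp add: kernel_op_def algebra_simps sum.distrib fun_eq_iff)

lemma kernel_op_scale: "kernel_op V a (\<lambda>v. c * x v) = (\<lambda>v. c * kernel_op V a x v)"
  by (simp add: kernel_op_def sum_distrib_left mult_ac fun_eq_iff)

lemma kernel_op_symmetric:
  assumes "\<And>v w. v \<in> V \<Longrightarrow> w \<in> V \<Longrightarrow> a v w = a w v"
  shows "inner_on V x (kernel_op V a y) = inner_on V (kernel_op V a x) y"
proof -
  have "inner_on V x (kernel_op V a y) = (\<Sum>v\<in>V. \<Sum>w\<in>V. x v * a v w * y w)"
    by (simp add: inner_on_def kernel_op_def sum_distrib_left mult_ac)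
  also have "\<dots> = (\<Sum>w\<in>V. \<Sum>v\<in>V. x v * a v w * y w)" by (rule sum.swap)
  also have "\<dots> = inner_on V (kernel_op V a x) y"
    using assms by (simp add: inner_on_def kernel_op_def sum_distrib_right sum_distrib_left mult_ac)
  finally show ?thesis .
qed

lemma quad_form_add:
  assumes "\<And>v w. v \<in> V \<Longrightarrow> w \<in> V \<Longrightarrow> a v w = a w v"
  shows "quad_form V a (\<lambda>v. s * x v + t * y v)
     = s\<^sup>2 * quad_form V a x + 2 * s * t * inner_on V x (kernel_op V a y) + t\<^sup>2 * quad_form V a y"
proof -
  have "inner_on V y (kernel_op V a x) = inner_on V x (kernel_op V a y)"
    using kernel_op_symmetric[of V a y x, OF assms] by (simp add: inner_on_commute)
  then show ?thesis
    by (simp add: kernel_op_add kernel_op_scale inner_on_add inner_on_scale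
      power2_eq_square algebra_simps)
qed

lemma inner_on_add_square:
  "inner_on V (\<lambda>v. s * x v + t * y v) (\<lambda>v. s * x v + t * y v)
     = s\<^sup>2 * inner_on V x x + 2 * s * t * inner_on V x y + t\<^sup>2 * inner_on V y y"
  by (simp add: inner_on_add inner_on_scale inner_on_commute[of V y x] power2_eq_square algebra_simps)

section \<open>Spectral theorem by successive Rayleigh maximization\<close>

lemma continuous_on_eval [continuous_intros]: "continuous_on S (\<lambda>x::'a \<Rightarrow> real. x v)"
  by (rule continuous_on_subset[OF continuous_on_product_coordinates]) simp

text \<open>Compactness of a constrained unit sphere. The vectors live on a possibly infinite type,
  so compactness comes from Tychonoff's theorem; the vector \<open>z\<close> makes the constrained
  sphere non-empty.\<close>

lemma rayleigh_maximum_exists: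
  fixes a :: "'a \<Rightarrow> 'a \<Rightarrow> real"
  assumes "finite V" "inner_on V z z = 1" "\<And>i. i < k \<Longrightarrow> inner_on V z (e (i::nat)) = 0"
  shows "\<exists>x. inner_on V x x = 1 \<and> (\<forall>i<k. inner_on V x (e i) = 0) \<and>
    (\<forall>y. inner_on V y y = 1 \<and> (\<forall>i<k. inner_on V y (e i) = 0) \<longrightarrow>
       quad_form V a y \<le> quad_form V a x)"
proof -
  \<comment> \<open>A unit vector has its entries on \<open>V\<close> in [-1, 1]. Fixing the value 0
    elsewhere makes the box compact and changes neither the form nor the norm.\<close>
  define B where "B = PiE UNIV (\<lambda>v. if v \<in> V then {-1..1::real} else {0})"
  define C where "C = {x. inner_on V x x = 1 \<and> (\<forall>i<k. inner_on V x (e i) = 0)}"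
  have "compactin (product_topology (\<lambda>_::'a. euclidean :: real topology) UNIV) B"
    unfolding B_def compactin_PiE by (auto simp: compactin_euclidean_iff)
  then have B: "compact B"
    by (simp add: euclidean_product_topology compactin_euclidean_iff)
  have inner_cont: "continuous_on UNIV (\<lambda>x. inner_on V (f x) (g x))"
    if "\<And>v. continuous_on UNIV (\<lambda>x. f x v)" "\<And>v. continuous_on UNIV (\<lambda>x. g x v)"
    for f g :: "('a \<Rightarrow> real) \<Rightarrow> 'a \<Rightarrow> real"
    unfolding inner_on_def using that by (intro continuous_intros)
  have "closed {x. inner_on V x x = 1}"
    by (intro closed_Collect_eq inner_cont continuous_intros)
  moreover have "closed {x. inner_on V x (e i) = 0}" for i
    by (intro closed_Collect_eq inner_cont continuous_intros)
  ultimately have "closed ({x. inner_on V x x = 1} \<inter> (\<Inter>i\<in>{..<k}. {x. inner_on V x (e i) = 0}))"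
    by (intro closed_Int closed_INT) auto
  also have "{x. inner_on V x x = 1} \<inter> (\<Inter>i\<in>{..<k}. {x. inner_on V x (e i) = 0}) = C"
    by (auto simp: C_def)
  finally have compact: "compact (B \<inter> C)" using B by (rule compact_Int_closed[rotated])
  have restrict: "\<exists>y'\<in>B \<inter> C. quad_form V a y' = quad_form V a y" if "y \<in> C" for y
  proof
    let ?y = "\<lambda>v. if v \<in> V then y v else 0"
    have "(y v)\<^sup>2 \<le> 1" if "v \<in> V" for v
    proof -
      have "(y v)\<^sup>2 \<le> (\<Sum>v\<in>V. (y v)\<^sup>2)" using that \<open>finite V\<close> by (intro member_le_sum) auto
      then show ?thesis using \<open>y \<in> C\<close> by (simp add: C_def inner_on_def power2_eq_square)
    qed
    then have "?y \<in> B" by (auto simp: B_def abs_le_iff abs_square_le_1)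
    moreover have "inner_on V ?y ?y = inner_on V y y" "inner_on V ?y f = inner_on V y f" for f
      by (auto intro!: inner_on_cong)
    ultimately show "?y \<in> B \<inter> C" using \<open>y \<in> C\<close> by (simp add: C_def)
    have "kernel_op V a ?y = kernel_op V a y" by (auto intro!: kernel_op_cong)
    then show "quad_form V a ?y = quad_form V a y"
      using \<open>\<And>f. inner_on V ?y f = inner_on V y f\<close> by simp
  qed
  have "z \<in> C" using assms by (simp add: C_def)
  then have "B \<inter> C \<noteq> {}" using restrict by blast
  moreover have "continuous_on (B \<inter> C) (quad_form V a)"
    by (rule continuous_on_subset[OF inner_cont])
      (auto simp: kernel_op_def intro!: continuous_intros)
  ultimately obtain x where "x \<in> B \<inter> C" "\<And>y. y \<in> B \<inter> C \<Longrightarrow> quad_form V a y \<le> quad_form V a x"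
    using continuous_attains_sup[OF compact] by metis
  then have "quad_form V a y \<le> quad_form V a x" if "y \<in> C" for y using restrict that by metis
  then show ?thesis using \<open>x \<in> B \<inter> C\<close> unfolding C_def by blast
qed

lemma quadratic_nonpos_imp_linear_zero:
  fixes b c :: real
  assumes "\<And>t. t * b + t\<^sup>2 * c \<le> 0"
  shows "b = 0"
proof (rule ccontr)
  assume "b \<noteq> 0"
  \<comment> \<open>At t = b / d the expression equals b^2 (d + c) / d^2, which is positive because
    d > - c.\<close>
  define d where "d = \<bar>c\<bar> + 1"
  have "d > 0" "c \<le> d" "- c < d" by (auto simp: d_def)
  have "(b / d) * b + (b / d)\<^sup>2 * c \<le> 0" by (rule assms)
  then have "(b / d) * b * d\<^sup>2 + (b / d)\<^sup>2 * c * d\<^sup>2 \<le> 0"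
    by (metis distrib_right mult_nonpos_nonneg zero_le_power2)
  then have "b\<^sup>2 * (d + c) \<le> 0" using \<open>d > 0\<close>
    by (simp add: power2_eq_square field_simps)
  then show False using \<open>b \<noteq> 0\<close> \<open>- c < d\<close> by (simp add: mult_le_0_iff)
qed

text \<open>First variation: along the line x + t y the defect of the Rayleigh bound is a quadratic
  in t without constant term, so its linear coefficient vanishes. Maximality is required in the
  direction \<open>y\<close> only, so that it may come from a constrained maximum.\<close>

lemma rayleigh_maximizer_orthogonal:
  assumes sym: "\<And>v w. v \<in> V \<Longrightarrow> w \<in> V \<Longrightarrow> a v w = a w v"
    and max: "\<And>t. quad_form V a (\<lambda>v. x v + t * y v)
      \<le> \<mu> * inner_on V (\<lambda>v. x v + t * y v) (\<lambda>v. x v + t * y v)"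
    and eq: "quad_form V a x = \<mu> * inner_on V x x"
  shows "inner_on V y (\<lambda>v. kernel_op V a x v - \<mu> * x v) = 0"
proof -
  have "t * (2 * (inner_on V x (kernel_op V a y) - \<mu> * inner_on V x y))
      + t\<^sup>2 * (quad_form V a y - \<mu> * inner_on V y y) \<le> 0" for t
    using max[of t] eq quad_form_add[of V a 1 x t y, OF sym] inner_on_add_square[of V 1 x t y]
    by (simp add: algebra_simps)
  then have "inner_on V x (kernel_op V a y) - \<mu> * inner_on V x y = 0"
    using quadratic_nonpos_imp_linear_zero by fastforce
  then show ?thesis
    using kernel_op_symmetric[of V a x y, OF sym]
    by (simp add: inner_on_diff inner_on_scale inner_on_commute)
qed

lemma rayleigh_scale:
  assumes "finite V"
    and "\<And>y. inner_on V y y = 1 \<Longrightarrow> (\<And>i. i < k \<Longrightarrow> inner_on V y (e i) = 0) \<Longrightarrow> quad_form V a y \<le> \<mu>"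
    and "\<And>i. i < (k::nat) \<Longrightarrow> inner_on V y (e i) = 0"
  shows "quad_form V a y \<le> \<mu> * inner_on V y y"
proof (cases "inner_on V y y = 0")
  case True
  then have "\<And>v. v \<in> V \<Longrightarrow> y v = 0" using \<open>finite V\<close> by (simp add: inner_on_self_eq_0_iff)
  then show ?thesis by (simp add: inner_on_def)
next
  case False
  define s where "s = sqrt (inner_on V y y)"
  have s: "s > 0" "s\<^sup>2 = inner_on V y y"
    using False inner_on_self_nonneg[of V y] by (auto simp: s_def less_le)
  have "quad_form V a (\<lambda>v. (1 / s) * y v) \<le> \<mu>"
  proof (rule assms(2))
    show "inner_on V (\<lambda>v. (1 / s) * y v) (\<lambda>v. (1 / s) * y v) = 1"
      unfolding inner_on_scale s(2)[symmetric] using s(1) by (simp add: power2_eq_square)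
    show "inner_on V (\<lambda>v. (1 / s) * y v) (e i) = 0" if "i < k" for i
      unfolding inner_on_scale using assms(3)[OF that] by simp
  qed
  then have "quad_form V a y / s\<^sup>2 \<le> \<mu>"
    unfolding kernel_op_scale inner_on_scale by (simp add: power2_eq_square)
  then have "quad_form V a y \<le> \<mu> * s\<^sup>2" using s(1) by (simp add: pos_divide_le_eq)
  then show ?thesis by (simp only: s(2))
qed

text \<open>The point vectors of \<open>V\<close> have projections onto the span of the
  \<open>e i\<close> whose squared lengths sum to \<open>k\<close>, which is less than
  \<open>card V\<close>. So some point vector has a projection shorter than 1, and its residual can
  be normalized.\<close>

lemma orthonormal_extension_exists:
  assumes "finite V" "k < card V"
    and on: "\<And>i j. i < k \<Longrightarrow> j < k \<Longrightarrow> inner_on V (e i) (e j) = (if i = j then 1 else 0)"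
  obtains z where "inner_on V z z = 1" "\<And>i. i < (k::nat) \<Longrightarrow> inner_on V z (e i) = 0"
proof -
  have "(\<Sum>v\<in>V. \<Sum>i<k. (e i v)\<^sup>2) = (\<Sum>i<k. inner_on V (e i) (e i))"
    by (subst sum.swap) (simp add: inner_on_def power2_eq_square)
  also have "\<dots> = real k" using on by simp
  also have "\<dots> < (\<Sum>v\<in>V. 1)" using \<open>k < card V\<close> by simp
  finally obtain u where u: "u \<in> V" "(\<Sum>i<k. (e i u)\<^sup>2) < 1"
    by (metis (no_types, lifting) linorder_not_less sum_mono)
  define y where "y v = (if v = u then 1 else 0) - (\<Sum>i<k. e i u * e i v)" for v
  have \<delta>: "inner_on V (\<lambda>v. if v = u then 1 else 0) f = f u" for f
    using u(1) \<open>finite V\<close> by (simp add: inner_on_def if_distrib[of "\<lambda>x. x * _"] cong: if_cong)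
  have orth: "inner_on V y (e j) = 0" if "j < k" for j
  proof -
    have "(\<Sum>i<k. e i u * inner_on V (e i) (e j)) = (\<Sum>i<k. if i = j then e i u else 0)"
      using on that by (intro sum.cong) auto
    then show ?thesis using that by (simp add: y_def[abs_def] inner_on_diff inner_on_sum inner_on_scale \<delta>)
  qed
  have "inner_on V y y = y u - (\<Sum>i<k. e i u * inner_on V y (e i))"
    by (subst (2) y_def[abs_def]) (simp add: inner_on_diff inner_on_sum inner_on_scale \<delta>
        inner_on_commute[of V y "\<lambda>v. if v = u then 1 else 0"])
  also have "\<dots> = 1 - (\<Sum>i<k. (e i u)\<^sup>2)"
    using orth by (simp add: y_def power2_eq_square)
  finally have pos: "inner_on V y y > 0" using u by simp
  define s where "s = sqrt (inner_on V y y)"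
  have s: "s > 0" "s\<^sup>2 = inner_on V y y" using pos by (auto simp: s_def)
  show thesis
  proof (rule that)
    show "inner_on V (\<lambda>v. (1 / s) * y v) (\<lambda>v. (1 / s) * y v) = 1"
      unfolding inner_on_scale s(2)[symmetric] using s(1) by (simp add: power2_eq_square)
    show "inner_on V (\<lambda>v. (1 / s) * y v) (e i) = 0" if "i < k" for i
      unfolding inner_on_scale using orth[OF that] by simp
  qed
qed

text \<open>The third clause is the variational half of the min-max principle and also forces the
  descending order of \<open>\<mu>\<close>. The length \<open>k\<close> may be smaller than the
  dimension because the basis is built one vector at a time.\<close>

definition eigenbasis ::
  "'a set \<Rightarrow> ('a \<Rightarrow> 'a \<Rightarrow> real) \<Rightarrow> nat \<Rightarrow> (nat \<Rightarrow> 'a \<Rightarrow> real) \<Rightarrow> (nat \<Rightarrow> real) \<Rightarrow> bool" where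
  "eigenbasis V a k e \<mu> \<longleftrightarrow>
     (\<forall>i<k. \<forall>j<k. inner_on V (e i) (e j) = (if i = j then 1 else 0)) \<and>
     (\<forall>i<k. \<forall>v\<in>V. kernel_op V a (e i) v = \<mu> i * e i v) \<and>
     (\<forall>i<k. \<forall>x. (\<forall>j<i. inner_on V x (e j) = 0) \<longrightarrow> quad_form V a x \<le> \<mu> i * inner_on V x x)"

text \<open>Let \<open>x\<close> maximize the form on the unit vectors orthogonal to the earlier
  eigenvectors, with maximum m. By symmetry the residual A x - m x is orthogonal to them as well. It
  is thus an admissible direction, and the first variation along it says that its own norm is
  0.\<close>

lemma eigenbasis_exists:
  assumes "finite V" and sym: "\<And>v w. v \<in> V \<Longrightarrow> w \<in> V \<Longrightarrow> a v w = a w v"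
  shows "k \<le> card V \<Longrightarrow> \<exists>e \<mu>. eigenbasis V a k e \<mu>"
proof (induction k)
  case 0
  show ?case by (simp add: eigenbasis_def)
next
  case (Suc k)
  then obtain e \<mu> where IH: "eigenbasis V a k e \<mu>" by auto
  then have on: "\<And>i j. i < k \<Longrightarrow> j < k \<Longrightarrow> inner_on V (e i) (e j) = (if i = j then 1 else 0)"
    and ev: "\<And>i v. i < k \<Longrightarrow> v \<in> V \<Longrightarrow> kernel_op V a (e i) v = \<mu> i * e i v"
    and ray: "\<And>i x. i < k \<Longrightarrow> (\<forall>j<i. inner_on V x (e j) = 0) \<Longrightarrow> quad_form V a x \<le> \<mu> i * inner_on V x x"
    by (auto simp: eigenbasis_def)
  obtain z where z: "inner_on V z z = 1" "\<And>i. i < k \<Longrightarrow> inner_on V z (e i) = 0"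
    using orthonormal_extension_exists[OF \<open>finite V\<close> _ on, of k] Suc.prems by auto
  obtain x where x: "inner_on V x x = 1" "\<forall>i<k. inner_on V x (e i) = 0"
    "\<forall>y. inner_on V y y = 1 \<and> (\<forall>i<k. inner_on V y (e i) = 0) \<longrightarrow> quad_form V a y \<le> quad_form V a x"
    using rayleigh_maximum_exists[where a = a and e = e and k = k, OF \<open>finite V\<close> z] by blast
  define m where "m = quad_form V a x"
  have max: "quad_form V a y \<le> m * inner_on V y y" if "\<And>i. i < k \<Longrightarrow> inner_on V y (e i) = 0" for y
    unfolding m_def by (rule rayleigh_scale[where e = e and k = k]) (use x(3) \<open>finite V\<close> that in blast)+
  define y where "y v = kernel_op V a x v - m * x v" for v
  have y_orth: "inner_on V y (e i) = 0" if "i < k" for i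
  proof -
    have "inner_on V (kernel_op V a x) (e i) = inner_on V x (kernel_op V a (e i))"
      using kernel_op_symmetric[of V a x "e i", OF sym] by simp
    also have "\<dots> = inner_on V x (\<lambda>v. \<mu> i * e i v)" using ev that by (intro inner_on_cong) auto
    also have "\<dots> = 0" using x(2) that by (simp add: inner_on_scale)
    finally show ?thesis using x(2) that by (simp add: y_def[abs_def] inner_on_diff inner_on_scale)
  qed
  have "inner_on V y (\<lambda>v. kernel_op V a x v - m * x v) = 0"
  proof (rule rayleigh_maximizer_orthogonal[OF sym])
    fix t
    show "quad_form V a (\<lambda>v. x v + t * y v)
        \<le> m * inner_on V (\<lambda>v. x v + t * y v) (\<lambda>v. x v + t * y v)"
      by (rule max) (simp add: inner_on_add inner_on_scale x(2) y_orth)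
    show "quad_form V a x = m * inner_on V x x" by (simp add: m_def x(1))
  qed auto
  then have "inner_on V y y = 0" by (simp add: y_def[abs_def])
  then have "\<And>v. v \<in> V \<Longrightarrow> kernel_op V a x v = m * x v"
    using \<open>finite V\<close> by (simp add: inner_on_self_eq_0_iff y_def)
  then have "eigenbasis V a (Suc k) (e(k := x)) (\<mu>(k := m))"
    unfolding eigenbasis_def
  proof (intro conjI allI impI ballI)
    fix i j assume "i < Suc k" "j < Suc k"
    then consider "i < k" "j < k" | "i < k" "j = k" | "i = k" "j < k" | "i = k" "j = k" by linarith
    then show "inner_on V ((e(k := x)) i) ((e(k := x)) j) = (if i = j then 1 else 0)"
    proof cases
      case 2
      then show ?thesis using x(2) inner_on_commute[of V "e i" x] by simp
    qed (use on x(1,2) in simp_all)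
  next
    fix i v assume "i < Suc k" "v \<in> V"
    then show "kernel_op V a ((e(k := x)) i) v = (\<mu>(k := m)) i * (e(k := x)) i v"
      using ev \<open>\<And>v. v \<in> V \<Longrightarrow> kernel_op V a x v = m * x v\<close> by (cases "i = k") simp_all
  next
    fix i y assume i: "i < Suc k" and y: "\<forall>j<i. inner_on V y ((e(k := x)) j) = 0"
    show "quad_form V a y \<le> (\<mu>(k := m)) i * inner_on V y y"
    proof (cases "i = k")
      case True
      then show ?thesis using y max[of y] by simp
    next
      case False
      then show ?thesis using i y ray[of i y] by simp
    qed
  qed
  then show ?case by blast
qed

text \<open>Orthonormal columns give orthonormal rows: the squared norms of the residuals of all
  point vectors are non-negative and sum to \<open>card V\<close> minus
  \<open>card V\<close>.\<close>

lemma eigenbasis_complete: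
  assumes "finite V" and basis: "eigenbasis V a (card V) e \<mu>" and "u \<in> V" "v \<in> V"
  shows "(\<Sum>i<card V. e i u * e i v) = (if u = v then 1 else 0)"
proof -
  let ?n = "card V"
  have on: "inner_on V (e i) (e j) = (if i = j then 1 else 0)" if "i < ?n" "j < ?n" for i j
    using basis that by (simp add: eigenbasis_def)
  define y where "y u v = (if v = u then 1 else 0) - (\<Sum>i<?n. e i u * e i v)" for u v
  have \<delta>: "inner_on V (\<lambda>v. if v = u then 1 else 0) f = f u" if "u \<in> V" for u f
    using that \<open>finite V\<close> by (simp add: inner_on_def if_distrib[of "\<lambda>x. x * _"] cong: if_cong)
  have sq: "inner_on V (y u) (y u) = 1 - (\<Sum>i<?n. (e i u)\<^sup>2)" if "u \<in> V" for u
  proof -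
    have orth: "inner_on V (y u) (e j) = 0" if "j < ?n" for j
    proof -
      have "(\<Sum>i<?n. e i u * inner_on V (e i) (e j)) = (\<Sum>i<?n. if i = j then e i u else 0)"
        using on that by (intro sum.cong) auto
      then show ?thesis using that \<open>u \<in> V\<close>
        by (simp add: y_def[abs_def] inner_on_diff inner_on_sum inner_on_scale \<delta>)
    qed
    have "inner_on V (y u) (y u) = y u u - (\<Sum>i<?n. e i u * inner_on V (y u) (e i))"
      by (subst (2) y_def[abs_def]) (simp add: inner_on_diff inner_on_sum inner_on_scale \<delta> that
        inner_on_commute[of V "y u" "\<lambda>v. if v = u then 1 else 0"])
    then show ?thesis using orth by (simp add: y_def power2_eq_square)
  qed
  have "(\<Sum>u\<in>V. inner_on V (y u) (y u)) = (\<Sum>u\<in>V. 1 - (\<Sum>i<?n. (e i u)\<^sup>2))" using sq by simp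
  also have "\<dots> = real ?n - (\<Sum>i<?n. inner_on V (e i) (e i))"
    by (simp add: sum_subtractf inner_on_def power2_eq_square sum.swap[of _ V])
  also have "\<dots> = 0" using on by simp
  finally have "inner_on V (y u) (y u) = 0"
    using \<open>finite V\<close> \<open>u \<in> V\<close> by (simp add: sum_nonneg_eq_0_iff inner_on_self_nonneg)
  then show ?thesis using \<open>finite V\<close> \<open>v \<in> V\<close> by (auto simp: inner_on_self_eq_0_iff y_def)
qed


lemma eigenbasis_antimono:
  assumes "eigenbasis V a n e \<mu>" "i \<le> j" "j < n"
  shows "\<mu> j \<le> \<mu> i"
proof (cases "i = j")
  case False
  have "quad_form V a (e j) = inner_on V (e j) (\<lambda>v. \<mu> j * e j v)"
    using assms by (intro inner_on_cong) (auto simp: eigenbasis_def)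
  then have "quad_form V a (e j) = \<mu> j" "inner_on V (e j) (e j) = 1"
    using assms by (simp_all add: inner_on_scale eigenbasis_def)
  moreover have "quad_form V a (e j) \<le> \<mu> i * inner_on V (e j) (e j)"
  proof -
    have "\<forall>k<i. inner_on V (e j) (e k) = 0" using assms by (auto simp: eigenbasis_def)
    moreover have "i < n" using assms by simp
    ultimately show ?thesis using assms(1) unfolding eigenbasis_def by blast
  qed
  ultimately show ?thesis by simp
qed simp

text \<open>The orthogonal matrix with the eigenvectors as columns conjugates the matrix of the
  kernel into a diagonal one.\<close>

lemma char_poly_eigenbasis:
  assumes "distinct xs" "n = length xs"
    and basis: "eigenbasis (set xs) a n e \<mu>"
  shows "char_poly (mat n n (\<lambda>(i, j). a (xs ! i) (xs ! j))) = (\<Prod>i\<leftarrow>[0..<n]. [:- \<mu> i, 1:])"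
proof -
  let ?V = "set xs"
  define A where "A = mat n n (\<lambda>(i, j). a (xs ! i) (xs ! j))"
  define U where "U = mat n n (\<lambda>(i, j). e j (xs ! i))"
  define D where "D = mat n n (\<lambda>(i, j). if i = j then \<mu> i else 0)"
  have card: "card ?V = n" using assms by (simp add: distinct_card)
  have sum_V: "(\<Sum>v\<in>?V. f v) = (\<Sum>k = 0..<n. f (xs ! k))" for f :: "_ \<Rightarrow> real"
    using assms(1,2) by (simp add: sum.distinct_set_conv_list sum_list_sum_nth)
  have carrier: "A \<in> carrier_mat n n" "U \<in> carrier_mat n n" "D \<in> carrier_mat n n"
    "transpose_mat U \<in> carrier_mat n n"
    by (auto simp: A_def U_def D_def)
  have UU: "U * transpose_mat U = 1\<^sub>m n"
  proof (rule eq_matI)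
    fix i j assume ij: "i < dim_row (1\<^sub>m n :: real mat)" "j < dim_col (1\<^sub>m n :: real mat)"
    then have "(\<Sum>k<n. e k (xs ! i) * e k (xs ! j)) = (if i = j then 1 else 0)"
      using eigenbasis_complete[of ?V a e \<mu> "xs ! i" "xs ! j"] basis assms(1,2) card
      by (simp add: nth_eq_iff_index_eq)
    then show "(U * transpose_mat U) $$ (i, j) = 1\<^sub>m n $$ (i, j)"
      using ij by (simp add: U_def scalar_prod_def atLeast0LessThan)
  qed (auto simp: U_def)
  have U'U: "transpose_mat U * U = 1\<^sub>m n"
    using mat_mult_left_right_inverse[OF carrier(2) carrier(4) UU] .
  have AU: "A * U = U * D"
  proof (rule eq_matI)
    fix i j assume ij: "i < dim_row (U * D)" "j < dim_col (U * D)"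
    then have ij: "i < n" "j < n" by (auto simp: U_def D_def)
    have "(A * U) $$ (i, j) = kernel_op ?V a (e j) (xs ! i)"
      using ij by (simp add: A_def U_def scalar_prod_def kernel_op_def sum_V)
    also have "\<dots> = \<mu> j * e j (xs ! i)"
      using basis ij assms(2) by (simp add: eigenbasis_def)
    also have "\<dots> = (\<Sum>k = 0..<n. e k (xs ! i) * (if k = j then \<mu> k else 0))"
      using ij by (simp add: if_distrib[of "\<lambda>x. _ * x"] cong: if_cong)
    also have "\<dots> = (U * D) $$ (i, j)"
      using ij by (simp add: U_def D_def scalar_prod_def)
    finally show "(A * U) $$ (i, j) = (U * D) $$ (i, j)" .
  qed (auto simp: A_def U_def D_def)
  have "A = A * (U * transpose_mat U)" using UU carrier by simp
  also have "\<dots> = A * U * transpose_mat U" using carrier by simp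
  also have "\<dots> = U * D * transpose_mat U" by (simp only: AU)
  finally have "similar_mat A D"
    using carrier UU U'U by (intro similar_matI[of A D U "transpose_mat U" n]) auto
  then have "char_poly A = char_poly D" by (rule char_poly_similar)
  also have "\<dots> = (\<Prod>a\<leftarrow>diag_mat D. [:- a, 1:])"
    using carrier(3) by (rule char_poly_upper_triangular) (auto simp: D_def upper_triangular_def)
  also have "diag_mat D = map \<mu> [0..<n]"
    by (auto simp: diag_mat_def D_def intro!: map_cong)
  finally show ?thesis by (simp add: A_def o_def)
qed

section \<open>Adjacency eigenvalues\<close>

definition adj :: "'a pair_pre_digraph \<Rightarrow> 'a \<Rightarrow> 'a \<Rightarrow> real" where
  "adj G v w = (if (v, w) \<in> parcs G then 1 else 0)"

abbreviation graph_form :: "'a pair_pre_digraph \<Rightarrow> ('a \<Rightarrow> real) \<Rightarrow> real" where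
  "graph_form G \<equiv> quad_form (pverts G) (adj G)"

abbreviation graph_op :: "'a pair_pre_digraph \<Rightarrow> ('a \<Rightarrow> real) \<Rightarrow> 'a \<Rightarrow> real" where
  "graph_op G \<equiv> kernel_op (pverts G) (adj G)"

abbreviation sq_norm :: "'a set \<Rightarrow> ('a \<Rightarrow> real) \<Rightarrow> real" where
  "sq_norm V x \<equiv> inner_on V x x"

lemma pair_graph_iff:
  "pair_graph G \<longleftrightarrow> finite (pverts G) \<and> parcs G \<subseteq> pverts G \<times> pverts G \<and> sym (parcs G) \<and> irrefl (parcs G)"
proof
  assume "pair_graph G"
  then interpret pair_graph G .
  show "finite (pverts G) \<and> parcs G \<subseteq> pverts G \<times> pverts G \<and> sym (parcs G) \<and> irrefl (parcs G)"
    using pair_finite_verts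
    by (auto simp: irrefl_def dest: in_arcsD1 in_arcsD2 no_loops' intro!: symI arcs_symmetric)
next
  assume *: "finite (pverts G) \<and> parcs G \<subseteq> pverts G \<times> pverts G \<and> sym (parcs G) \<and> irrefl (parcs G)"
  then have "finite (parcs G)" using finite_subset[of "parcs G" "pverts G \<times> pverts G"] by simp
  with * show "pair_graph G"
    by unfold_locales (force simp: symmetric_def irrefl_def)+
qed

lemma
  assumes "pair_graph G"
  shows finite_pverts: "finite (pverts G)"
    and parcs_in_pverts: "(u, v) \<in> parcs G \<Longrightarrow> u \<in> pverts G" "(u, v) \<in> parcs G \<Longrightarrow> v \<in> pverts G"
    and parcs_sym: "(u, v) \<in> parcs G \<Longrightarrow> (v, u) \<in> parcs G"
    and parcs_irrefl: "(u, u) \<notin> parcs G"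
proof -
  have *: "finite (pverts G)" "parcs G \<subseteq> pverts G \<times> pverts G" "sym (parcs G)" "irrefl (parcs G)"
    using assms by (simp_all add: pair_graph_iff)
  show "finite (pverts G)" by fact
  show "u \<in> pverts G" "v \<in> pverts G" if "(u, v) \<in> parcs G" using that *(2) by auto
  show "(v, u) \<in> parcs G" if "(u, v) \<in> parcs G" using *(3) that by (rule symD)
  show "(u, u) \<notin> parcs G" using *(4) by (simp add: irrefl_def)
qed

lemma adj_sym: "pair_graph G \<Longrightarrow> adj G v w = adj G w v"
  using parcs_sym[of G v w] parcs_sym[of G w v] by (auto simp: adj_def)

lemma adj_nonneg: "adj G v w \<ge> 0" by (simp add: adj_def)

text \<open>Bridge from \<open>eigval\<close> to the variational eigenbasis: the roots and the
  values \<open>\<mu> i\<close> agree as multisets, and both lists are descending, so they agree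
  entry by entry.\<close>

lemma adjacency_eigenbasis:
  assumes "pair_graph G"
  obtains e \<mu> where "eigenbasis (pverts G) (adj G) (card (pverts G)) e \<mu>"
    "\<forall>i<card (pverts G). eigval (Suc i) G = \<mu> i"
proof -
  let ?V = "pverts G" and ?n = "card (pverts G)"
  obtain e \<mu> where basis: "eigenbasis ?V (adj G) ?n e \<mu>"
    using eigenbasis_exists[OF finite_pverts[OF assms], of "adj G" ?n] adj_sym[OF assms] by auto
  define xs where "xs = vertex_list G"
  have "\<exists>xs. distinct xs \<and> set xs = ?V" using finite_distinct_list[OF finite_pverts[OF assms]] by auto
  then have "distinct xs \<and> set xs = ?V" unfolding xs_def vertex_list_def by (rule someI_ex)
  then have xs: "distinct xs" "set xs = ?V" "length xs = ?n" using distinct_card by fastforce+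
  have "adjacency_matrix G = mat ?n ?n (\<lambda>(i, j). adj G (xs ! i) (xs ! j))"
    using xs(3) by (simp add: adjacency_matrix_def adj_def Let_def flip: xs_def)
  then have "char_poly (adjacency_matrix G) = (\<Prod>i\<leftarrow>[0..<?n]. [:- \<mu> i, 1:])"
    using char_poly_eigenbasis[of xs ?n "adj G" e \<mu>] xs basis by simp
  also have "\<dots> = (\<Prod>i\<in>{0..<?n}. [:- \<mu> i, 1:])" by (simp add: prod.list_conv_set_nth prod.distinct_set_conv_list)
  finally have "proots (char_poly (adjacency_matrix G)) = (\<Sum>i\<in>{0..<?n}. {#\<mu> i#})"
    by (simp add: proots_prod)
  also have "\<dots> = mset (rev (map \<mu> [0..<?n]))"
    by (simp add: sum_unfold_sum_mset)
  finally have "adjacency_eigenvalues G = rev (sort (rev (map \<mu> [0..<?n])))"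
    by (simp only: adjacency_eigenvalues_def sorted_list_of_multiset_mset)
  moreover have "sorted (rev (map \<mu> [0..<?n]))"
    using eigenbasis_antimono[OF basis] by (auto simp: sorted_rev_iff_nth_mono)
  ultimately have "adjacency_eigenvalues G = map \<mu> [0..<?n]"
    by (metis rev_rev_ident sorted_sort_id)
  then show thesis using basis by (intro that[of e \<mu>]) (simp_all add: eigval_def)
qed

lemma graph_form_le:
  assumes "pair_graph G" "pverts G \<noteq> {}"
  shows "graph_form G x \<le> spectral_radius G * sq_norm (pverts G) x"
proof -
  obtain e \<mu> where "eigenbasis (pverts G) (adj G) (card (pverts G)) e \<mu>"
    and "\<forall>i<card (pverts G). eigval (Suc i) G = \<mu> i"
    using adjacency_eigenbasis[OF assms(1)] .
  moreover have "card (pverts G) > 0" using assms finite_pverts by (simp add: card_gt_0_iff)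
  ultimately show ?thesis by (auto simp: eigenbasis_def)
qed

text \<open>Equality in the Rayleigh bound makes the first variation vanish in every direction, in
  particular along the residual.\<close>

lemma maximal_imp_eigenvector:
  assumes "pair_graph G" "pverts G \<noteq> {}"
    and ge: "graph_form G x \<ge> spectral_radius G * sq_norm (pverts G) x"
    and "v \<in> pverts G"
  shows "graph_op G x v = spectral_radius G * x v"
proof -
  define y where "y = (\<lambda>v. graph_op G x v - spectral_radius G * x v)"
  have eq: "graph_form G x = spectral_radius G * sq_norm (pverts G) x"
    using ge graph_form_le[OF assms(1,2), of x] by simp
  have "inner_on (pverts G) y (\<lambda>v. graph_op G x v - spectral_radius G * x v) = 0"
    using graph_form_le[OF assms(1,2)] adj_sym[OF assms(1)] eq
    by (intro rayleigh_maximizer_orthogonal) auto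
  then have "inner_on (pverts G) y y = 0" by (simp add: y_def)
  then show ?thesis
    using assms finite_pverts[OF assms(1)] by (simp add: inner_on_self_eq_0_iff y_def)
qed

lemma graph_form_mono_abs: "graph_form G x \<le> graph_form G (\<lambda>v. \<bar>x v\<bar>)"
  unfolding inner_on_def kernel_op_def
proof (rule sum_mono)
  fix v
  have "x v * (\<Sum>w\<in>pverts G. adj G v w * x w) \<le> \<bar>x v * (\<Sum>w\<in>pverts G. adj G v w * x w)\<bar>" by simp
  also have "\<dots> = \<bar>x v\<bar> * \<bar>\<Sum>w\<in>pverts G. adj G v w * x w\<bar>" by (simp add: abs_mult)
  also have "\<dots> \<le> \<bar>x v\<bar> * (\<Sum>w\<in>pverts G. \<bar>adj G v w * x w\<bar>)"
    by (intro mult_left_mono sum_abs) simp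
  finally show "x v * (\<Sum>w\<in>pverts G. adj G v w * x w) \<le> \<bar>x v\<bar> * (\<Sum>w\<in>pverts G. adj G v w * \<bar>x w\<bar>)"
    by (simp add: abs_mult adj_nonneg)
qed

lemma sq_norm_abs: "sq_norm V (\<lambda>v. \<bar>x v\<bar>) = sq_norm V x"
  by (simp add: inner_on_def)

text \<open>Taking absolute values keeps the norm and does not decrease the form, so the absolute
  value of a top eigenvector is again one. Non-negativity holds on the whole type, which is the form
  needed when vectors are extended by 0.\<close>

lemma spectral_radius_eigenvector:
  assumes "pair_graph G" "pverts G \<noteq> {}"
  obtains x where "sq_norm (pverts G) x = 1" "\<forall>v. x v \<ge> 0"
    "\<forall>v\<in>pverts G. graph_op G x v = spectral_radius G * x v"
proof -
  let ?V = "pverts G"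
  obtain e \<mu> where basis: "eigenbasis (pverts G) (adj G) (card (pverts G)) e \<mu>"
    and ev: "\<forall>i<card (pverts G). eigval (Suc i) G = \<mu> i"
    using adjacency_eigenbasis[OF assms(1)] .
  have n: "card ?V > 0" using assms finite_pverts by (simp add: card_gt_0_iff)
  have "sq_norm ?V (e 0) = 1" using basis n by (simp add: eigenbasis_def)
  have "graph_form G (e 0) = inner_on ?V (e 0) (\<lambda>v. spectral_radius G * e 0 v)"
    using basis n ev by (intro inner_on_cong) (auto simp: eigenbasis_def)
  also have "\<dots> = spectral_radius G" using \<open>sq_norm ?V (e 0) = 1\<close> by (simp add: inner_on_scale)
  finally have "graph_form G (\<lambda>v. \<bar>e 0 v\<bar>) \<ge> spectral_radius G" using graph_form_mono_abs by metis
  then show thesis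
    using \<open>sq_norm ?V (e 0) = 1\<close> maximal_imp_eigenvector[OF assms, of "\<lambda>v. \<bar>e 0 v\<bar>"]
    by (intro that[of "\<lambda>v. \<bar>e 0 v\<bar>"]) (simp_all add: sq_norm_abs)
qed

section \<open>Min-max bounds for the second eigenvalue\<close>

lemma second_eigenvector:
  assumes "pair_graph G" "card (pverts G) \<ge> 2"
  obtains x y where "sq_norm (pverts G) x = 1" "sq_norm (pverts G) y = 1" "inner_on (pverts G) x y = 0"
    "\<forall>v\<in>pverts G. graph_op G y v = spectral_radius G * y v"
    "\<forall>v\<in>pverts G. graph_op G x v = eigval 2 G * x v"
    "\<forall>z. inner_on (pverts G) z y = 0 \<longrightarrow> graph_form G z \<le> eigval 2 G * sq_norm (pverts G) z"
    "eigval 2 G \<le> spectral_radius G"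
proof -
  let ?V = "pverts G"
  obtain e \<mu> where basis: "eigenbasis (pverts G) (adj G) (card (pverts G)) e \<mu>"
    and ev: "\<forall>i<card (pverts G). eigval (Suc i) G = \<mu> i"
    using adjacency_eigenbasis[OF assms(1)] .
  have n: "0 < card ?V" "1 < card ?V" using assms(2) by auto
  have \<mu>: "spectral_radius G = \<mu> 0" "eigval 2 G = \<mu> 1"
    using ev n by (auto simp: numeral_2_eq_2)
  show thesis
  proof (rule that[of "e 1" "e 0"])
    have "graph_form G z \<le> \<mu> 1 * sq_norm ?V z" if "inner_on ?V z (e 0) = 0" for z
    proof -
      have "\<forall>j<1. inner_on ?V z (e j) = 0" using that by simp
      then show ?thesis using basis n(2) unfolding eigenbasis_def by blast
    qed
    then show "\<forall>z. inner_on ?V z (e 0) = 0 \<longrightarrow> graph_form G z \<le> eigval 2 G * sq_norm ?V z"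
      by (simp add: \<mu>)
    show "eigval 2 G \<le> spectral_radius G" using eigenbasis_antimono[OF basis, of 0 1] n \<mu> by simp
  qed (use basis n \<mu> in \<open>simp_all add: eigenbasis_def\<close>)
qed

text \<open>A combination of \<open>p\<close> and \<open>q\<close> with coefficients not both 0 can
  be made orthogonal to the top eigenvector, and there the form is bounded by the second
  eigenvalue.\<close>

lemma second_eigenvalue_test_vector:
  assumes "pair_graph G" "card (pverts G) \<ge> 2"
  obtains s t where "(s, t) \<noteq> (0, 0::real)"
    "graph_form G (\<lambda>v. s * p v + t * q v)
       \<le> eigval 2 G * sq_norm (pverts G) (\<lambda>v. s * p v + t * q v)"
proof -
  obtain x y where y: "\<forall>z. inner_on (pverts G) z y = 0 \<longrightarrow> graph_form G z \<le> eigval 2 G * sq_norm (pverts G) z"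
    by (rule second_eigenvector[OF assms])
  show thesis
  proof (cases "inner_on (pverts G) p y = 0")
    case True
    then show ?thesis by (intro that[of 1 0] y[rule_format]) (simp_all add: inner_on_add inner_on_scale)
  next
    case False
    let ?s = "inner_on (pverts G) q y" and ?t = "- inner_on (pverts G) p y"
    have "inner_on (pverts G) (\<lambda>v. ?s * p v + ?t * q v) y
        = ?s * inner_on (pverts G) p y + ?t * inner_on (pverts G) q y"
      unfolding inner_on_add inner_on_scale ..
    also have "\<dots> = 0" by simp
    finally have "graph_form G (\<lambda>v. ?s * p v + ?t * q v)
        \<le> eigval 2 G * sq_norm (pverts G) (\<lambda>v. ?s * p v + ?t * q v)"
      using y by blast
    then show ?thesis by (rule that[rotated]) (use False in simp)
  qed
qed

text \<open>A strict inequality at every pair other than (0, 0) already makes \<open>p\<close> and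
  \<open>q\<close> independent on the vertices, so no norm condition accompanies it.\<close>

lemma second_eigenvalue_gt:
  assumes "pair_graph G" "card (pverts G) \<ge> 2"
    and "\<And>s t. (s, t) \<noteq> (0, 0) \<Longrightarrow> graph_form G (\<lambda>v. s * p v + t * q v)
       > \<mu> * sq_norm (pverts G) (\<lambda>v. s * p v + t * q v)"
  shows "eigval 2 G > \<mu>"
proof -
  obtain s t where st: "(s, t) \<noteq> (0, 0::real)"
    "graph_form G (\<lambda>v. s * p v + t * q v)
       \<le> eigval 2 G * sq_norm (pverts G) (\<lambda>v. s * p v + t * q v)"
    using second_eigenvalue_test_vector[OF assms(1,2)] .
  then have "\<mu> * sq_norm (pverts G) (\<lambda>v. s * p v + t * q v)
      < eigval 2 G * sq_norm (pverts G) (\<lambda>v. s * p v + t * q v)"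
    using assms(3) by (meson less_le_trans)
  then show ?thesis
    using inner_on_self_nonneg by (rule mult_right_less_imp_less)
qed

text \<open>The strict version is applied to \<mu> - \<epsilon>; positivity of the norm is what
  turns the weak inequality into a strict one.\<close>

lemma second_eigenvalue_ge:
  assumes "pair_graph G" "card (pverts G) \<ge> 2"
    and "\<And>s t. (s, t) \<noteq> (0, 0) \<Longrightarrow> graph_form G (\<lambda>v. s * p v + t * q v)
       \<ge> \<mu> * sq_norm (pverts G) (\<lambda>v. s * p v + t * q v)"
    and "\<And>s t. (s, t) \<noteq> (0, 0) \<Longrightarrow> sq_norm (pverts G) (\<lambda>v. s * p v + t * q v) > 0"
  shows "eigval 2 G \<ge> \<mu>"
proof -
  have "\<mu> - \<epsilon> < eigval 2 G" if "\<epsilon> > 0" for \<epsilon>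
  proof (rule second_eigenvalue_gt[OF assms(1,2), of "\<mu> - \<epsilon>" p q])
    fix s t :: real assume "(s, t) \<noteq> (0, 0)"
    then show "graph_form G (\<lambda>v. s * p v + t * q v)
       > (\<mu> - \<epsilon>) * sq_norm (pverts G) (\<lambda>v. s * p v + t * q v)"
      using assms(3)[of s t] mult_pos_pos[OF \<open>\<epsilon> > 0\<close> assms(4)[of s t]] by (simp add: left_diff_distrib)
  qed
  then show ?thesis by (meson diff_less_eq field_le_epsilon less_imp_le)
qed

section \<open>Isomorphisms and embeddings\<close>

text \<open>\<open>digraph_iso\<close> carries a separate map on arcs. As arcs are pairs of vertices
  here, the vertex map determines it and is all that is kept.\<close>

definition graph_bij :: "('a \<Rightarrow> 'b) \<Rightarrow> 'a pair_pre_digraph \<Rightarrow> 'b pair_pre_digraph \<Rightarrow> bool" where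
  "graph_bij f G K \<longleftrightarrow> bij_betw f (pverts G) (pverts K) \<and>
     (\<forall>u\<in>pverts G. \<forall>v\<in>pverts G. (u, v) \<in> parcs G \<longleftrightarrow> (f u, f v) \<in> parcs K)"

text \<open>Assumes only that arcs run between vertices, because the subgraphs in
  \<open>contains_copy\<close> and the values of \<open>add_vertex\<close> are not known to satisfy
  \<open>pair_graph\<close> where it is applied.\<close>

lemma graph_iso_iff:
  assumes G: "parcs G \<subseteq> pverts G \<times> pverts G" and K: "parcs K \<subseteq> pverts K \<times> pverts K"
  shows "G \<cong>\<^sub>G K \<longleftrightarrow> (\<exists>f. graph_bij f G K)"
proof
  assume "G \<cong>\<^sub>G K"
  then obtain h where h: "pre_digraph.digraph_isomorphism (with_proj G) h"
    and K_eq: "with_proj K = app_iso h (with_proj G)"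
    by (auto simp: graph_iso_def digraph_iso_def)
  \<comment> \<open>Equality with \<open>with_proj K\<close> forces tail and head of the image to be
    the two projections, so the arc map acts as the vertex map in both coordinates.\<close>
  have ends: "iso_tail h = fst" "iso_head h = snd" "pverts K = iso_verts h ` pverts G"
    "parcs K = iso_arcs h ` parcs G"
    using K_eq by (simp_all add: with_proj_def app_iso_def)
  have inj: "inj_on (iso_verts h) (pverts G)"
    using h by (simp add: pre_digraph.digraph_isomorphism_def)
  have arc: "iso_arcs h (u, v) = (iso_verts h u, iso_verts h v)" if "(u, v) \<in> parcs G" for u v
    using h that ends(1,2) by (auto simp: pre_digraph.digraph_isomorphism_def prod_eq_iff)
  have "graph_bij (iso_verts h) G K"
    unfolding graph_bij_def
  proof (intro conjI ballI iffI)
    show "bij_betw (iso_verts h) (pverts G) (pverts K)"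
      using inj ends(3) by (simp add: bij_betw_def)
    fix u v assume uv: "u \<in> pverts G" "v \<in> pverts G"
    show "(iso_verts h u, iso_verts h v) \<in> parcs K" if "(u, v) \<in> parcs G"
      using arc[OF that] that ends(4) by (metis imageI)
    show "(u, v) \<in> parcs G" if arcK: "(iso_verts h u, iso_verts h v) \<in> parcs K"
    proof -
      obtain e where e: "e \<in> parcs G" "(iso_verts h u, iso_verts h v) = iso_arcs h e"
        using arcK unfolding ends(4) by blast
      obtain u' v' where "e = (u', v')" by (cases e)
      with e have *: "(u', v') \<in> parcs G" "(iso_verts h u, iso_verts h v) = iso_arcs h (u', v')"
        by simp_all
      then have "iso_verts h u = iso_verts h u'" "iso_verts h v = iso_verts h v'"
        using arc[OF *(1)] by simp_all
      moreover have "u' \<in> pverts G" "v' \<in> pverts G" using *(1) G by auto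
      ultimately have "u = u'" "v = v'" using inj_onD[OF inj] uv by blast+
      then show ?thesis using * by simp
    qed
  qed
  then show "\<exists>f. graph_bij f G K" by blast
next
  assume "\<exists>f. graph_bij f G K"
  then obtain f where f: "bij_betw f (pverts G) (pverts K)"
    "\<forall>u\<in>pverts G. \<forall>v\<in>pverts G. (u, v) \<in> parcs G \<longleftrightarrow> (f u, f v) \<in> parcs K"
    unfolding graph_bij_def by blast
  then have inj: "inj_on f (pverts G)" "f ` pverts G = pverts K" by (simp_all add: bij_betw_def)
  define h where "h = \<lparr>iso_verts = f, iso_arcs = map_prod f f, iso_head = snd, iso_tail = fst\<rparr>"
  have "wf_digraph (with_proj G)" using G by unfold_locales auto
  moreover have "inj_on (map_prod f f) (parcs G)"
    by (rule inj_on_subset[OF map_prod_inj_on[OF inj(1) inj(1)] G])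
  ultimately have "pre_digraph.digraph_isomorphism (with_proj G) h"
    using inj(1) by (auto simp: pre_digraph.digraph_isomorphism_def h_def)
  moreover have "parcs K = map_prod f f ` parcs G"
  proof (intro equalityI subsetI)
    fix e assume e: "e \<in> parcs K"
    then have "e \<in> f ` pverts G \<times> f ` pverts G" using K inj(2) by blast
    then obtain u v where uv: "u \<in> pverts G" "v \<in> pverts G" "e = (f u, f v)" by blast
    then have "(u, v) \<in> parcs G" using e f(2) by simp
    then show "e \<in> map_prod f f ` parcs G" using uv(3) by force
  next
    fix e assume "e \<in> map_prod f f ` parcs G"
    then obtain u v where "(u, v) \<in> parcs G" "e = (f u, f v)" by auto
    then show "e \<in> parcs K" using f(2) G by blast
  qed
  then have "with_proj K = app_iso h (with_proj G)"
    using inj(2) by (simp add: with_proj_def app_iso_def h_def)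
  ultimately show "G \<cong>\<^sub>G K" by (auto simp: graph_iso_def digraph_iso_def)
qed

lemma graph_bij_sym:
  assumes "graph_bij f G K"
  shows "graph_bij (the_inv_into (pverts G) f) K G"
proof -
  have f: "bij_betw f (pverts G) (pverts K)" using assms by (simp add: graph_bij_def)
  then have inv: "bij_betw (the_inv_into (pverts G) f) (pverts K) (pverts G)"
    by (rule bij_betw_the_inv_into)
  have "f (the_inv_into (pverts G) f u) = u" if "u \<in> pverts K" for u
    using f that by (simp add: f_the_inv_into_f_bij_betw)
  then show ?thesis
    using assms inv bij_betwE[OF inv] by (simp add: graph_bij_def)
qed

lemma graph_bij_trans:
  assumes "graph_bij f G K" "graph_bij g K L"
  shows "graph_bij (g \<circ> f) G L"
  unfolding graph_bij_def
proof (intro conjI ballI)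
  show "bij_betw (g \<circ> f) (pverts G) (pverts L)"
    using assms by (auto simp: graph_bij_def intro: bij_betw_trans)
  fix u v assume "u \<in> pverts G" "v \<in> pverts G"
  moreover from this have "f u \<in> pverts K" "f v \<in> pverts K"
    using assms(1) bij_betwE unfolding graph_bij_def by blast+
  ultimately show "(u, v) \<in> parcs G \<longleftrightarrow> ((g \<circ> f) u, (g \<circ> f) v) \<in> parcs L"
    using assms by (simp add: graph_bij_def)
qed

lemma pair_graph_iso_iff:
  assumes "pair_graph G" "pair_graph K"
  shows "G \<cong>\<^sub>G K \<longleftrightarrow> (\<exists>f. graph_bij f G K)"
  using graph_iso_iff[of G K] assms by (simp add: pair_graph_iff)

definition embeds :: "('b \<Rightarrow> 'a) \<Rightarrow> 'b pair_pre_digraph \<Rightarrow> 'a pair_pre_digraph \<Rightarrow> bool" where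
  "embeds f H G \<longleftrightarrow> inj_on f (pverts H) \<and> f ` pverts H \<subseteq> pverts G \<and>
     (\<forall>(u, v)\<in>parcs H. (f u, f v) \<in> parcs G)"

lemma contains_copy_iff:
  assumes H: "pair_graph H" and G: "pair_graph G"
  shows "contains_copy H G \<longleftrightarrow> (\<exists>f. embeds f H G)"
proof
  assume "contains_copy H G"
  then obtain K where K: "subgraph (with_proj K) (with_proj G)" "H \<cong>\<^sub>G K"
    by (auto simp: contains_copy_def)
  have "wf_digraph (with_proj K)" using K(1) by (simp add: subgraph_def)
  then have "parcs K \<subseteq> pverts K \<times> pverts K" by (auto simp: wf_digraph_def)
  then obtain f where "graph_bij f H K"
    using K(2) H graph_iso_iff[of H K] unfolding pair_graph_iff by blast
  then have f: "inj_on f (pverts H)" "f ` pverts H = pverts K"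
    "\<forall>u\<in>pverts H. \<forall>v\<in>pverts H. (u, v) \<in> parcs H \<longleftrightarrow> (f u, f v) \<in> parcs K"
    by (simp_all add: graph_bij_def bij_betw_def)
  have "pverts K \<subseteq> pverts G" "parcs K \<subseteq> parcs G" using K(1) by (simp_all add: subgraph_def)
  then have "embeds f H G"
    using f parcs_in_pverts[OF H] unfolding embeds_def by blast
  then show "\<exists>f. embeds f H G" by blast
next
  assume "\<exists>f. embeds f H G"
  then obtain f where f: "inj_on f (pverts H)" "f ` pverts H \<subseteq> pverts G"
    "\<forall>(u, v)\<in>parcs H. (f u, f v) \<in> parcs G" unfolding embeds_def by blast
  define K where "K = \<lparr>pverts = f ` pverts H, parcs = map_prod f f ` parcs H\<rparr>"
  have wf: "parcs K \<subseteq> pverts K \<times> pverts K"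
    using parcs_in_pverts[OF H] by (auto simp: K_def)
  have "graph_bij f H K"
    unfolding graph_bij_def
  proof (intro conjI ballI iffI)
    fix u v assume uv: "u \<in> pverts H" "v \<in> pverts H"
    show "(u, v) \<in> parcs H" if arcK: "(f u, f v) \<in> parcs K"
    proof -
      obtain u' v' where *: "(u', v') \<in> parcs H" "f u = f u'" "f v = f v'"
        using arcK unfolding K_def by auto
      then have "u = u'" "v = v'" using parcs_in_pverts[OF H] uv inj_onD[OF f(1)] by blast+
      then show ?thesis using * by simp
    qed
  qed (use f in \<open>force simp: K_def bij_betw_def\<close>)+
  then have "H \<cong>\<^sub>G K" using graph_iso_iff[of H K] wf H unfolding pair_graph_iff by blast
  moreover have "subgraph (with_proj K) (with_proj G)"
    unfolding subgraph_def
  proof (intro conjI)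
    show "wf_digraph (with_proj G)" using parcs_in_pverts[OF G] by unfold_locales auto
    show "wf_digraph (with_proj K)" using wf by unfold_locales auto
  qed (use f in \<open>auto simp: K_def\<close>)
  ultimately show "contains_copy H G" by (auto simp: contains_copy_def)
qed

lemma embeds_trans: "embeds f H G \<Longrightarrow> embeds g G K \<Longrightarrow> embeds (g \<circ> f) H K"
  unfolding embeds_def
proof (elim conjE, intro conjI)
  assume *: "inj_on f (pverts H)" "f ` pverts H \<subseteq> pverts G" "\<forall>(u, v)\<in>parcs H. (f u, f v) \<in> parcs G"
    "inj_on g (pverts G)" "g ` pverts G \<subseteq> pverts K" "\<forall>(u, v)\<in>parcs G. (g u, g v) \<in> parcs K"
  show "inj_on (g \<circ> f) (pverts H)" using *(1) inj_on_subset[OF *(4,2)] by (rule comp_inj_on)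
  show "(g \<circ> f) ` pverts H \<subseteq> pverts K" using *(2,5) by auto
  show "\<forall>(u, v)\<in>parcs H. ((g \<circ> f) u, (g \<circ> f) v) \<in> parcs K" using *(3,6) by auto
qed

lemma graph_bij_embeds:
  assumes "pair_graph G" "graph_bij f G K"
  shows "embeds f G K"
proof -
  have "(f u, f v) \<in> parcs K" if "(u, v) \<in> parcs G" for u v
    using that parcs_in_pverts[OF assms(1) that] assms(2) by (simp add: graph_bij_def)
  moreover have "inj_on f (pverts G)" "f ` pverts G = pverts K"
    using assms(2) by (simp_all add: graph_bij_def bij_betw_def)
  ultimately show ?thesis unfolding embeds_def by blast
qed

lemma contains_copy_embeds:
  assumes "pair_graph H" "pair_graph G" "pair_graph K" "embeds g G K" "contains_copy H G"
  shows "contains_copy H K"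
proof -
  obtain f where "embeds f H G" using assms(1,2,5) contains_copy_iff by blast
  then have "embeds (g \<circ> f) H K" using assms(4) by (rule embeds_trans)
  then show ?thesis using assms(1,3) contains_copy_iff by blast
qed

definition map_graph :: "('a \<Rightarrow> 'b) \<Rightarrow> 'a pair_pre_digraph \<Rightarrow> 'b pair_pre_digraph" where
  "map_graph f G = \<lparr>pverts = f ` pverts G, parcs = map_prod f f ` parcs G\<rparr>"

lemma pair_graph_map_graph:
  assumes "pair_graph G" "inj_on f (pverts G)"
  shows "pair_graph (map_graph f G)" "graph_bij f G (map_graph f G)"
proof -
  note G = parcs_in_pverts[OF assms(1)]
  have irr: "f u \<noteq> f v" if "(u, v) \<in> parcs G" for u v
    using that G assms parcs_irrefl[OF assms(1)] by (metis inj_onD)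
  show "pair_graph (map_graph f G)"
    unfolding pair_graph_iff
  proof (intro conjI)
    show "finite (pverts (map_graph f G))" using finite_pverts[OF assms(1)] by (simp add: map_graph_def)
    show "parcs (map_graph f G) \<subseteq> pverts (map_graph f G) \<times> pverts (map_graph f G)"
      using G by (auto simp: map_graph_def)
    show "sym (parcs (map_graph f G))"
      using parcs_sym[OF assms(1)] by (fastforce simp: map_graph_def intro!: symI)
    show "irrefl (parcs (map_graph f G))" using irr by (auto simp: map_graph_def irrefl_def)
  qed
  show "graph_bij f G (map_graph f G)"
    unfolding graph_bij_def
  proof (intro conjI ballI iffI)
    fix u v assume uv: "u \<in> pverts G" "v \<in> pverts G"
    show "(u, v) \<in> parcs G" if arcK: "(f u, f v) \<in> parcs (map_graph f G)"
    proof -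
      obtain u' v' where *: "(u', v') \<in> parcs G" "f u = f u'" "f v = f v'"
        using arcK unfolding map_graph_def by auto
      then have "u = u'" "v = v'" using G uv inj_onD[OF assms(2)] by blast+
      then show ?thesis using * by simp
    qed
  qed (use assms(2) in \<open>force simp: map_graph_def bij_betw_def\<close>)+
qed

text \<open>\<open>max_spectral_radius\<close>, \<open>nikiforov_threshold\<close> and
  \<open>maximizes_second_eigenvalue\<close> range over graphs on natural numbers; such a copy makes
  them apply to graphs on any vertex type.\<close>

lemma nat_graph_copy:
  assumes "pair_graph G"
  obtains K :: "nat pair_pre_digraph" and f where
    "pair_graph K" "graph_bij f G K" "pverts K = {..<card (pverts G)}"
proof -
  obtain f where f: "bij_betw f (pverts G) {0..<card (pverts G)}"
    using ex_bij_betw_finite_nat[OF finite_pverts[OF assms]] by auto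
  then have "inj_on f (pverts G)" "f ` pverts G = {..<card (pverts G)}"
    by (auto simp: bij_betw_def)
  then show thesis
    using pair_graph_map_graph[OF assms, of f]
    by (intro that[of "map_graph f G" f]) (simp_all, simp add: map_graph_def)
qed

lemma graph_bij_card: "graph_bij f G K \<Longrightarrow> card (pverts G) = card (pverts K)"
  by (auto simp: graph_bij_def dest: bij_betw_same_card)

section \<open>Quadratic forms along embeddings and bijections\<close>

lemma graph_form_arcs:
  assumes "pair_graph G"
  shows "graph_form G x = (\<Sum>(u, v)\<in>parcs G. x u * x v)"
proof -
  have fin: "finite (pverts G)" using finite_pverts[OF assms] .
  have "graph_form G x = (\<Sum>u\<in>pverts G. \<Sum>v\<in>pverts G. if (u, v) \<in> parcs G then x u * x v else 0)"
    by (auto simp: inner_on_def kernel_op_def adj_def sum_distrib_left intro!: sum.cong)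
  also have "\<dots> = (\<Sum>(u, v)\<in>pverts G \<times> pverts G. if (u, v) \<in> parcs G then x u * x v else 0)"
    by (simp add: sum.cartesian_product)
  also have "\<dots> = (\<Sum>(u, v)\<in>parcs G. x u * x v)"
    using assms fin by (intro sum.mono_neutral_cong_right) (auto simp: pair_graph_iff)
  finally show ?thesis .
qed

lemma graph_op_eq:
  assumes "pair_graph G"
  shows "graph_op G x v = (\<Sum>w | (v, w) \<in> parcs G. x w)"
proof -
  have "graph_op G x v = (\<Sum>w\<in>pverts G. if (v, w) \<in> parcs G then x w else 0)"
    by (auto simp: kernel_op_def adj_def intro!: sum.cong)
  also have "\<dots> = (\<Sum>w | (v, w) \<in> parcs G. x w)"
    using assms finite_pverts[OF assms] parcs_in_pverts[OF assms]
    by (intro sum.mono_neutral_cong_right) auto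
  finally show ?thesis .
qed

lemma finite_parcs: "pair_graph G \<Longrightarrow> finite (parcs G)"
  using finite_subset[of "parcs G" "pverts G \<times> pverts G"] by (simp add: pair_graph_iff)

text \<open>Pushing a non-negative vector forward and extending it by 0 keeps its norm, and the arcs
  of \<open>K\<close> that are not images of arcs of \<open>G\<close> can only add non-negative
  products.\<close>

lemma embeds_extension:
  assumes G: "pair_graph G" and K: "pair_graph K" and f: "embeds f G K" and x: "\<forall>v. x v \<ge> 0"
  obtains y where "\<forall>w. y w \<ge> 0" "\<forall>v\<in>pverts G. y (f v) = x v" "\<forall>w. w \<notin> f ` pverts G \<longrightarrow> y w = 0"
    "sq_norm (pverts K) y = sq_norm (pverts G) x" "graph_form G x \<le> graph_form K y"
proof -
  have inj: "inj_on f (pverts G)" "f ` pverts G \<subseteq> pverts K" using f by (auto simp: embeds_def)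
  define y where "y w = (if w \<in> f ` pverts G then x (the_inv_into (pverts G) f w) else 0)" for w
  have yf: "y (f v) = x v" if "v \<in> pverts G" for v
    using that inj by (simp add: y_def the_inv_into_f_f)
  have y0: "y w \<ge> 0" for w using x by (simp add: y_def)
  have "sq_norm (pverts K) y = (\<Sum>w\<in>f ` pverts G. y w * y w)"
    unfolding inner_on_def using inj(2) finite_pverts[OF K]
    by (intro sum.mono_neutral_right) (auto simp: y_def)
  also have "\<dots> = sq_norm (pverts G) x" using inj by (simp add: sum.reindex yf inner_on_def)
  finally have norm: "sq_norm (pverts K) y = sq_norm (pverts G) x" .
  have "graph_form G x = (\<Sum>(u, v)\<in>parcs G. y (f u) * y (f v))"
    using parcs_in_pverts[OF G] yf by (auto simp: graph_form_arcs[OF G] intro!: sum.cong)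
  also have "\<dots> = (\<Sum>(u, v)\<in>map_prod f f ` parcs G. y u * y v)"
  proof (subst sum.reindex)
    show "inj_on (map_prod f f) (parcs G)"
      using G by (intro inj_on_subset[OF map_prod_inj_on[OF inj(1) inj(1)]]) (auto simp: pair_graph_iff)
  qed (simp add: o_def case_prod_beta)
  also have "\<dots> \<le> (\<Sum>(u, v)\<in>parcs K. y u * y v)"
    using f y0 finite_parcs[OF K] by (intro sum_mono2) (auto simp: embeds_def)
  also have "\<dots> = graph_form K y" by (simp add: graph_form_arcs[OF K])
  finally have form: "graph_form G x \<le> graph_form K y" .
  show thesis
    by (rule that[of y]) (use y0 yf norm form in \<open>auto simp: y_def\<close>)
qed

lemma spectral_radius_embeds:
  assumes "pair_graph G" "pair_graph K" "pverts G \<noteq> {}" "embeds f G K"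
  shows "spectral_radius G \<le> spectral_radius K"
proof -
  obtain x where x: "sq_norm (pverts G) x = 1" "\<forall>v. x v \<ge> 0"
    "\<forall>v\<in>pverts G. graph_op G x v = spectral_radius G * x v"
    using spectral_radius_eigenvector[OF assms(1,3)] .
  obtain y where y: "sq_norm (pverts K) y = sq_norm (pverts G) x" "graph_form G x \<le> graph_form K y"
    by (rule embeds_extension[OF assms(1,2,4) x(2)])
  have "pverts K \<noteq> {}" using assms(3,4) by (auto simp: embeds_def)
  have "spectral_radius G = inner_on (pverts G) x (\<lambda>v. spectral_radius G * x v)"
    using x(1) by (simp add: inner_on_scale)
  also have "\<dots> = graph_form G x" using x(3) by (intro inner_on_cong) auto
  also have "\<dots> \<le> graph_form K y" by (rule y(2))
  also have "\<dots> \<le> spectral_radius K"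
    using graph_form_le[OF assms(2) \<open>pverts K \<noteq> {}\<close>, of y] x(1) y(1) by simp
  finally show ?thesis .
qed

lemma spectral_radius_graph_bij:
  assumes "pair_graph G" "pair_graph K" "pverts G \<noteq> {}" "graph_bij f G K"
  shows "spectral_radius G = spectral_radius K"
proof (rule antisym)
  show "spectral_radius G \<le> spectral_radius K"
    using assms by (intro spectral_radius_embeds graph_bij_embeds)
  have "pverts K \<noteq> {}" using assms(3,4) by (auto simp: graph_bij_def bij_betw_def)
  then show "spectral_radius K \<le> spectral_radius G"
    using spectral_radius_embeds[OF assms(2,1) _ graph_bij_embeds[OF assms(2) graph_bij_sym[OF assms(4)]]]
    by blast
qed

text \<open>On the span of the two top eigenvectors the Rayleigh quotient is a weighted mean of
  their eigenvalues. This plane is carried along a bijection to show that the second eigenvalue is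
  an isomorphism invariant.\<close>

lemma second_eigenvector_span:
  assumes "pair_graph G" "card (pverts G) \<ge> 2"
  obtains x y where
    "\<forall>s t. graph_form G (\<lambda>v. s * x v + t * y v)
       \<ge> eigval 2 G * sq_norm (pverts G) (\<lambda>v. s * x v + t * y v)"
    "\<forall>s t. sq_norm (pverts G) (\<lambda>v. s * x v + t * y v) = s\<^sup>2 + t\<^sup>2"
proof -
  obtain x y where *: "sq_norm (pverts G) x = 1" "sq_norm (pverts G) y = 1" "inner_on (pverts G) x y = 0"
    "\<forall>v\<in>pverts G. graph_op G y v = spectral_radius G * y v"
    "\<forall>v\<in>pverts G. graph_op G x v = eigval 2 G * x v"
    "eigval 2 G \<le> spectral_radius G"
    by (rule second_eigenvector[OF assms])
  have norm: "sq_norm (pverts G) (\<lambda>v. s * x v + t * y v) = s\<^sup>2 + t\<^sup>2" for s t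
    using * by (simp add: inner_on_add_square)
  have "graph_form G x = inner_on (pverts G) x (\<lambda>v. eigval 2 G * x v)"
    using * by (intro inner_on_cong) auto
  then have 1: "graph_form G x = eigval 2 G" using * by (simp add: inner_on_scale)
  have "graph_form G y = inner_on (pverts G) y (\<lambda>v. spectral_radius G * y v)"
    using * by (intro inner_on_cong) auto
  then have 2: "graph_form G y = spectral_radius G" using * by (simp add: inner_on_scale)
  have "inner_on (pverts G) x (graph_op G y) = inner_on (pverts G) x (\<lambda>v. spectral_radius G * y v)"
    using * by (intro inner_on_cong) auto
  then have 3: "inner_on (pverts G) x (graph_op G y) = 0" using * by (simp add: inner_on_scale)
  have "graph_form G (\<lambda>v. s * x v + t * y v) = s\<^sup>2 * eigval 2 G + t\<^sup>2 * spectral_radius G" for s t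
    using quad_form_add[of "pverts G" "adj G" s x t y] adj_sym[OF assms(1)] 1 2 3 by simp
  moreover have "s\<^sup>2 * eigval 2 G + t\<^sup>2 * spectral_radius G \<ge> eigval 2 G * (s\<^sup>2 + t\<^sup>2)" for s t
    using mult_left_mono[OF *(6), of "t\<^sup>2"] by (simp add: algebra_simps)
  ultimately show thesis using norm by (intro that[of x y]) auto
qed

lemma second_eigenvalue_graph_bij_le:
  assumes "pair_graph G" "pair_graph K" "card (pverts G) \<ge> 2" "graph_bij f G K"
  shows "eigval 2 K \<le> eigval 2 G"
proof -
  have card: "card (pverts K) \<ge> 2" using assms graph_bij_card by metis
  obtain x y where xy: "\<forall>s t. graph_form K (\<lambda>v. s * x v + t * y v)
       \<ge> eigval 2 K * sq_norm (pverts K) (\<lambda>v. s * x v + t * y v)"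
    "\<forall>s t. sq_norm (pverts K) (\<lambda>v. s * x v + t * y v) = s\<^sup>2 + t\<^sup>2"
    by (rule second_eigenvector_span[OF assms(2) card])
  have f: "bij_betw f (pverts G) (pverts K)" using assms(4) by (simp add: graph_bij_def)
  have norm: "sq_norm (pverts G) (\<lambda>v. z (f v)) = sq_norm (pverts K) z" for z
    unfolding inner_on_def by (rule sum.reindex_bij_betw[OF f])
  have op: "graph_op G (\<lambda>v. z (f v)) v = graph_op K z (f v)" if "v \<in> pverts G" for z v
  proof -
    have "graph_op G (\<lambda>v. z (f v)) v = (\<Sum>w\<in>pverts G. adj K (f v) (f w) * z (f w))"
      using assms(4) that unfolding kernel_op_def by (intro sum.cong) (auto simp: adj_def graph_bij_def)
    also have "\<dots> = graph_op K z (f v)" unfolding kernel_op_def by (rule sum.reindex_bij_betw[OF f])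
    finally show ?thesis .
  qed
  have form: "graph_form G (\<lambda>v. z (f v)) = graph_form K z" for z
  proof -
    have "graph_form G (\<lambda>v. z (f v)) = (\<Sum>v\<in>pverts G. z (f v) * graph_op K z (f v))"
      unfolding inner_on_def using op by (intro sum.cong) auto
    also have "\<dots> = graph_form K z" unfolding inner_on_def by (rule sum.reindex_bij_betw[OF f])
    finally show ?thesis .
  qed
  show ?thesis
  proof (rule second_eigenvalue_ge[OF assms(1,3), where p = "x \<circ> f" and q = "y \<circ> f"])
    fix s t :: real assume "(s, t) \<noteq> (0, 0)"
    then have "s\<^sup>2 + t\<^sup>2 > 0" by (simp add: sum_power2_gt_zero_iff)
    then show "sq_norm (pverts G) (\<lambda>v. s * (x \<circ> f) v + t * (y \<circ> f) v) > 0"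
      using norm[of "\<lambda>v. s * x v + t * y v"] xy(2) by simp
    show "graph_form G (\<lambda>v. s * (x \<circ> f) v + t * (y \<circ> f) v)
       \<ge> eigval 2 K * sq_norm (pverts G) (\<lambda>v. s * (x \<circ> f) v + t * (y \<circ> f) v)"
      using norm[of "\<lambda>v. s * x v + t * y v"] form[of "\<lambda>v. s * x v + t * y v"] xy(1) by simp
  qed
qed

lemma second_eigenvalue_graph_bij:
  assumes "pair_graph G" "pair_graph K" "card (pverts G) \<ge> 2" "graph_bij f G K"
  shows "eigval 2 G = eigval 2 K"
  using second_eigenvalue_graph_bij_le[OF assms] graph_bij_card[OF assms(4)] assms(3)
    second_eigenvalue_graph_bij_le[OF assms(2,1) _ graph_bij_sym[OF assms(4)]] by simp

section \<open>Induced subgraphs and cuts\<close>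

definition induced :: "'a pair_pre_digraph \<Rightarrow> 'a set \<Rightarrow> 'a pair_pre_digraph" where
  "induced G S = \<lparr>pverts = S, parcs = parcs G \<inter> S \<times> S\<rparr>"

lemma induced_simps [simp]: "pverts (induced G S) = S" "parcs (induced G S) = parcs G \<inter> S \<times> S"
  by (simp_all add: induced_def)

lemma pair_graph_induced:
  assumes "pair_graph G" "S \<subseteq> pverts G"
  shows "pair_graph (induced G S)"
  using finite_subset[OF assms(2) finite_pverts[OF assms(1)]] parcs_irrefl[OF assms(1)]
  by (auto simp: pair_graph_iff irrefl_def intro!: symI parcs_sym[OF assms(1)])

lemma embeds_induced: "S \<subseteq> T \<Longrightarrow> embeds id (induced G S) (induced G T)"
  by (auto simp: embeds_def)

lemma embeds_induced': "S \<subseteq> pverts G \<Longrightarrow> embeds id (induced G S) G"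
  by (auto simp: embeds_def)

lemma free_of_induced:
  assumes "pair_graph H" "pair_graph G" "S \<subseteq> pverts G" "free_of H G"
  shows "free_of H (induced G S)"
  using contains_copy_embeds[OF assms(1) pair_graph_induced[OF assms(2,3)] assms(2) embeds_induced'[OF assms(3)]]
    assms(4) by blast

text \<open>A walk cannot leave a set without outgoing arcs; conversely the set of vertices
  reachable from \<open>u\<close> has no outgoing arc, so it is everything. Later arguments use
  connectivity in this cut form.\<close>

lemma graph_connected_iff:
  assumes "pair_graph G"
  shows "graph_connected G \<longleftrightarrow> pverts G \<noteq> {} \<and>
    (\<forall>S. S \<subseteq> pverts G \<and> S \<noteq> {} \<and> S \<noteq> pverts G \<longrightarrow> (\<exists>u\<in>S. \<exists>v\<in>pverts G - S. (u, v) \<in> parcs G))"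
proof -
  interpret pair_graph G by fact
  have eq: "parcs (mk_symmetric (with_proj G)) = parcs G"
    using parcs_sym[OF assms] by (auto simp: mk_symmetric_def)
  have reach: "reachable (with_proj (mk_symmetric (with_proj G))) u v \<longleftrightarrow> (u, v) \<in> rtrancl_on (pverts G) (parcs G)" for u v
    by (simp add: reachable_def eq)
  have conn: "graph_connected G \<longleftrightarrow> pverts G \<noteq> {} \<and>
      (\<forall>u\<in>pverts G. \<forall>v\<in>pverts G. (u, v) \<in> rtrancl_on (pverts G) (parcs G))"
    unfolding graph_connected_def Digraph_Component.connected_def strongly_connected_def reach by simp
  show ?thesis unfolding conn
  proof (intro conj_cong refl iffI allI impI ballI)
    fix S assume r: "\<forall>u\<in>pverts G. \<forall>v\<in>pverts G. (u, v) \<in> rtrancl_on (pverts G) (parcs G)"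
      and S: "S \<subseteq> pverts G \<and> S \<noteq> {} \<and> S \<noteq> pverts G"
    show "\<exists>u\<in>S. \<exists>v\<in>pverts G - S. (u, v) \<in> parcs G"
    proof (rule ccontr)
      assume no: "\<not> ?thesis"
      obtain u v where uv: "u \<in> S" "v \<in> pverts G" "v \<notin> S" using S by blast
      have "(u, v) \<in> rtrancl_on (pverts G) (parcs G)" using r uv S by blast
      then have "v \<in> S"
        by (induction rule: rtrancl_on_induct) (use uv no parcs_in_pverts[OF assms] in blast)+
      then show False using uv by simp
    qed
  next
    fix u v assume cut: "\<forall>S. S \<subseteq> pverts G \<and> S \<noteq> {} \<and> S \<noteq> pverts G \<longrightarrow>
        (\<exists>u\<in>S. \<exists>v\<in>pverts G - S. (u, v) \<in> parcs G)"
      and uv: "u \<in> pverts G" "v \<in> pverts G"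
    define S where "S = {w \<in> pverts G. (u, w) \<in> rtrancl_on (pverts G) (parcs G)}"
    have "u \<in> S" using uv by (simp add: S_def)
    have "\<not> (\<exists>x\<in>S. \<exists>y\<in>pverts G - S. (x, y) \<in> parcs G)"
      by (auto simp: S_def intro: rtrancl_on_into_rtrancl_on)
    moreover have "S \<subseteq> pverts G" by (auto simp: S_def)
    ultimately have "S = pverts G" using cut \<open>u \<in> S\<close> by blast
    then show "(u, v) \<in> rtrancl_on (pverts G) (parcs G)" using uv by (auto simp: S_def)
  qed
qed

lemma graph_connected_graph_bij:
  assumes "pair_graph G" "pair_graph K" "graph_bij f G K" "graph_connected G"
  shows "graph_connected K"
  unfolding graph_connected_iff[OF assms(2)]
proof (intro conjI allI impI)
  have f: "bij_betw f (pverts G) (pverts K)" using assms(3) by (simp add: graph_bij_def)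
  show "pverts K \<noteq> {}" using assms(4) f unfolding graph_connected_iff[OF assms(1)] by (auto simp: bij_betw_def)
  fix S assume S: "S \<subseteq> pverts K \<and> S \<noteq> {} \<and> S \<noteq> pverts K"
  define T where "T = {v \<in> pverts G. f v \<in> S}"
  have onto: "\<exists>v\<in>pverts G. w = f v" if "w \<in> pverts K" for w
    using f that by (auto simp: bij_betw_def)
  have "T \<subseteq> pverts G" by (auto simp: T_def)
  moreover have "T \<noteq> {}"
  proof -
    obtain w where "w \<in> S" "w \<in> pverts K" using S by blast
    then show ?thesis using onto[of w] by (auto simp: T_def)
  qed
  moreover have "T \<noteq> pverts G"
  proof -
    obtain w where "w \<notin> S" "w \<in> pverts K" using S by blast
    then show ?thesis using onto[of w] by (auto simp: T_def)
  qed
  ultimately obtain u v where "u \<in> T" "v \<in> pverts G - T" "(u, v) \<in> parcs G"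
    using assms(4) unfolding graph_connected_iff[OF assms(1)] by blast
  moreover from this have "f v \<in> pverts K" using bij_betwE[OF f] by blast
  ultimately have "f u \<in> S" "f v \<in> pverts K - S" "(f u, f v) \<in> parcs K"
    using assms(3) by (simp_all add: T_def graph_bij_def)
  then show "\<exists>u\<in>S. \<exists>v\<in>pverts K - S. (u, v) \<in> parcs K" by blast
qed

section \<open>Colourings\<close>

lemma proper_colouring_embeds:
  assumes "embeds f H G" "proper_colouring G k c"
  shows "proper_colouring H k (c \<circ> f)"
  using assms by (fastforce simp: proper_colouring_def embeds_def image_subset_iff)

lemma proper_colouring_exists:
  assumes "pair_graph G"
  shows "\<exists>c. proper_colouring G (card (pverts G)) c"
proof -
  obtain f where f: "bij_betw f (pverts G) {0..<card (pverts G)}"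
    using ex_bij_betw_finite_nat[OF finite_pverts[OF assms]] by auto
  then have inj: "inj_on f (pverts G)" and "f ` pverts G = {..<card (pverts G)}"
    by (auto simp: bij_betw_def)
  moreover have "f u \<noteq> f v" if "(u, v) \<in> parcs G" for u v
    using that inj_onD[OF inj, of u v] parcs_in_pverts[OF assms that] parcs_irrefl[OF assms] by auto
  ultimately have "proper_colouring G (card (pverts G)) f"
    by (auto simp: proper_colouring_def)
  then show ?thesis by blast
qed

lemma chromatic_number_colouring:
  assumes "pair_graph G"
  shows "\<exists>c. proper_colouring G (chromatic_number G) c"
  unfolding chromatic_number_def by (rule LeastI_ex) (use proper_colouring_exists[OF assms] in blast)

lemma free_of_if_colourable:
  assumes "colour_critical \<chi> H" "pair_graph G" "proper_colouring G \<chi> c"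
  shows "free_of H G"
proof
  assume "contains_copy H G"
  then obtain f where "embeds f H G"
    using assms contains_copy_iff by (auto simp: colour_critical_def)
  then have "proper_colouring H \<chi> (c \<circ> f)" using assms(3) by (rule proper_colouring_embeds)
  then have "chromatic_number H \<le> \<chi>" unfolding chromatic_number_def by (intro Least_le) blast
  then show False using assms(1) by (simp add: colour_critical_def)
qed

lemma pair_graph_delete_edge:
  assumes "pair_graph G"
  shows "pair_graph (delete_edge G u v)"
  using parcs_in_pverts[OF assms] parcs_irrefl[OF assms] finite_pverts[OF assms]
  by (auto simp: pair_graph_iff delete_edge_def irrefl_def intro!: symI intro: parcs_sym[OF assms])

lemma pair_graph_add_edge:
  assumes "pair_graph G" "u \<in> pverts G" "v \<in> pverts G" "u \<noteq> v"
  shows "pair_graph (add_edge G u v)"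
  using assms(2-) parcs_in_pverts[OF assms(1)] parcs_irrefl[OF assms(1)] finite_pverts[OF assms(1)]
  by (auto simp: pair_graph_iff add_edge_def irrefl_def intro!: symI intro: parcs_sym[OF assms(1)])

text \<open>A colouring of \<open>H\<close> minus the critical edge must give both ends the same
  colour, as otherwise it would colour all of \<open>H\<close> with \<open>\<chi>\<close> colours.
  This common colour later decides which part receives the critical edge.\<close>

lemma critical_edge_colouring:
  assumes "colour_critical \<chi> H"
  obtains u v c where "(u, v) \<in> parcs H" "c ` pverts H \<subseteq> {..<\<chi>}" "c u = c v"
    "\<forall>(x, y)\<in>parcs H. {x, y} \<noteq> {u, v} \<longrightarrow> c x \<noteq> c y"
proof -
  have H: "pair_graph H" using assms by (simp add: colour_critical_def)
  obtain u v where uv: "(u, v) \<in> parcs H" "chromatic_number (delete_edge H u v) = \<chi>"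
    using assms by (auto simp: colour_critical_def)
  then obtain c where c: "proper_colouring (delete_edge H u v) \<chi> c"
    using chromatic_number_colouring[OF pair_graph_delete_edge[OF H]] by metis
  then have range: "c ` pverts H \<subseteq> {..<\<chi>}"
    and proper: "\<forall>(x, y)\<in>parcs H. {x, y} \<noteq> {u, v} \<longrightarrow> c x \<noteq> c y"
    by (auto simp: proper_colouring_def delete_edge_def doubleton_eq_iff)
  have "c u = c v"
  proof (rule ccontr)
    assume "c u \<noteq> c v"
    then have "proper_colouring H \<chi> c"
      using range proper by (auto simp: proper_colouring_def doubleton_eq_iff)
    then have "chromatic_number H \<le> \<chi>" unfolding chromatic_number_def by (intro Least_le) blast
    then show False using assms by (simp add: colour_critical_def)
  qed
  then show thesis using that uv range proper by blast
qed

section \<open>Complete multipartite subgraphs\<close>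

lemma card_lists_sum:
  assumes "finite V" and X: "X \<subseteq> {L. set L \<subseteq> V \<and> length L = Suc k}"
  shows "card X = (\<Sum>L | set L \<subseteq> V \<and> length L = k. card {v \<in> V. v # L \<in> X})"
proof -
  let ?B = "{L. set L \<subseteq> V \<and> length L = k}"
  have "finite ?B" using finite_lists_length_eq[OF \<open>finite V\<close>] .
  have eq: "X = (\<lambda>(L, v). v # L) ` (SIGMA L:?B. {v \<in> V. v # L \<in> X})"
  proof (intro equalityI subsetI)
    fix x assume x: "x \<in> X"
    then have "set x \<subseteq> V \<and> length x = Suc k" using X by blast
    moreover from this obtain v L where "x = v # L" by (cases x) auto
    ultimately show "x \<in> (\<lambda>(L, v). v # L) ` (SIGMA L:?B. {v \<in> V. v # L \<in> X})"
      using x by (intro image_eqI[of _ _ "(L, v)"]) auto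
  qed auto
  have "inj_on (\<lambda>(L, v). v # L) (SIGMA L:?B. {v \<in> V. v # L \<in> X})"
    by (auto simp: inj_on_def)
  then have "card X = card (SIGMA L:?B. {v \<in> V. v # L \<in> X})"
    by (subst eq) (rule card_image)
  also have "\<dots> = (\<Sum>L\<in>?B. card {v \<in> V. v # L \<in> X})"
    using \<open>finite ?B\<close> \<open>finite V\<close> by (intro card_SigmaI) auto
  finally show ?thesis .
qed

lemma sum_card_swap:
  assumes "finite A" "finite B"
  shows "(\<Sum>a\<in>A. card {b \<in> B. P a b}) = (\<Sum>b\<in>B. card {a \<in> A. P a b})"
proof -
  have "(\<Sum>a\<in>A. card {b \<in> B. P a b}) = (\<Sum>a\<in>A. \<Sum>b\<in>B. if P a b then 1 else 0)"
    using assms by (simp add: sum.If_cases Int_def)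
  also have "\<dots> = (\<Sum>b\<in>B. \<Sum>a\<in>A. if P a b then 1 else 0)" by (rule sum.swap)
  also have "\<dots> = (\<Sum>b\<in>B. card {a \<in> A. P a b})" using assms by (simp add: sum.If_cases Int_def)
  finally show ?thesis .
qed

definition clique_tuple :: "'a rel \<Rightarrow> 'a list \<Rightarrow> bool" where
  "clique_tuple E L \<longleftrightarrow> (\<forall>i<length L. \<forall>j<length L. i \<noteq> j \<longrightarrow> (L ! i, L ! j) \<in> E)"

text \<open>The columns of such a family of \<open>k\<close>-tuples are the parts of a complete \<open>k\<close>-partite graph.\<close>

definition multipartite_family :: "'a rel \<Rightarrow> nat \<Rightarrow> 'a list set \<Rightarrow> bool" where
  "multipartite_family E k A \<longleftrightarrow> (\<forall>x\<in>A. \<forall>y\<in>A.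
     (\<forall>i<k. \<forall>j<k. i \<noteq> j \<longrightarrow> (x ! i, y ! j) \<in> E) \<and> (x \<noteq> y \<longrightarrow> (\<forall>i<k. x ! i \<noteq> y ! i)))"

text \<open>Induction on \<open>k\<close> in the manner of Kovari, Sos and Turan; \<open>X\<close>
  contains a proportion 1 / D of all k-tuples. Keeping the tails with many extensions doubles
  \<open>D\<close> while \<open>k\<close> drops by one, so 2^(k + 1) D \<le> F is invariant. To get
  \<open>t\<close> tuples the induction must provide 4 D t tails, which is paid by one factor of
  F^(k - 1). So \<open>Q\<close> bounds every family that occurs, and F Q 2^Q \<le> n pays for the
  pigeonhole over subsets of such a family.\<close>

lemma multipartite_family_exists:
  assumes "finite V"
  shows "k \<ge> 1 \<Longrightarrow> X \<subseteq> {L. set L \<subseteq> V \<and> length L = k} \<Longrightarrow> \<forall>L\<in>X. clique_tuple E L \<Longrightarrow> D > 0 \<Longrightarrow>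
    card V ^ k \<le> D * card X \<Longrightarrow> 2 ^ (k + 1) * D \<le> F \<Longrightarrow> t * F ^ (k - 1) \<le> Q \<Longrightarrow>
    F * Q * 2 ^ Q \<le> card V \<Longrightarrow>
    \<exists>A\<subseteq>X. finite A \<and> card A = t \<and> multipartite_family E k A"
proof (induction k arbitrary: X D t)
  case 0
  then show ?case by simp
next
  case (Suc k)
  let ?n = "card V"
  have finX: "finite X" using Suc.prems(2) finite_lists_length_eq[OF \<open>finite V\<close>] finite_subset by blast
  have "F > 0" using Suc.prems(4,6) by (metis gr0I le_zero_eq mult_is_0 power_not_zero zero_neq_numeral)
  consider "t = 0" | "t > 0" "k = 0" | "t > 0" "k \<ge> 1" by linarith
  then show ?case
  proof cases
    case 1
    then show ?thesis by (intro exI[of _ "{}"]) (simp add: multipartite_family_def)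
  next
    case 2
    have "D * t \<le> F * Q * 2 ^ Q"
    proof -
      have "D \<le> F" "t \<le> Q" using Suc.prems(6,7) 2 by simp_all
      then have "D * t * 1 \<le> F * Q * 2 ^ Q" by (intro mult_le_mono) auto
      then show ?thesis by simp
    qed
    also have "\<dots> \<le> card V" by (rule Suc.prems(8))
    also have "\<dots> \<le> D * card X" using Suc.prems(5) 2 by simp
    finally have "D * t \<le> D * card X" .
    then have "t \<le> card X" using Suc.prems(4) by simp
    then obtain A where A: "A \<subseteq> X" "card A = t" "finite A"
      by (rule obtain_subset_with_card_n)
    have "x ! 0 \<noteq> y ! 0" if "x \<in> A" "y \<in> A" "x \<noteq> y" for x y
    proof -
      have "length x = 1" "length y = 1" using that A Suc.prems(2) 2 by auto
      then show ?thesis using that by (cases x; cases y) auto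
    qed
    then have "multipartite_family E (Suc k) A" using 2 by (auto simp: multipartite_family_def)
    then show ?thesis using A by blast
  next
    case 3
    let ?B = "{L. set L \<subseteq> V \<and> length L = k}"
    define ext where "ext L = {v \<in> V. v # L \<in> X}" for L
    \<comment> \<open>Tails with at least half of the guaranteed average n / D of extensions. The
      other tails account for at most half of \<open>X\<close>.\<close>
    define X' where "X' = {L \<in> ?B. ?n \<le> 2 * D * card (ext L)}"
    have finB: "finite ?B" using finite_lists_length_eq[OF \<open>finite V\<close>] .
    have cardB: "card ?B = ?n ^ k" using card_lists_length_eq[OF \<open>finite V\<close>] .
    have ext_le: "card (ext L) \<le> ?n" for L
      unfolding ext_def using \<open>finite V\<close> by (intro card_mono) auto
    have fin_ext: "finite (ext L)" for L using \<open>finite V\<close> by (simp add: ext_def)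
    have "0 < F * Q" using \<open>F > 0\<close> Suc.prems(7) 3 by (metis gr0I le_zero_eq mult_is_0 power_not_zero)
    then have "?n > 0" using Suc.prems(8) by (metis le_zero_eq gr0I mult_is_0 power_not_zero zero_neq_numeral)
    have "2 * ?n ^ Suc k \<le> 2 * D * card X" using Suc.prems(5) by simp
    also have "\<dots> = (\<Sum>L\<in>?B. 2 * D * card (ext L))"
      unfolding card_lists_sum[OF \<open>finite V\<close> Suc.prems(2)] ext_def by (simp add: sum_distrib_left)
    also have "\<dots> \<le> (\<Sum>L\<in>?B. (if L \<in> X' then 2 * D * ?n else 0) + ?n)"
      by (intro sum_mono) (use ext_le in \<open>auto simp: X'_def intro: trans_le_add1\<close>)
    also have "\<dots> = card X' * (2 * D * ?n) + ?n ^ k * ?n"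
    proof -
      have "?B \<inter> X' = X'" by (auto simp: X'_def)
      then show ?thesis using finB by (simp add: sum.distrib sum.If_cases cardB)
    qed
    finally have "?n * ?n ^ k \<le> ?n * (2 * D * card X')" by (simp add: mult_ac)
    then have X'_card: "?n ^ k \<le> 2 * D * card X'" using \<open>?n > 0\<close> by simp
    have DF: "4 * D \<le> F" "8 * D \<le> F"
    proof -
      have "(2::nat) ^ 3 \<le> 2 ^ (Suc k + 1)" using 3 by (intro power_increasing) auto
      then have "8 * D \<le> 2 ^ (Suc k + 1) * D" by (intro mult_le_mono1) simp
      also have "\<dots> \<le> F" by (rule Suc.prems(6))
      finally show "8 * D \<le> F" .
      then show "4 * D \<le> F" by simp
    qed
    have k: "F ^ k = F * F ^ (k - 1)" using 3 by (cases k) auto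
    have t'Q: "(4 * D * t) * F ^ (k - 1) \<le> Q"
    proof -
      have "(4 * D * t) * F ^ (k - 1) \<le> F * t * F ^ (k - 1)" using DF by (intro mult_le_mono1) auto
      also have "\<dots> = t * F ^ (Suc k - 1)" by (simp add: k)
      also have "\<dots> \<le> Q" by (rule Suc.prems(7))
      finally show ?thesis .
    qed
    have "\<exists>A\<subseteq>X'. finite A \<and> card A = 4 * D * t \<and> multipartite_family E k A"
    proof (rule Suc.IH[where D = "2 * D"])
      show "X' \<subseteq> {L. set L \<subseteq> V \<and> length L = k}" by (auto simp: X'_def)
      show "\<forall>L\<in>X'. clique_tuple E L"
      proof
        fix L assume "L \<in> X'"
        then have "?n \<le> 2 * D * card (ext L)" by (simp add: X'_def)
        then have "card (ext L) > 0" using \<open>?n > 0\<close> by (cases "card (ext L)") simp_all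
        then obtain v where "v # L \<in> X" using fin_ext[of L] by (auto simp: ext_def card_gt_0_iff)
        then have c: "clique_tuple E (v # L)" using Suc.prems(3) by blast
        show "clique_tuple E L"
          unfolding clique_tuple_def
        proof (intro allI impI)
          fix i j assume "i < length L" "j < length L" "i \<noteq> j"
          then show "(L ! i, L ! j) \<in> E"
            using c[unfolded clique_tuple_def, rule_format, of "Suc i" "Suc j"] by simp
        qed
      qed
    qed (use 3 Suc.prems X'_card t'Q in \<open>simp_all add: mult_ac\<close>)
    then obtain A where A: "A \<subseteq> X'" "finite A" "card A = 4 * D * t" "multipartite_family E k A" by blast
    let ?M = "4 * D * t"
    have "?M \<le> Q"
    proof -
      have "?M * 1 \<le> ?M * F ^ (k - 1)" using \<open>F > 0\<close> by (intro mult_le_mono) auto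
      also have "\<dots> \<le> Q" by (rule t'Q)
      finally show ?thesis by simp
    qed
    \<comment> \<open>\<open>B v\<close> records the tails of \<open>A\<close> that \<open>v\<close>
      extends. By double counting at least n / (4 D) vertices extend \<open>t\<close> or more of
      them; these form \<open>V'\<close>.\<close>
    define B where "B v = {L \<in> A. v # L \<in> X}" for v
    define V' where "V' = {v \<in> V. t \<le> card (B v)}"
    have "2 * D * (2 * t * ?n) = card A * ?n" using A by simp
    also have "\<dots> \<le> (\<Sum>L\<in>A. 2 * D * card (ext L))"
    proof -
      have "(\<Sum>L\<in>A. ?n) \<le> (\<Sum>L\<in>A. 2 * D * card (ext L))"
        using A by (intro sum_mono) (auto simp: X'_def)
      then show ?thesis by simp
    qed
    also have "\<dots> = 2 * D * (\<Sum>v\<in>V. card (B v))"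
      unfolding ext_def B_def using sum_card_swap[OF A(2) \<open>finite V\<close>, of "\<lambda>L v. v # L \<in> X"]
      by (simp flip: sum_distrib_left)
    finally have "2 * t * ?n \<le> (\<Sum>v\<in>V. card (B v))" using Suc.prems(4) by simp
    also have "\<dots> \<le> (\<Sum>v\<in>V. (if v \<in> V' then ?M else 0) + t)"
    proof (rule sum_mono)
      fix v assume "v \<in> V"
      have "card (B v) \<le> card A" unfolding B_def using A by (intro card_mono) auto
      then show "card (B v) \<le> (if v \<in> V' then ?M else 0) + t"
        using A \<open>v \<in> V\<close> by (auto simp: V'_def)
    qed
    also have "\<dots> = card V' * ?M + ?n * t"
    proof -
      have "V \<inter> V' = V'" by (auto simp: V'_def)
      then show ?thesis using \<open>finite V\<close> by (simp add: sum.distrib sum.If_cases)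
    qed
    finally have "t * ?n \<le> t * (4 * D * card V')" by (simp add: algebra_simps)
    then have V'_card: "?n \<le> 4 * D * card V'" using 3 by simp
    \<comment> \<open>Pigeonhole over the at most 2^(4 D t) values of \<open>B\<close>: with only
      \<open>t\<close> vertices or fewer for each value, \<open>V'\<close> would be smaller than n /
      (4 D).\<close>
    have "\<exists>v0\<in>V'. t \<le> card {w \<in> V'. B w = B v0}"
    proof (rule ccontr)
      assume "\<not> ?thesis"
      then have small: "card {w \<in> V'. B w = B v} \<le> t" if "v \<in> V'" for v using that by force
      have "finite V'" using \<open>finite V\<close> by (simp add: V'_def)
      have sub: "B ` V' \<subseteq> Pow A" by (auto simp: B_def)
      then have finBV: "finite (B ` V')" using A by (meson finite_Pow_iff finite_subset)
      have "V' = (\<Union>S\<in>B ` V'. {w \<in> V'. B w = S})" by auto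
      then have "card V' \<le> (\<Sum>S\<in>B ` V'. card {w \<in> V'. B w = S})"
        using card_UN_le[OF finBV, of "\<lambda>S. {w \<in> V'. B w = S}"] by simp
      also have "\<dots> \<le> (\<Sum>S\<in>B ` V'. t)" using small by (intro sum_mono) auto
      also have "\<dots> = card (B ` V') * t" by simp
      also have "\<dots> \<le> 2 ^ ?M * t"
        using card_mono[OF _ sub] A by (intro mult_le_mono1) (simp add: card_Pow)
      finally have "4 * D * card V' \<le> 4 * D * (2 ^ ?M * t)" by (rule mult_le_mono2)
      then have upper: "F * Q * 2 ^ Q \<le> 4 * D * (2 ^ ?M * t)" using V'_card Suc.prems(8) by linarith
      have lower: "8 * D * (t * 2 ^ ?M) \<le> F * (Q * 2 ^ Q)"
      proof (intro mult_le_mono DF)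
        have "t * 1 \<le> t * F ^ (Suc k - 1)" using \<open>F > 0\<close> by (intro mult_le_mono) auto
        also have "\<dots> \<le> Q" by (rule Suc.prems(7))
        finally show "t \<le> Q" by simp
        show "(2::nat) ^ ?M \<le> 2 ^ Q" using \<open>?M \<le> Q\<close> by (intro power_increasing) auto
      qed
      define P where "P = D * (2 ^ ?M * t)"
      have "8 * P = 8 * D * (t * 2 ^ ?M)" by (simp only: P_def mult_ac)
      also note lower
      also have "F * (Q * 2 ^ Q) = F * Q * 2 ^ Q" by (simp only: mult.assoc)
      also note upper
      also have "4 * D * (2 ^ ?M * t) = 4 * P" by (simp only: P_def mult_ac)
      finally have "8 * P \<le> 4 * P" .
      moreover have "0 < P" unfolding P_def using 3 Suc.prems(4) by simp
      ultimately show False by simp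
    qed
    then obtain v0 where v0: "v0 \<in> V'" "t \<le> card {w \<in> V'. B w = B v0}" by blast
    have "t \<le> card (B v0)" using v0 by (simp add: V'_def)
    then obtain B1 where B1: "B1 \<subseteq> B v0" "card B1 = t" "finite B1"
      by (rule obtain_subset_with_card_n)
    obtain T where T: "T \<subseteq> {w \<in> V'. B w = B v0}" "card T = t" "finite T"
      using v0(2) by (rule obtain_subset_with_card_n)
    obtain h where h: "bij_betw h B1 T"
      using finite_same_card_bij[OF B1(3) T(3)] B1(2) T(2) by auto
    have hT: "h L \<in> T" if "L \<in> B1" for L using h that by (rule bij_betw_apply)
    have h_inj: "h L \<noteq> h L'" if "L \<in> B1" "L' \<in> B1" "L \<noteq> L'" for L L'
      using h that by (auto simp: bij_betw_def inj_on_def)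
    \<comment> \<open>All vertices of \<open>T\<close> extend the same tails, so any of them may
      precede any tail of \<open>B1\<close>. The pairing \<open>h\<close> only serves to keep the
      new first entries distinct.\<close>
    have inX: "h L # L' \<in> X" if "L \<in> B1" "L' \<in> B1" for L L'
    proof -
      have "B (h L) = B v0" using hT[OF that(1)] T by auto
      then have "L' \<in> B (h L)" using B1 that by auto
      then show ?thesis by (simp add: B_def)
    qed
    have B1A: "B1 \<subseteq> A" using B1 by (auto simp: B_def)
    have "multipartite_family E (Suc k) ((\<lambda>L. h L # L) ` B1)"
      unfolding multipartite_family_def
    proof (intro ballI conjI allI impI)
      fix x y assume "x \<in> (\<lambda>L. h L # L) ` B1" "y \<in> (\<lambda>L. h L # L) ` B1"
      then obtain L L' where L: "L \<in> B1" "x = h L # L" "L' \<in> B1" "y = h L' # L'" by blast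
      have "length (h L # L') = Suc k" "length (h L' # L) = Suc k"
        using inX[OF L(1,3)] inX[OF L(3,1)] Suc.prems(2) by auto
      then have len: "length L' = k" "length L = k" by simp_all
      have LA: "L \<in> A" "L' \<in> A" using B1A L by auto
      note * = bspec[OF bspec[OF A(4)[unfolded multipartite_family_def] LA(1)] LA(2)]
      have fam: "\<forall>i<k. \<forall>j<k. i \<noteq> j \<longrightarrow> (L ! i, L' ! j) \<in> E"
        by (rule conjunct1[OF *])
      have fam2: "L \<noteq> L' \<longrightarrow> (\<forall>i<k. L ! i \<noteq> L' ! i)"
        by (rule conjunct2[OF *])
      { fix i j assume ij: "i < Suc k" "j < Suc k" "i \<noteq> j"
        consider "i = 0" | "j = 0" | i' j' where "i = Suc i'" "j = Suc j'" by (cases i; cases j) auto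
        then show "(x ! i, y ! j) \<in> E"
        proof cases
          case 1
          have "clique_tuple E (h L # L')" using Suc.prems(3) inX[OF L(1,3)] by blast
          then have "((h L # L') ! i, (h L # L') ! j) \<in> E"
            using ij len unfolding clique_tuple_def by simp
          then show ?thesis using 1 ij L by (cases j) auto
        next
          case 2
          have "clique_tuple E (h L' # L)" using Suc.prems(3) inX[OF L(3,1)] by blast
          then have "((h L' # L) ! i, (h L' # L) ! j) \<in> E"
            using ij len unfolding clique_tuple_def by simp
          then show ?thesis using 2 ij L by (cases i) auto
        next
          case 3
          then show ?thesis using fam L(2,4) ij by simp
        qed }
      fix i assume "x \<noteq> y" "i < Suc k"
      then have "L \<noteq> L'" using L by auto
      then show "x ! i \<noteq> y ! i"
        using fam2 L(2,4) h_inj[OF L(1,3)] \<open>i < Suc k\<close> by (cases i) simp_all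
    qed
    moreover have "(\<lambda>L. h L # L) ` B1 \<subseteq> X" using inX by auto
    moreover have "card ((\<lambda>L. h L # L) ` B1) = t" using B1 by (subst card_image) (auto simp: inj_on_def)
    ultimately show ?thesis using B1(3) by (intro exI[of _ "(\<lambda>L. h L # L) ` B1"]) auto
  qed
qed

section \<open>Dense graphs with large cliques\<close>

definition is_clique :: "'a rel \<Rightarrow> 'a set \<Rightarrow> bool" where
  "is_clique E S \<longleftrightarrow> (\<forall>a\<in>S. \<forall>b\<in>S. a \<noteq> b \<longrightarrow> (a, b) \<in> E)"

text \<open>For an irreflexive relation a vertex of \<open>V\<close> counts among its own
  non-neighbours. The bound (4 r + 5) n / (4 r (r + 1)) imposed on their number below equals (1 / r
  + 1 / (4 r (r + 1))) n, slightly more than the share n / r in a balanced r-partite graph.\<close>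

abbreviation non_nbrs :: "'a rel \<Rightarrow> 'a set \<Rightarrow> 'a \<Rightarrow> 'a set" where
  "non_nbrs E V v \<equiv> {w \<in> V. (v, w) \<notin> E}"

text \<open>A vertex outside the set counted below misses at least two units of weight if the clique
  vertices of \<open>W\<close> weigh two units and those of \<open>S\<close> one. The total missed weight is too small for
  this to happen often.\<close>

lemma clique_exchange_vertices:
  fixes r :: nat
  assumes V: "finite V" "S \<subseteq> V" "W \<subseteq> V" and "sym E"
    and sparse: "\<And>v. v \<in> V \<Longrightarrow> 4 * r * (r + 1) * card (non_nbrs E V v) \<le> (4 * r + 5) * card V"
    and S: "card S \<ge> 3" and W: "card W + card S = r + 1"
  shows "(card S - 2) * card V
    \<le> 4 * r * card {z \<in> V. \<exists>q\<in>S. \<forall>x\<in>(S - {q}) \<union> W. (z, x) \<in> E}" (is "_ \<le> 4 * r * card ?Z")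
proof -
  let ?n = "card V" and ?N = "4 * r * (r + 1)"
  have fin: "finite S" "finite W" using V finite_subset by auto
  have pt: "2 \<le> 2 * card {x \<in> W. (z, x) \<notin> E} + card {x \<in> S. (z, x) \<notin> E}" if z: "z \<in> V" "z \<notin> ?Z" for z
  proof (cases "{x \<in> W. (z, x) \<notin> E} = {}")
    case False
    then have "card {x \<in> W. (z, x) \<notin> E} \<ge> 1" using fin by (simp add: Suc_le_eq card_gt_0_iff)
    then show ?thesis by linarith
  next
    case True
    have "\<not> card {x \<in> S. (z, x) \<notin> E} \<le> 1"
    proof
      assume "card {x \<in> S. (z, x) \<notin> E} \<le> 1"
      then obtain q where q: "q \<in> S" "{x \<in> S. (z, x) \<notin> E} \<subseteq> {q}"
      proof (cases "{x \<in> S. (z, x) \<notin> E} = {}")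
        case True
        obtain q where "q \<in> S" using S by (metis card.empty not_numeral_le_zero equals0I)
        then show thesis using that[of q] True by blast
      next
        case False
        then have "0 < card {x \<in> S. (z, x) \<notin> E}" using fin by (subst card_gt_0_iff) simp
        then have "card {x \<in> S. (z, x) \<notin> E} = 1"
          using \<open>card {x \<in> S. (z, x) \<notin> E} \<le> 1\<close> by linarith
        then obtain q where "{x \<in> S. (z, x) \<notin> E} = {q}" by (rule card_1_singletonE)
        then show thesis using that[of q] by blast
      qed
      then have "z \<in> ?Z" using z(1) True by blast
      then show False using z(2) by simp
    qed
    then show ?thesis by linarith
  qed
  have swap: "(\<Sum>z\<in>V. card {x \<in> T. (z, x) \<notin> E}) = (\<Sum>x\<in>T. card (non_nbrs E V x))"
    if "finite T" for T
  proof -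
    have "(z, x) \<notin> E \<longleftrightarrow> (x, z) \<notin> E" for z x using \<open>sym E\<close> by (meson symD)
    then show ?thesis using sum_card_swap[OF V(1) that, of "\<lambda>z x. (z, x) \<notin> E"] by simp
  qed
  have bound: "?N * (\<Sum>x\<in>T. card (non_nbrs E V x)) \<le> card T * ((4 * r + 5) * ?n)" if "T \<subseteq> V" for T
  proof -
    have "(\<Sum>x\<in>T. ?N * card (non_nbrs E V x)) \<le> (\<Sum>x\<in>T. (4 * r + 5) * ?n)"
      using sparse that by (intro sum_mono) auto
    then show ?thesis by (simp add: sum_distrib_left)
  qed
  have "?Z \<subseteq> V" by auto
  have "2 * (?n - card ?Z) = (\<Sum>z\<in>V - ?Z. 2)"
    using V(1) \<open>?Z \<subseteq> V\<close> by (simp add: card_Diff_subset finite_subset)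
  also have "\<dots> \<le> (\<Sum>z\<in>V - ?Z. 2 * card {x \<in> W. (z, x) \<notin> E} + card {x \<in> S. (z, x) \<notin> E})"
    using pt by (intro sum_mono) blast
  also have "\<dots> \<le> (\<Sum>z\<in>V. 2 * card {x \<in> W. (z, x) \<notin> E} + card {x \<in> S. (z, x) \<notin> E})"
    using V(1) by (intro sum_mono2) auto
  also have "\<dots> = 2 * (\<Sum>x\<in>W. card (non_nbrs E V x)) + (\<Sum>x\<in>S. card (non_nbrs E V x))"
    by (simp add: sum.distrib swap fin flip: sum_distrib_left)
  finally have "?N * (2 * (?n - card ?Z))
      \<le> ?N * (2 * (\<Sum>x\<in>W. card (non_nbrs E V x)) + (\<Sum>x\<in>S. card (non_nbrs E V x)))"
    by (rule mult_le_mono2)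
  also have "\<dots> \<le> (2 * card W + card S) * ((4 * r + 5) * ?n)"
    using bound[OF V(2)] bound[OF V(3)] by (simp add: algebra_simps)
  finally have *: "real (?N * (2 * (?n - card ?Z))) \<le> real ((2 * card W + card S) * ((4 * r + 5) * ?n))"
    by (rule of_nat_mono)
  have "card ?Z \<le> ?n" using V(1) by (intro card_mono) auto
  then have "real (?n - card ?Z) = real ?n - real (card ?Z)" by (rule of_nat_diff)
  moreover have "real ?N = 4 * real r * (real r + 1)" by (simp add: algebra_simps)
  moreover have "2 * real (card W) + real (card S) = 2 * (real r + 1) - real (card S)"
    using arg_cong[OF W, of real] by simp
  ultimately have "4 * real r * (real r + 1) * (2 * (real ?n - real (card ?Z)))
      \<le> (2 * (real r + 1) - real (card S)) * ((4 * real r + 5) * real ?n)"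
    using * by (simp only: of_nat_mult of_nat_add of_nat_numeral)
  then have h1: "real ?n * (8 * real r * (real r + 1) - (2 * (real r + 1) - real (card S)) * (4 * real r + 5))
      \<le> 2 * (real r + 1) * (4 * real r * real (card ?Z))"
    by (simp add: algebra_simps)
  \<comment> \<open>With s = \<open>card S\<close> the right side exceeds the left by s (2 r + 3) -
    6 (r + 1), which is positive for s \<ge> 3.\<close>
  have "2 * (real r + 1) * (real (card S) - 2)
      \<le> 8 * real r * (real r + 1) - (2 * (real r + 1) - real (card S)) * (4 * real r + 5)"
  proof -
    have "3 * (2 * real r + 3) \<le> real (card S) * (2 * real r + 3)"
      using S by (intro mult_right_mono) auto
    then show ?thesis by (simp add: algebra_simps)
  qed
  then have "real ?n * (2 * (real r + 1) * (real (card S) - 2))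
     \<le> real ?n * (8 * real r * (real r + 1) - (2 * (real r + 1) - real (card S)) * (4 * real r + 5))"
    by (rule mult_left_mono) simp
  also note h1
  also have "real ?n * (2 * (real r + 1) * (real (card S) - 2))
      = 2 * (real r + 1) * (real ?n * (real (card S) - 2))"
    by (simp only: mult_ac)
  finally have "2 * (real r + 1) * (real ?n * (real (card S) - 2))
      \<le> 2 * (real r + 1) * (4 * real r * real (card ?Z))" .
  then have "real ?n * (real (card S) - 2) \<le> 4 * real r * real (card ?Z)"
    by (rule mult_left_le_imp_le) simp
  moreover have "real (card S - 2) = real (card S) - 2" using S by simp
  ultimately have "real ((card S - 2) * ?n) \<le> real (4 * r * card ?Z)"
    by (simp add: mult_ac)
  then show ?thesis by (rule of_nat_le_iff[THEN iffD1])
qed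

text \<open>Each step replaces one clique vertex. Every tuple of \<open>X\<close> forms an (r +
  1)-clique with \<open>S\<close>, and by the preceding count many vertices can take the place of
  some \<open>q\<close> in \<open>S\<close>; averaging over \<open>S\<close> picks one
  \<open>q\<close> that serves a fair share of all tuples. The cost per step is 12 r, a factor 4 r
  from the count and 3 from s \<le> 3 (s - 2). The bound on \<open>j\<close> leaves at least two
  vertices in \<open>S\<close>.\<close>

lemma joint_exists:
  fixes r :: nat
  assumes V: "finite V" "E \<subseteq> V \<times> V" "sym E" "irrefl E"
    and sparse: "\<And>v. v \<in> V \<Longrightarrow> 4 * r * (r + 1) * card (non_nbrs E V v) \<le> (4 * r + 5) * card V"
    and K: "K \<subseteq> V" "card K = r + 1" "is_clique E K"
  shows "j + 1 \<le> r \<Longrightarrow> \<exists>S X. S \<subseteq> V \<and> card S = r + 1 - j \<and>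
    X \<subseteq> {L. set L \<subseteq> V \<and> length L = j} \<and>
    (\<forall>L\<in>X. is_clique E (S \<union> set L) \<and> clique_tuple E L \<and> S \<inter> set L = {}) \<and>
    card V ^ j \<le> (12 * r) ^ j * card X"
proof (induction j)
  case 0
  show ?case using K by (intro exI[of _ K] exI[of _ "{[]}"]) (auto simp: clique_tuple_def)
next
  case (Suc j)
  let ?n = "card V"
  obtain S X where S: "S \<subseteq> V" "card S = r + 1 - j" and X: "X \<subseteq> {L. set L \<subseteq> V \<and> length L = j}"
    and good: "\<And>L. L \<in> X \<Longrightarrow> is_clique E (S \<union> set L)" "\<And>L. L \<in> X \<Longrightarrow> clique_tuple E L"
      "\<And>L. L \<in> X \<Longrightarrow> S \<inter> set L = {}"
    and cardX: "?n ^ j \<le> (12 * r) ^ j * card X"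
    using Suc by auto
  have finX: "finite X" using X finite_lists_length_eq[OF V(1)] finite_subset by blast
  have finS: "finite S" using S V(1) finite_subset by blast
  have irr: "(x, x) \<notin> E" for x using V(4) by (auto simp: irrefl_def)
  define Z where "Z q L = {z \<in> V. \<forall>x\<in>(S - {q}) \<union> set L. (z, x) \<in> E}" for q L
  define s where "s = card S"
  have s3: "s \<ge> 3" using Suc.prems S(2) by (simp add: s_def)
  have Zfin: "finite (Z q L)" for q L using V(1) by (simp add: Z_def)
  have ex: "(s - 2) * ?n \<le> 4 * r * (\<Sum>q\<in>S. card (Z q L))" if L: "L \<in> X" for L
  proof -
    have distinct: "distinct L"
      using good(2)[OF L] irr unfolding clique_tuple_def distinct_conv_nth by metis
    then have "card (set L) = j" using distinct_card X L by fastforce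
    then have "card (set L) + card S = r + 1" using S(2) Suc.prems by linarith
    then have "(s - 2) * ?n \<le> 4 * r * card {z \<in> V. \<exists>q\<in>S. \<forall>x\<in>(S - {q}) \<union> set L. (z, x) \<in> E}"
      unfolding s_def using X L s3[unfolded s_def]
      by (intro clique_exchange_vertices[OF V(1) S(1) _ V(3) sparse]) auto
    also have "{z \<in> V. \<exists>q\<in>S. \<forall>x\<in>(S - {q}) \<union> set L. (z, x) \<in> E} = (\<Union>q\<in>S. Z q L)"
      by (auto simp: Z_def)
    also have "4 * r * card (\<Union>q\<in>S. Z q L) \<le> 4 * r * (\<Sum>q\<in>S. card (Z q L))"
      using finS by (intro mult_le_mono2 card_UN_le)
    finally show ?thesis .
  qed
  have "\<exists>q\<in>S. (s - 2) * ?n * card X \<le> s * (4 * r * (\<Sum>L\<in>X. card (Z q L)))"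
  proof (rule ccontr)
    assume "\<not> ?thesis"
    then have less: "s * (4 * r * (\<Sum>L\<in>X. card (Z q L))) < (s - 2) * ?n * card X" if "q \<in> S" for q
      using that by (meson not_le)
    have "s * ((s - 2) * ?n * card X) = s * (\<Sum>L\<in>X. (s - 2) * ?n)" by simp
    also have "\<dots> \<le> s * (\<Sum>L\<in>X. 4 * r * (\<Sum>q\<in>S. card (Z q L)))"
      using ex by (intro mult_le_mono2 sum_mono) auto
    also have "\<dots> = (\<Sum>q\<in>S. s * (4 * r * (\<Sum>L\<in>X. card (Z q L))))"
      by (simp add: sum_distrib_left sum.swap[of _ X S])
    also have "\<dots> < (\<Sum>q\<in>S. (s - 2) * ?n * card X)"
      using less finS s3 by (intro sum_strict_mono) (auto simp: s_def)
    also have "\<dots> = s * ((s - 2) * ?n * card X)" by (simp add: s_def)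
    finally show False by simp
  qed
  then obtain q where q: "q \<in> S" "(s - 2) * ?n * card X \<le> s * (4 * r * (\<Sum>L\<in>X. card (Z q L)))" by blast
  define Y where "Y = (\<lambda>(L, z). z # L) ` (SIGMA L:X. Z q L)"
  have "card Y = (\<Sum>L\<in>X. card (Z q L))"
    unfolding Y_def using finX Zfin by (subst card_image) (auto simp: inj_on_def)
  with mult_le_mono2[OF q(2), of 3]
  have le3: "3 * ((s - 2) * ?n * card X) \<le> 3 * (s * (4 * r * card Y))" by (simp only:)
  have "s * (?n * card X) \<le> 3 * ((s - 2) * ?n * card X)"
  proof -
    have "s \<le> 3 * (s - 2)" using s3 by simp
    then have "s * (?n * card X) \<le> 3 * (s - 2) * (?n * card X)" by (rule mult_le_mono1)
    then show ?thesis by (simp add: mult_ac)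
  qed
  also note le3
  also have "3 * (s * (4 * r * card Y)) = s * (12 * r * card Y)" by simp
  finally have "s * (?n * card X) \<le> s * (12 * r * card Y)" .
  then have nX: "?n * card X \<le> 12 * r * card Y" using s3 by simp
  have "?n ^ Suc j \<le> ?n * ((12 * r) ^ j * card X)" using cardX by simp
  also have "\<dots> \<le> (12 * r) ^ j * (12 * r * card Y)" using mult_le_mono2[OF nX, of "(12 * r) ^ j"] by (simp add: mult_ac)
  finally have cardY: "?n ^ Suc j \<le> (12 * r) ^ Suc j * card Y" by (simp add: mult_ac)
  have Y: "Y \<subseteq> {L. set L \<subseteq> V \<and> length L = Suc j}" 
  proof
    fix M assume "M \<in> Y"
    then obtain z L where M: "M = z # L" "L \<in> X" "z \<in> V" by (auto simp: Y_def Z_def)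
    then have "set L \<subseteq> V \<and> length L = j" using X by blast
    then show "M \<in> {L. set L \<subseteq> V \<and> length L = Suc j}" using M by simp
  qed
  have goodY: "is_clique E ((S - {q}) \<union> set M) \<and> clique_tuple E M \<and> (S - {q}) \<inter> set M = {}"
    if MY: "M \<in> Y" for M
  proof -
    obtain z L where M: "M = z # L" "L \<in> X" "z \<in> Z q L" using MY by (auto simp: Y_def)
    have z: "(z, x) \<in> E" "(x, z) \<in> E" if "x \<in> (S - {q}) \<union> set L" for x
      using M(3) that V(3) by (auto simp: Z_def dest: symD)
    have "is_clique E ((S - {q}) \<union> set M)"
      using good(1)[OF M(2)] z unfolding is_clique_def M(1) by auto
    moreover have "clique_tuple E M"
      unfolding clique_tuple_def
    proof (intro allI impI)
      fix a b assume ab: "a < length M" "b < length M" "a \<noteq> b"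
      show "(M ! a, M ! b) \<in> E"
        using ab z good(2)[OF M(2)] unfolding clique_tuple_def M(1)
        by (cases a; cases b) auto
    qed
    moreover have "z \<notin> S - {q}" using z(1)[of z] irr by blast
    then have "(S - {q}) \<inter> set M = {}" using good(3)[OF M(2)] by (auto simp: M(1))
    ultimately show ?thesis by blast
  qed
  show ?case
    using S q(1) finS Y goodY cardY Suc.prems
    by (intro exI[of _ "S - {q}"] exI[of _ Y]) (auto simp: card_Diff_singleton)
qed

text \<open>After r - 1 exchanges \<open>S\<close> is an edge u v. Each (r - 1)-tuple is then
  preceded by a common neighbour of its entries, of which there are at least n / (2 r) and which
  need not be adjacent to \<open>u\<close> or \<open>v\<close>. This is why column 0 is exempt in
  the conclusion: it is the part that takes in the critical edge.\<close>

lemma edge_with_multipartite_family: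
  fixes r :: nat
  assumes V: "finite V" "E \<subseteq> V \<times> V" "sym E" "irrefl E" and "r \<ge> 2"
    and sparse: "\<And>v. v \<in> V \<Longrightarrow> 4 * r * (r + 1) * card (non_nbrs E V v) \<le> (4 * r + 5) * card V"
    and K: "K \<subseteq> V" "card K = r + 1" "is_clique E K"
    and size: "F = 2 ^ (r + 1) * (12 * r) ^ r" "t * F ^ (r - 1) \<le> Q" "F * Q * 2 ^ Q \<le> card V"
  obtains u v A where "(u, v) \<in> E" "finite A" "card A = t" "multipartite_family E r A"
    "\<forall>L\<in>A. \<forall>i. 0 < i \<and> i < r \<longrightarrow> (u, L ! i) \<in> E \<and> (v, L ! i) \<in> E"
proof -
  let ?n = "card V"
  have "\<exists>S X. S \<subseteq> V \<and> card S = r + 1 - (r - 1) \<and>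
    X \<subseteq> {L. set L \<subseteq> V \<and> length L = r - 1} \<and>
    (\<forall>L\<in>X. is_clique E (S \<union> set L) \<and> clique_tuple E L \<and> S \<inter> set L = {}) \<and>
    ?n ^ (r - 1) \<le> (12 * r) ^ (r - 1) * card X"
    using \<open>r \<ge> 2\<close> by (intro joint_exists[OF V sparse K]) auto
  then obtain S X where S: "S \<subseteq> V" "card S = 2" and X: "X \<subseteq> {L. set L \<subseteq> V \<and> length L = r - 1}"
    and good: "\<forall>L\<in>X. is_clique E (S \<union> set L) \<and> clique_tuple E L \<and> S \<inter> set L = {}"
    and cardX: "?n ^ (r - 1) \<le> (12 * r) ^ (r - 1) * card X"
    using \<open>r \<ge> 2\<close> by auto
  have finX: "finite X" using X finite_lists_length_eq[OF V(1)] finite_subset by blast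
  obtain u v where uv: "S = {u, v}" "u \<noteq> v" using S(2) by (auto simp: card_2_iff)
  define Z where "Z L = {z \<in> V. \<forall>x\<in>set L. (z, x) \<in> E}" for L
  have Zfin: "finite (Z L)" for L using V(1) by (simp add: Z_def)
  have Zcard: "?n \<le> 2 * r * card (Z L)" if L: "L \<in> X" for L
  proof -
    let ?N = "4 * r * (r + 1)"
    have sub: "set L \<subseteq> V" "length L = r - 1" using L X by auto
    have "V - Z L \<subseteq> (\<Union>x\<in>set L. non_nbrs E V x)" using V(3) by (auto simp: Z_def dest: symD)
    then have "card (V - Z L) \<le> card (\<Union>x\<in>set L. non_nbrs E V x)"
      using V(1) by (intro card_mono) auto
    also have "\<dots> \<le> (\<Sum>x\<in>set L. card (non_nbrs E V x))" by (intro card_UN_le) simp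
    finally have "?N * card (V - Z L) \<le> ?N * (\<Sum>x\<in>set L. card (non_nbrs E V x))"
      by (rule mult_le_mono2)
    also have "\<dots> = (\<Sum>x\<in>set L. ?N * card (non_nbrs E V x))" by (rule sum_distrib_left)
    also have "\<dots> \<le> (\<Sum>x\<in>set L. (4 * r + 5) * ?n)" using sparse sub by (intro sum_mono) auto
    also have "\<dots> \<le> (r - 1) * ((4 * r + 5) * ?n)" using card_length[of L] sub by simp
    finally have *: "real (?N * card (V - Z L)) \<le> real ((r - 1) * ((4 * r + 5) * ?n))" by (rule of_nat_mono)
    have "Z L \<subseteq> V" by (auto simp: Z_def)
    then have "real (card (V - Z L)) = real ?n - real (card (Z L))"
      using V(1) by (simp add: card_Diff_subset card_mono finite_subset of_nat_diff)
    moreover have "real (r - 1) = real r - 1" using \<open>r \<ge> 2\<close> by simp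
    moreover have "real ?N = 4 * real r * (real r + 1)" by (simp add: algebra_simps)
    ultimately have "4 * real r * (real r + 1) * (real ?n - real (card (Z L)))
        \<le> (real r - 1) * ((4 * real r + 5) * real ?n)"
      using * by (simp only: of_nat_mult of_nat_add of_nat_numeral)
    then have h: "real ?n * (3 * real r + 5) \<le> 2 * (real r + 1) * (2 * real r * real (card (Z L)))"
      by (simp add: algebra_simps)
    have "2 * (real r + 1) * real ?n \<le> real ?n * (3 * real r + 5)"
      using mult_left_mono[of "2 * (real r + 1)" "3 * real r + 5" "real ?n"] by (simp add: mult_ac)
    also note h
    finally have "2 * (real r + 1) * real ?n \<le> 2 * (real r + 1) * (2 * real r * real (card (Z L)))" .
    then have "real ?n \<le> 2 * real r * real (card (Z L))" by (rule mult_left_le_imp_le) simp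
    then have "real ?n \<le> real (2 * r * card (Z L))" by simp
    then show ?thesis by (rule of_nat_le_iff[THEN iffD1])
  qed
  define Y where "Y = (\<lambda>(L, z). z # L) ` (SIGMA L:X. Z L)"
  have cY: "card Y = (\<Sum>L\<in>X. card (Z L))"
    unfolding Y_def using finX Zfin by (subst card_image) (auto simp: inj_on_def)
  have "?n * card X = (\<Sum>L\<in>X. ?n)" by simp
  also have "\<dots> \<le> (\<Sum>L\<in>X. 2 * r * card (Z L))" using Zcard by (intro sum_mono) auto
  also have "\<dots> = 2 * r * card Y" by (simp add: cY sum_distrib_left)
  also have "\<dots> \<le> 12 * r * card Y" by simp
  finally have nX: "?n * card X \<le> 12 * r * card Y" .
  have r: "x ^ r = x * x ^ (r - 1)" for x :: nat using \<open>r \<ge> 2\<close> by (cases r) auto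
  have "?n ^ r \<le> ?n * ((12 * r) ^ (r - 1) * card X)" using cardX by (simp add: r)
  also have "\<dots> \<le> (12 * r) ^ (r - 1) * (12 * r * card Y)"
    using mult_le_mono2[OF nX, of "(12 * r) ^ (r - 1)"] by (simp add: mult_ac)
  finally have cardY: "?n ^ r \<le> (12 * r) ^ r * card Y" by (simp add: r mult_ac)
  have cons: "clique_tuple E M \<and> (\<forall>i. 0 < i \<and> i < r \<longrightarrow> (u, M ! i) \<in> E \<and> (v, M ! i) \<in> E)
      \<and> set M \<subseteq> V \<and> length M = r" if MY: "M \<in> Y" for M
  proof -
    obtain z L where M: "M = z # L" "L \<in> X" "z \<in> Z L" using MY by (auto simp: Y_def)
    have L: "set L \<subseteq> V" "length L = r - 1" using M(2) X by auto
    have z: "(z, x) \<in> E" "(x, z) \<in> E" if "x \<in> set L" for x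
      using M(3) that V(3) by (auto simp: Z_def dest: symD)
    have c: "clique_tuple E L" "is_clique E (S \<union> set L)" "S \<inter> set L = {}" using good M(2) by auto
    have "clique_tuple E M"
      unfolding clique_tuple_def
    proof (intro allI impI)
      fix a b assume ab: "a < length M" "b < length M" "a \<noteq> b"
      show "(M ! a, M ! b) \<in> E"
        using ab z c(1) unfolding clique_tuple_def M(1) by (cases a; cases b) auto
    qed
    moreover have "(u, M ! i) \<in> E \<and> (v, M ! i) \<in> E" if i: "0 < i" "i < r" for i
    proof -
      have "M ! i = L ! (i - 1)" "i - 1 < length L" using i L by (auto simp: M(1))
      then have "M ! i \<in> set L" by simp
      then have "M ! i \<in> S \<union> set L" "u \<noteq> M ! i" "v \<noteq> M ! i" using c(3) uv(1) by auto
      moreover have "u \<in> S \<union> set L" "v \<in> S \<union> set L" using uv(1) by auto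
      ultimately show ?thesis using c(2) unfolding is_clique_def by blast
    qed
    moreover have "z \<in> V" using M(3) by (simp add: Z_def)
    ultimately show ?thesis using L \<open>r \<ge> 2\<close> by (auto simp: M(1))
  qed
  \<comment> \<open>The density 1 / (12 r)^r of \<open>Y\<close> among all r-tuples is the origin of
    \<open>F\<close>.\<close>
  have "\<exists>A\<subseteq>Y. finite A \<and> card A = t \<and> multipartite_family E r A"
  proof (rule multipartite_family_exists[OF V(1) _ _ _ _ cardY])
    show "2 ^ (r + 1) * (12 * r) ^ r \<le> F" by (simp add: size)
  qed (use cons size \<open>r \<ge> 2\<close> in auto)
  then obtain A where A: "A \<subseteq> Y" "finite A" "card A = t" "multipartite_family E r A" by blast
  have "X \<noteq> {}" if "?n > 0"
  proof
    assume "X = {}"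
    then have "?n ^ (r - 1) = 0" using cardX by simp
    then show False using that by simp
  qed
  moreover have "?n > 0" using S uv V(1) by (auto simp: card_gt_0_iff)
  ultimately obtain L where "L \<in> X" by blast
  then have "(u, v) \<in> E" using good uv unfolding is_clique_def by blast
  then show thesis using that A cons by blast
qed

text \<open>The critical edge goes to u v, and any other vertex \<open>x\<close> to entry
  \<open>d x\<close> of a tuple of its own. Vertices coloured like the ends of the critical edge lie
  in column 0, where adjacency to \<open>u\<close> and \<open>v\<close> is not asked for; all other
  arcs of \<open>H\<close> join different columns.\<close>

lemma critical_graph_embeds:
  assumes crit: "colour_critical r H" and G: "pair_graph G" and "r \<ge> 2"
    and uv: "(u, v) \<in> parcs G" and A: "finite A" "card A = card (pverts H)"
    and fam: "multipartite_family (parcs G) r A"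
    and nb: "\<forall>L\<in>A. \<forall>i. 0 < i \<and> i < r \<longrightarrow> (u, L ! i) \<in> parcs G \<and> (v, L ! i) \<in> parcs G"
  shows "contains_copy H G"
proof -
  have H: "pair_graph H" using crit by (simp add: colour_critical_def)
  obtain a b c where ab: "(a, b) \<in> parcs H" and c: "c ` pverts H \<subseteq> {..<r}" "c a = c b"
    "\<forall>(x, y)\<in>parcs H. {x, y} \<noteq> {a, b} \<longrightarrow> c x \<noteq> c y"
    by (rule critical_edge_colouring[OF crit])
  have abV: "a \<in> pverts H" "b \<in> pverts H" "a \<noteq> b"
    using parcs_in_pverts[OF H ab] parcs_irrefl[OF H] ab by auto
  have finH: "finite (pverts H)" by (rule finite_pverts[OF H])
  have "r > 0" using c(1) abV by auto
  \<comment> \<open>The colouring \<open>c\<close> with the common colour of \<open>a\<close> and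
    \<open>b\<close> swapped with 0.\<close>
  define d where "d x = (if c x = c a then 0 else if c x = 0 then c a else c x)" for x
  have d_less: "d x < r" if "x \<in> pverts H" for x
    using c(1) that abV \<open>r > 0\<close> by (auto simp: d_def)
  have d_eq: "d x = d y \<longleftrightarrow> c x = c y" for x y by (auto simp: d_def)
  have d0: "d x = 0 \<longleftrightarrow> c x = c a" for x by (auto simp: d_def)
  have Adj: "(x ! i, y ! j) \<in> parcs G" if "x \<in> A" "y \<in> A" "i < r" "j < r" "i \<noteq> j" for x y i j
    using fam that unfolding multipartite_family_def by blast
  have Inj: "x = y" if "x \<in> A" "y \<in> A" "i < r" "x ! i = y ! i" for x y i
    using fam that unfolding multipartite_family_def by blast
  \<comment> \<open>At most one tuple starts with \<open>u\<close> and one with \<open>v\<close>.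
    Without them there are still enough, since \<open>a\<close> and \<open>b\<close> take no
    tuple.\<close>
  define A' where "A' = {L \<in> A. L ! 0 \<noteq> u \<and> L ! 0 \<noteq> v}"
  have "card (A - A') \<le> 2"
  proof -
    have "inj_on (\<lambda>L. L ! 0) (A - A')" using Inj[OF _ _ \<open>r > 0\<close>] by (auto simp: inj_on_def)
    moreover have "(\<lambda>L. L ! 0) ` (A - A') \<subseteq> {u, v}" by (auto simp: A'_def)
    ultimately have "card (A - A') \<le> card {u, v}" by (intro card_inj_on_le) auto
    also have "\<dots> \<le> 2" by (simp add: card_insert_if)
    finally show ?thesis .
  qed
  moreover have "A' \<subseteq> A" by (auto simp: A'_def)
  then have "card (A - A') = card A - card A'" "card A' \<le> card A"
    using A(1) by (simp_all add: card_Diff_subset card_mono finite_subset)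
  moreover have "card (pverts H - {a, b}) = card (pverts H) - 2"
    using abV finH by (simp add: card_Diff_subset)
  ultimately have "card (pverts H - {a, b}) \<le> card A'" using A(2) by linarith
  then obtain h where h: "h ` (pverts H - {a, b}) \<subseteq> A'" "inj_on h (pverts H - {a, b})"
    using card_le_inj[of "pverts H - {a, b}" A'] A finH by (auto simp: A'_def)
  define f where "f x = (if x = a then u else if x = b then v else h x ! d x)" for x
  have hA: "h x \<in> A" "h x ! 0 \<noteq> u" "h x ! 0 \<noteq> v" if "x \<in> pverts H" "x \<noteq> a" "x \<noteq> b" for x
    using h(1) that by (auto simp: A'_def)
  have irr: "(x, x) \<notin> parcs G" for x by (rule parcs_irrefl[OF G])
  have nbr: "(u, h x ! d x) \<in> parcs G \<and> (v, h x ! d x) \<in> parcs G"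
    if "x \<in> pverts H" "x \<noteq> a" "x \<noteq> b" "d x \<noteq> 0" for x
    using nb hA(1)[OF that(1-3)] d_less[OF that(1)] that(4) by simp
  have ne: "h x ! d x \<noteq> u" "h x ! d x \<noteq> v" if "x \<in> pverts H" "x \<noteq> a" "x \<noteq> b" for x
    using nbr[OF that] hA[OF that] irr by (cases "d x = 0"; metis)+
  have "u \<noteq> v" using uv irr by auto
  have "embeds f H G"
    unfolding embeds_def
  proof (intro conjI)
    show "inj_on f (pverts H)"
    proof (rule inj_onI)
      fix x y assume xy: "x \<in> pverts H" "y \<in> pverts H" "f x = f y"
      show "x = y"
      proof (cases "x \<in> {a, b} \<or> y \<in> {a, b}")
        case True
        then show ?thesis using xy ne[of x] ne[of y] \<open>u \<noteq> v\<close> by (auto simp: f_def split: if_splits)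
      next
        case False
        then have eq: "h x ! d x = h y ! d y" using xy by (simp add: f_def)
        have A: "h x \<in> A" "h y \<in> A" using hA xy False by auto
        have "d x = d y" using Adj[OF A d_less[OF xy(1)] d_less[OF xy(2)]] eq irr by metis
        then have "h x = h y" using Inj[OF A d_less[OF xy(1)]] eq by simp
        then show ?thesis using h(2) xy False by (auto dest: inj_onD)
      qed
    qed
    have arc: "(f x, f y) \<in> parcs G" if "(x, y) \<in> parcs H" for x y
    proof -
      have V: "x \<in> pverts H" "y \<in> pverts H" using parcs_in_pverts[OF H that] by auto
      show ?thesis
      proof (cases "{x, y} = {a, b}")
        case True
        then show ?thesis using uv parcs_sym[OF G uv] abV by (auto simp: f_def doubleton_eq_iff)
      next
        case False
        then have "c x \<noteq> c y" using c(3) that by auto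
        then have dxy: "d x \<noteq> d y" by (simp add: d_eq)
        consider "x \<in> {a, b}" | "x \<notin> {a, b}" "y \<in> {a, b}" | "x \<notin> {a, b}" "y \<notin> {a, b}" by blast
        then show ?thesis
        proof cases
          case 1
          then have "d x = 0" using d0 c(2) by auto
          then have "d y \<noteq> 0" using dxy by simp
          then have "y \<notin> {a, b}" using d0 c(2) by auto
          then show ?thesis using nbr[of y] V 1 \<open>d y \<noteq> 0\<close> abV by (auto simp: f_def)
        next
          case 2
          then have "d y = 0" using d0 c(2) by auto
          then have "d x \<noteq> 0" using dxy by simp
          then have "(u, f x) \<in> parcs G" "(v, f x) \<in> parcs G" using nbr[of x] V 2 by (auto simp: f_def)
          moreover have "f y = u \<or> f y = v" using 2 by (auto simp: f_def)
          ultimately show ?thesis using parcs_sym[OF G] by blast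
        next
          case 3
          then show ?thesis
            using Adj[OF hA(1) hA(1) d_less[OF V(1)] d_less[OF V(2)] dxy] V by (auto simp: f_def)
        qed
      qed
    qed
    then show "\<forall>(x, y)\<in>parcs H. (f x, f y) \<in> parcs G" by blast
    show "f ` pverts H \<subseteq> pverts G"
    proof
      fix w assume "w \<in> f ` pverts H"
      then obtain x where x: "x \<in> pverts H" "w = f x" by blast
      show "w \<in> pverts G"
      proof (cases "x \<in> {a, b}")
        case True
        then show ?thesis using x parcs_in_pverts[OF G uv] by (auto simp: f_def)
      next
        case False
        have "h x \<in> A" using hA x False by simp
        obtain i where i: "i < r" "i \<noteq> d x"
          using \<open>r \<ge> 2\<close> that[of 0] that[of 1] by (cases "d x = 0") auto
        then have "(h x ! d x, h x ! i) \<in> parcs G"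
          using Adj[OF \<open>h x \<in> A\<close> \<open>h x \<in> A\<close> d_less[OF x(1)] i(1)] by simp
        then show ?thesis using parcs_in_pverts[OF G] x False by (auto simp: f_def)
      qed
    qed
  qed
  then show ?thesis using contains_copy_iff[OF H G] by blast
qed


section \<open>Colouring graphs with sparse complement\<close>

text \<open>Greedy choice of one vertex in each part: every earlier choice rules out at most
  \<open>d\<close> candidates, and the candidates joined to all of \<open>B\<close> outnumber what
  all choices together can rule out.\<close>

lemma clique_transversal_exists:
  assumes E: "sym E" "irrefl E" and "finite I" "is_clique E B" "finite B"
    and indep: "\<And>q q'. q \<in> I \<Longrightarrow> q' \<in> I \<Longrightarrow> q \<noteq> q' \<Longrightarrow> \<forall>x\<in>P q'. card (non_nbrs E (P q) x) \<le> d"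
    and fin: "\<And>q. q \<in> I \<Longrightarrow> finite (P q)"
    and large: "\<And>q. q \<in> I \<Longrightarrow> card I * d < card {x \<in> P q. \<forall>b\<in>B. (b, x) \<in> E}"
  shows "\<exists>C. C \<subseteq> (\<Union>q\<in>I. P q) \<and> card C = card I \<and> finite C \<and> C \<inter> B = {} \<and> is_clique E (B \<union> C)"
proof -
  have irr: "(x, x) \<notin> E" for x using E(2) by (auto simp: irrefl_def)
  have tr: "J \<subseteq> I \<Longrightarrow> \<exists>h. (\<forall>q\<in>J. h q \<in> P q \<and> (\<forall>b\<in>B. (b, h q) \<in> E)) \<and>
      (\<forall>q\<in>J. \<forall>q'\<in>J. q \<noteq> q' \<longrightarrow> (h q, h q') \<in> E)" if "finite J" for J
    using that
  proof (induction J)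
    case empty
    show ?case by simp
  next
    case (insert q J)
    then obtain h where h: "\<forall>q\<in>J. h q \<in> P q \<and> (\<forall>b\<in>B. (b, h q) \<in> E)"
      "\<forall>q\<in>J. \<forall>q'\<in>J. q \<noteq> q' \<longrightarrow> (h q, h q') \<in> E" by auto
    let ?X = "{x \<in> P q. \<forall>b\<in>B. (b, x) \<in> E}"
    have "card (\<Union>q'\<in>J. non_nbrs E (P q) (h q')) \<le> (\<Sum>q'\<in>J. card (non_nbrs E (P q) (h q')))"
      using insert.hyps(1) by (rule card_UN_le)
    also have "\<dots> \<le> (\<Sum>q'\<in>J. d)"
    proof (rule sum_mono)
      fix q' assume "q' \<in> J"
      moreover from this have "q \<noteq> q'" "q' \<in> I" "q \<in> I" "h q' \<in> P q'" using insert h(1) by auto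
      ultimately show "card (non_nbrs E (P q) (h q')) \<le> d" using indep by blast
    qed
    also have "\<dots> = card J * d" by simp
    also have "\<dots> \<le> card I * d" using insert.prems card_mono[OF \<open>finite I\<close>, of J] by simp
    also have "\<dots> < card ?X" using large insert.prems by simp
    finally have lt: "card (\<Union>q'\<in>J. non_nbrs E (P q) (h q')) < card ?X" .
    have "\<not> ?X \<subseteq> (\<Union>q'\<in>J. non_nbrs E (P q) (h q'))"
    proof
      assume sub: "?X \<subseteq> (\<Union>q'\<in>J. non_nbrs E (P q) (h q'))"
      have "finite (\<Union>q'\<in>J. non_nbrs E (P q) (h q'))" using fin insert by simp
      then have "card ?X \<le> card (\<Union>q'\<in>J. non_nbrs E (P q) (h q'))" using sub by (rule card_mono)
      then show False using lt by simp
    qed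
    then obtain x where x: "x \<in> P q" "\<forall>b\<in>B. (b, x) \<in> E" "\<forall>q'\<in>J. (h q', x) \<in> E" by blast
    then have "\<forall>q'\<in>J. (x, h q') \<in> E" using E(1) by (blast dest: symD)
    then show ?case using x h insert.hyps(2) by (intro exI[of _ "h(q := x)"]) auto
  qed
  then obtain h where h: "\<forall>q\<in>I. h q \<in> P q \<and> (\<forall>b\<in>B. (b, h q) \<in> E)"
      "\<forall>q\<in>I. \<forall>q'\<in>I. q \<noteq> q' \<longrightarrow> (h q, h q') \<in> E" 
    using tr[OF \<open>finite I\<close> subset_refl] by (elim exE conjE) (rule that)
  have inj: "inj_on h I"
  proof (rule inj_onI, rule ccontr)
    fix q q' assume "q \<in> I" "q' \<in> I" "h q = h q'" "q \<noteq> q'"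
    then have "(h q, h q) \<in> E" using h(2) by metis
    then show False using irr by simp
  qed
  have "is_clique E (B \<union> h ` I)"
    unfolding is_clique_def
  proof (intro ballI impI)
    fix a b assume ab: "a \<in> B \<union> h ` I" "b \<in> B \<union> h ` I" "a \<noteq> b"
    then consider "a \<in> B" "b \<in> B" | q where "a \<in> B" "q \<in> I" "b = h q" | q where "b \<in> B" "q \<in> I" "a = h q"
      | q q' where "q \<in> I" "q' \<in> I" "a = h q" "b = h q'" by blast
    then show "(a, b) \<in> E"
    proof cases
      case 1
      then show ?thesis using assms(4) ab(3) by (simp add: is_clique_def)
    next
      case 2
      then show ?thesis using h(1) by simp
    next
      case 3
      then have "(b, a) \<in> E" using h(1) by simp
      then show ?thesis by (rule symD[OF E(1)])
    next
      case 4
      moreover from this have "q \<noteq> q'" using ab(3) by auto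
      ultimately show ?thesis using h(2) by simp
    qed
  qed
  moreover have "h ` I \<inter> B = {}" using h(1) irr by fastforce
  moreover have "h ` I \<subseteq> (\<Union>q\<in>I. P q)" using h(1) by blast
  ultimately show ?thesis
    using inj \<open>finite I\<close> by (intro exI[of _ "h ` I"]) (simp add: card_image)
qed

text \<open>Greedy extension: fewer than \<open>r\<close> vertices together miss at most ((r - 1) n
  + r d) / r vertices, which is less than n because r d < n.\<close>

lemma clique_exists_of_sparse_complement:
  fixes r :: nat
  assumes V: "finite V" and E: "sym E" "irrefl E"
    and sparse: "\<And>v. v \<in> V \<Longrightarrow> r * card (non_nbrs E V v) \<le> card V + d"
    and large: "r * d < card V"
  shows "j \<le> r \<Longrightarrow> \<exists>Q\<subseteq>V. card Q = j \<and> is_clique E Q"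
proof (induction j)
  case 0
  show ?case by (intro exI[of _ "{}"]) (simp add: is_clique_def)
next
  case (Suc j)
  then obtain Q where Q: "Q \<subseteq> V" "card Q = j" "is_clique E Q" by auto
  have finQ: "finite Q" using Q(1) V finite_subset by blast
  have "r * card (\<Union>q\<in>Q. non_nbrs E V q) \<le> r * (\<Sum>q\<in>Q. card (non_nbrs E V q))"
    using finQ by (intro mult_le_mono2 card_UN_le)
  also have "\<dots> = (\<Sum>q\<in>Q. r * card (non_nbrs E V q))" by (rule sum_distrib_left)
  also have "\<dots> \<le> (\<Sum>q\<in>Q. card V + d)" using sparse Q(1) by (intro sum_mono) blast
  also have "\<dots> = j * card V + j * d" using Q(2) by (simp add: algebra_simps)
  also have "\<dots> \<le> (r - 1) * card V + r * d" using Suc.prems by (intro add_mono mult_le_mono1) auto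
  also have "\<dots> < (r - 1) * card V + card V" using large by simp
  also have "\<dots> = r * card V" using Suc.prems by (cases r) auto
  finally have "card (\<Union>q\<in>Q. non_nbrs E V q) < card V" by simp
  moreover have "finite (\<Union>q\<in>Q. non_nbrs E V q)" using V finQ by simp
  ultimately have "\<not> V \<subseteq> (\<Union>q\<in>Q. non_nbrs E V q)"
    using card_mono[of "\<Union>q\<in>Q. non_nbrs E V q" V] by linarith
  then obtain z where z: "z \<in> V" "\<forall>q\<in>Q. (q, z) \<in> E" by blast
  have "(z, q) \<in> E" if "q \<in> Q" for q using z(2) symD[OF E(1)] that by blast
  then have "is_clique E (insert z Q)" using Q(3) z(2) unfolding is_clique_def by auto
  moreover have "z \<notin> Q" using z(2) E(2) by (auto simp: irrefl_def)
  ultimately show ?case using Q finQ z(1) by (intro exI[of _ "insert z Q"]) simp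
qed

text \<open>Every vertex of \<open>V\<close> misses all of some part \<open>P q\<close>, where \<open>P q\<close> is the set of vertices whose
  only non-neighbour in a fixed \<open>r\<close>-clique \<open>Q\<close> is \<open>q\<close>; otherwise one finds an \<open>(r + 1)\<close>-clique.
  Colouring each vertex by such a \<open>q\<close> is proper for the same reason.\<close>

lemma colouring_of_sparse_complement:
  fixes r d :: nat
  assumes G: "pair_graph G" and "r \<ge> 2"
    and sparse: "\<And>v. v \<in> pverts G \<Longrightarrow> r * card (non_nbrs (parcs G) (pverts G) v) \<le> card (pverts G) + d"
    and large: "10 * r * r * d + 8 * r < card (pverts G)"
    and no_clique: "\<And>K. K \<subseteq> pverts G \<Longrightarrow> is_clique (parcs G) K \<Longrightarrow> card K \<noteq> r + 1"
  shows "\<exists>c. proper_colouring G r c"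
proof -
  let ?V = "pverts G" and ?E = "parcs G"
  let ?n = "card ?V"
  have V: "finite ?V" and E: "sym ?E" "irrefl ?E" using G by (auto simp: pair_graph_iff)
  have irr: "(x, x) \<notin> ?E" for x by (rule parcs_irrefl[OF G])
  have sy: "(y, x) \<in> ?E" if "(x, y) \<in> ?E" for x y using parcs_sym[OF G that] .
  have rd: "r * d \<le> 10 * r * r * d"
  proof -
    have "1 * (r * d) \<le> (10 * r) * (r * d)" using \<open>r \<ge> 2\<close> by (intro mult_le_mono1) simp
    then show ?thesis by (simp only: mult.assoc mult_1)
  qed
  then have "r * d < ?n" using large by linarith
  then obtain Q where Q: "Q \<subseteq> ?V" "card Q = r" "is_clique ?E Q"
    using clique_exists_of_sparse_complement[OF V E sparse] by blast
  have finQ: "finite Q" using Q(1) V finite_subset by blast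
  define miss where "miss z = {q \<in> Q. (z, q) \<notin> ?E}" for z
  define P where "P q = {z \<in> ?V. miss z = {q}}" for q
  have fin: "finite (P q)" for q using V by (simp add: P_def)
  have miss_ne: "miss z \<noteq> {}" if "z \<in> ?V" for z
  proof
    assume "miss z = {}"
    then have *: "(z, q) \<in> ?E" if "q \<in> Q" for q using that by (auto simp: miss_def)
    then have "z \<notin> Q" using irr by blast
    moreover have "is_clique ?E (insert z Q)" using * sy Q(3) unfolding is_clique_def by auto
    ultimately show False using no_clique[of "insert z Q"] Q finQ \<open>z \<in> ?V\<close> by simp
  qed
  have fin_miss: "finite (miss z)" for z using finQ by (simp add: miss_def)
  define nn where "nn v = real (card (non_nbrs ?E ?V v))" for v
  have nn: "real r * nn v \<le> real ?n + real d" if "v \<in> ?V" for v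
    using of_nat_mono[OF sparse[OF that], where 'a = real] by (simp add: nn_def)
  define J where "J = {z \<in> ?V. card (miss z) \<ge> 2}"
  have VJ: "?V = J \<union> (\<Union>q\<in>Q. P q)"
  proof (intro equalityI subsetI)
    fix z assume z: "z \<in> ?V"
    show "z \<in> J \<union> (\<Union>q\<in>Q. P q)"
    proof (cases "card (miss z) \<ge> 2")
      case False
      moreover have "card (miss z) > 0" using miss_ne[OF z] fin_miss by (simp add: card_gt_0_iff)
      ultimately have "card (miss z) = 1" by linarith
      then obtain q where q: "miss z = {q}" by (rule card_1_singletonE)
      then have "q \<in> Q" by (auto simp: miss_def)
      then show ?thesis using z q by (auto simp: P_def)
    qed (use z in \<open>simp add: J_def\<close>)
  qed (auto simp: J_def P_def)
  \<comment> \<open>Count the non-adjacent pairs between all vertices and \<open>Q\<close>. There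
    are at least n + \<open>card J\<close>, as every vertex misses some member of \<open>Q\<close>
    and those in \<open>J\<close> miss two, and at most n + d. Hence \<open>card J\<close> is at
    most \<open>d\<close>.\<close>
  have "card J + ?n = (\<Sum>z\<in>?V. (if z \<in> J then 1 else 0) + 1)"
  proof -
    have "?V \<inter> J = J" by (auto simp: J_def)
    then have "(\<Sum>z\<in>?V. if z \<in> J then 1 else 0) = card J" using V by (simp add: sum.If_cases)
    then show ?thesis unfolding sum.distrib by simp
  qed
  also have "\<dots> \<le> (\<Sum>z\<in>?V. card (miss z))"
  proof (rule sum_mono)
    fix z assume "z \<in> ?V"
    then have "card (miss z) \<ge> 1" using miss_ne fin_miss by (simp add: Suc_le_eq card_gt_0_iff)
    then show "(if z \<in> J then 1 else 0) + 1 \<le> card (miss z)" by (auto simp: J_def)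
  qed
  also have "\<dots> = (\<Sum>q\<in>Q. card {z \<in> ?V. (z, q) \<notin> ?E})"
    unfolding miss_def by (rule sum_card_swap[OF V finQ])
  also have "\<dots> = (\<Sum>q\<in>Q. card (non_nbrs ?E ?V q))"
  proof -
    have "{z \<in> ?V. (z, q) \<notin> ?E} = non_nbrs ?E ?V q" for q using sy by blast
    then show ?thesis by simp
  qed
  finally have "real (card J + ?n) \<le> (\<Sum>q\<in>Q. nn q)" unfolding nn_def by (simp flip: of_nat_sum)
  then have "real r * (real (card J) + real ?n) \<le> real r * (\<Sum>q\<in>Q. nn q)" by (intro mult_left_mono) auto
  also have "\<dots> = (\<Sum>q\<in>Q. real r * nn q)" by (rule sum_distrib_left)
  also have "\<dots> \<le> (\<Sum>q\<in>Q. real ?n + real d)" using nn Q(1) by (intro sum_mono) blast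
  also have "\<dots> = real r * (real ?n + real d)" using Q(2) by simp
  finally have J: "real (card J) \<le> real d" using \<open>r \<ge> 2\<close> by simp
  have P_le: "real r * real (card (P q)) \<le> real ?n + real d" if "q \<in> Q" for q
  proof -
    have "P q \<subseteq> non_nbrs ?E ?V q" using sy by (auto simp: P_def miss_def)
    then have "real (card (P q)) \<le> nn q" unfolding nn_def using V by (simp add: card_mono)
    then have "real r * real (card (P q)) \<le> real r * nn q" by (intro mult_left_mono) auto
    then show ?thesis using nn[of q] that Q(1) by auto
  qed
  have P_ge: "real ?n \<le> real r * real (card (P q)) + 2 * real r * real d" if q: "q \<in> Q" for q
  proof -
    have "?n \<le> card J + (\<Sum>q\<in>Q. card (P q))"
      using card_Un_le[of J "\<Union>q\<in>Q. P q"] card_UN_le[OF finQ, of P] VJ by simp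
    also have "(\<Sum>q\<in>Q. card (P q)) = card (P q) + (\<Sum>q'\<in>Q - {q}. card (P q'))"
      using finQ q by (rule sum.remove)
    finally have "real ?n \<le> real (card J) + (real (card (P q)) + (\<Sum>q'\<in>Q - {q}. real (card (P q'))))"
      by (simp flip: of_nat_sum of_nat_add)
    then have "real r * real ?n \<le> real r * (real (card J) + (real (card (P q)) + (\<Sum>q'\<in>Q - {q}. real (card (P q')))))"
      by (rule mult_left_mono) simp
    also have "\<dots> = real r * real (card J) + real r * real (card (P q)) + (\<Sum>q'\<in>Q - {q}. real r * real (card (P q')))"
      by (simp add: algebra_simps sum_distrib_left)
    also have "\<dots> \<le> real r * real d + real r * real (card (P q)) + (\<Sum>q'\<in>Q - {q}. real ?n + real d)"
      using J P_le by (intro add_mono mult_left_mono sum_mono) auto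
    also have "(\<Sum>q'\<in>Q - {q}. real ?n + real d) = (real r - 1) * (real ?n + real d)"
      using Q(2) q finQ \<open>r \<ge> 2\<close> by (simp add: card_Diff_singleton of_nat_diff)
    finally have "real ?n \<le> real r * real (card (P q)) + 2 * real r * real d - real d"
      by (simp add: algebra_simps)
    then show ?thesis by simp
  qed
  have P_indep: "(x, y) \<notin> ?E" if xP: "x \<in> P q" and yP: "y \<in> P q" and q: "q \<in> Q" for x y q
  proof
    assume xy: "(x, y) \<in> ?E"
    have adj: "(x, w) \<in> ?E" "(y, w) \<in> ?E" if "w \<in> Q - {q}" for w
      using that xP yP by (auto simp: P_def miss_def)
    then have "x \<notin> Q - {q}" "y \<notin> Q - {q}" using irr adj(1)[of x] adj(2)[of y] by auto
    moreover have "x \<noteq> y" using xy irr by blast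
    moreover have "is_clique ?E ({x, y} \<union> (Q - {q}))"
      using adj sy xy Q(3) unfolding is_clique_def by auto
    moreover have "{x, y} \<union> (Q - {q}) \<subseteq> ?V" using xP yP Q(1) by (auto simp: P_def)
    ultimately show False
      using no_clique[of "{x, y} \<union> (Q - {q})"] Q(2) finQ q \<open>r \<ge> 2\<close> by (simp add: card_Diff_singleton)
  qed
  have split: "real (card (P q)) + real (card (non_nbrs ?E (P q') v)) \<le> nn v"
    if "q \<noteq> q'" "\<forall>y\<in>P q. (v, y) \<notin> ?E" for q q' v
  proof -
    have disj: "P q \<inter> non_nbrs ?E (P q') v = {}" using that(1) by (auto simp: P_def)
    have "P q \<union> non_nbrs ?E (P q') v \<subseteq> non_nbrs ?E ?V v" using that(2) by (auto simp: P_def)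
    then have "card (P q \<union> non_nbrs ?E (P q') v) \<le> card (non_nbrs ?E ?V v)" using V by (intro card_mono) auto
    then have "card (P q) + card (non_nbrs ?E (P q') v) \<le> card (non_nbrs ?E ?V v)"
      using disj fin by (simp add: card_Un_disjoint)
    then show ?thesis unfolding nn_def by (simp flip: of_nat_add)
  qed
  \<comment> \<open>A part has at least n / r - 2 d vertices, so missing all of it uses up nearly
    the whole allowance of (n + d) / r and leaves at most 3 d non-neighbours in another
    part.\<close>
  have few: "card (non_nbrs ?E (P q') v) \<le> 3 * d"
    if "q \<in> Q" "q \<noteq> q'" "v \<in> ?V" "\<forall>y\<in>P q. (v, y) \<notin> ?E" for q q' v
  proof -
    have "real r * (real (card (P q)) + real (card (non_nbrs ?E (P q') v))) \<le> real ?n + real d"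
      using mult_left_mono[OF split[OF that(2,4)], of "real r"] nn[OF that(3)] by simp
    then have "real r * real (card (non_nbrs ?E (P q') v)) \<le> 2 * real r * real d + real d"
      using P_ge[OF that(1)] by (simp add: algebra_simps)
    also have "\<dots> \<le> real r * (3 * real d)"
      using mult_right_mono[of 1 "real r" "real d"] \<open>r \<ge> 2\<close> by (simp add: mult.commute)
    finally have "real (card (non_nbrs ?E (P q') v)) \<le> 3 * real d" using \<open>r \<ge> 2\<close> by simp
    then show ?thesis by linarith
  qed
  have sparse_parts: "\<forall>x\<in>P q'. card (non_nbrs ?E (P q) x) \<le> 3 * d" if "q \<in> Q" "q' \<in> Q" "q \<noteq> q'" for q q'
  proof
    fix x assume x: "x \<in> P q'"
    then show "card (non_nbrs ?E (P q) x) \<le> 3 * d"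
      using few[of q' q x] P_indep[OF x _ that(2)] that by (auto simp: P_def)
  qed
  \<comment> \<open>\<open>x\<close>, \<open>y\<close> and one vertex from each of the other r - 1
    parts would form a clique of size r + 1.\<close>
  have no_pair: False
    if q0: "q0 \<in> Q" and xy: "(x, y) \<in> ?E" "x \<in> ?V" "y \<in> ?V"
      and lg: "\<And>q. q \<in> Q - {q0} \<Longrightarrow> (r - 1) * (3 * d) < card {z \<in> P q. \<forall>b\<in>{x, y}. (b, z) \<in> ?E}" for q0 x y
  proof -
    have "x \<noteq> y" using xy irr by blast
    have cl: "is_clique ?E {x, y}" using xy sy by (auto simp: is_clique_def)
    have cQ: "card (Q - {q0}) = r - 1" using Q(2) finQ q0 by (simp add: card_Diff_singleton)
    have "\<exists>C. C \<subseteq> (\<Union>q\<in>Q - {q0}. P q) \<and> card C = card (Q - {q0}) \<and> finite C \<and> C \<inter> {x, y} = {} \<and>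
        is_clique ?E ({x, y} \<union> C)"
      using sparse_parts fin lg finQ unfolding cQ[symmetric]
      by (intro clique_transversal_exists[OF E _ cl, where d = "3 * d"]) auto
    then obtain C where C: "C \<subseteq> (\<Union>q\<in>Q - {q0}. P q)" "card C = r - 1" "finite C" "C \<inter> {x, y} = {}"
      "is_clique ?E ({x, y} \<union> C)" unfolding cQ by blast
    have "card ({x, y} \<union> C) = 2 + (r - 1)"
      using C(2-4) \<open>x \<noteq> y\<close> by (subst card_Un_disjoint) auto
    moreover have "{x, y} \<union> C \<subseteq> ?V" using C(1) xy by (auto simp: P_def)
    ultimately show False using no_clique[of "{x, y} \<union> C"] C(5) \<open>r \<ge> 2\<close> by simp
  qed
  have common: "card (P q) \<le> card {z \<in> P q. \<forall>b\<in>{x, y}. (b, z) \<in> ?E}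
      + card (non_nbrs ?E (P q) x) + card (non_nbrs ?E (P q) y)" for q x y
  proof -
    have "P q = {z \<in> P q. \<forall>b\<in>{x, y}. (b, z) \<in> ?E} \<union> non_nbrs ?E (P q) x \<union> non_nbrs ?E (P q) y" by auto
    then have "card (P q) = card ({z \<in> P q. \<forall>b\<in>{x, y}. (b, z) \<in> ?E} \<union> non_nbrs ?E (P q) x \<union> non_nbrs ?E (P q) y)"
      by (rule arg_cong)
    also have "\<dots> \<le> card ({z \<in> P q. \<forall>b\<in>{x, y}. (b, z) \<in> ?E} \<union> non_nbrs ?E (P q) x) + card (non_nbrs ?E (P q) y)"
      by (rule card_Un_le)
    finally have "card (P q) \<le> card ({z \<in> P q. \<forall>b\<in>{x, y}. (b, z) \<in> ?E} \<union> non_nbrs ?E (P q) x) + card (non_nbrs ?E (P q) y)" .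
    then show ?thesis
      using card_Un_le[of "{z \<in> P q. \<forall>b\<in>{x, y}. (b, z) \<in> ?E}" "non_nbrs ?E (P q) x"] by linarith
  qed
  have "real (10 * r * r * d + 8 * r) < real ?n" using large by (simp only: of_nat_less_iff)
  then have nlarge: "10 * (real r * (real r * real d)) + 8 * real r < real ?n" by (simp add: mult.assoc)
  have rrd: "2 * (real r * real d) \<le> real r * (real r * real d)" "2 * real d \<le> real r * real d"
    using \<open>r \<ge> 2\<close> by (auto intro!: mult_right_mono)
  have "\<exists>q\<in>Q. \<forall>y\<in>P q. (z, y) \<notin> ?E" if z: "z \<in> ?V" for z
  proof (rule ccontr)
    assume "\<not> ?thesis"
    then have ex: "\<exists>y\<in>P q. (z, y) \<in> ?E" if "q \<in> Q" for q using that by blast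
    define a where "a q = card {y \<in> P q. (z, y) \<in> ?E}" for q
    have "Q \<noteq> {}" using Q(2) \<open>r \<ge> 2\<close> by auto
    \<comment> \<open>Choose the part in which \<open>z\<close> has the fewest neighbours. The
      non-neighbours of \<open>z\<close> in this part and in another one together number at most (n
      + d) / r, so \<open>z\<close> has at least roughly n / (2 r) neighbours in every other part,
      enough for the transversal.\<close>
    then obtain q0 where q0: "q0 \<in> Q" "\<And>q. q \<in> Q \<Longrightarrow> a q0 \<le> a q"
      using ex_min_if_finite[of "a ` Q"] finQ by (metis (no_types, lifting) arg_min_if_finite(1) arg_min_least)
    obtain y where y: "y \<in> P q0" "(z, y) \<in> ?E" using ex q0(1) by blast
    have ac: "a q + card (non_nbrs ?E (P q) z) = card (P q)" for q
    proof -
      have "P q = {y \<in> P q. (z, y) \<in> ?E} \<union> non_nbrs ?E (P q) z" by auto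
      then show ?thesis unfolding a_def using fin
        by (metis (no_types, lifting) card_Un_disjoint finite_Un disjoint_iff mem_Collect_eq)
    qed
    show False
    proof (rule no_pair[OF q0(1) y(2) z])
      show "y \<in> ?V" using y by (simp add: P_def)
      fix q assume q: "q \<in> Q - {q0}"
      have "q \<noteq> q0" "q \<in> Q" using q by auto
      have "non_nbrs ?E (P q) z \<union> non_nbrs ?E (P q0) z \<subseteq> non_nbrs ?E ?V z" by (auto simp: P_def)
      then have "card (non_nbrs ?E (P q) z \<union> non_nbrs ?E (P q0) z) \<le> card (non_nbrs ?E ?V z)"
        using V by (intro card_mono) auto
      moreover have "non_nbrs ?E (P q) z \<inter> non_nbrs ?E (P q0) z = {}" using \<open>q \<noteq> q0\<close> by (auto simp: P_def)
      ultimately have "card (non_nbrs ?E (P q) z) + card (non_nbrs ?E (P q0) z) \<le> card (non_nbrs ?E ?V z)"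
        using fin by (simp add: card_Un_disjoint)
      then have s1: "real (card (non_nbrs ?E (P q) z)) + real (card (non_nbrs ?E (P q0) z)) \<le> nn z"
        unfolding nn_def by (simp flip: of_nat_add)
      define A where "A = real (card {w \<in> P q. \<forall>b\<in>{z, y}. (b, w) \<in> ?E})"
      have "card (non_nbrs ?E (P q) y) \<le> 3 * d" using sparse_parts[of q q0] q q0(1) y(1) by auto
      then have s2: "real (a q) \<le> A + 3 * real d"
        using common[of q z y] ac[of q] unfolding A_def by linarith
      have s3: "real (card (P q)) + real (card (P q0)) \<le> 2 * real (a q) + nn z"
        using s1 ac[of q] ac[of q0] q0(2)[OF \<open>q \<in> Q\<close>] by linarith
      have "real r * (real (card (P q)) + real (card (P q0))) \<le> real r * (2 * (A + 3 * real d) + nn z)"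
        using s2 s3 by (intro mult_left_mono) auto
      then have "real r * real (card (P q)) + real r * real (card (P q0))
          \<le> 2 * (real r * A) + 6 * (real r * real d) + (real ?n + real d)"
        using nn[OF z] by (simp add: algebra_simps)
      then have s4: "real ?n \<le> 2 * (real r * A) + 10 * (real r * real d) + real d"
        using P_ge[OF \<open>q \<in> Q\<close>] P_ge[OF q0(1)] by linarith
      have "6 * (real r * (real r * real d)) < 2 * (real r * A) + 6 * (real r * real d)"
        using s4 nlarge rrd by linarith
      then have "real r * (3 * (real r * real d)) < real r * (A + 3 * real d)" by (simp add: algebra_simps)
      then have "3 * (real r * real d) < A + 3 * real d" using \<open>r \<ge> 2\<close> by (simp add: mult_less_cancel_left_pos)
      moreover have "real ((r - 1) * (3 * d)) = 3 * (real r * real d) - 3 * real d"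
        using \<open>r \<ge> 2\<close> by (simp add: of_nat_diff algebra_simps)
      ultimately have "real ((r - 1) * (3 * d)) < A" by linarith
      then show "(r - 1) * (3 * d) < card {w \<in> P q. \<forall>b\<in>{z, y}. (b, w) \<in> ?E}"
        unfolding A_def by (simp only: of_nat_less_iff)
    qed
  qed
  then have "\<forall>z\<in>?V. \<exists>q\<in>Q. \<forall>y\<in>P q. (z, y) \<notin> ?E" by blast
  then obtain c where c: "\<forall>z\<in>?V. c z \<in> Q \<and> (\<forall>y\<in>P (c z). (z, y) \<notin> ?E)" by metis
  have proper: "c x \<noteq> c y" if xy: "(x, y) \<in> ?E" for x y
  proof
    assume eq: "c x = c y"
    have V2: "x \<in> ?V" "y \<in> ?V" using parcs_in_pverts[OF G xy] by auto
    have cx: "c x \<in> Q" using c V2 by blast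
    show False
    proof (rule no_pair[OF cx xy V2])
      fix q assume q: "q \<in> Q - {c x}"
      then have "c x \<noteq> q" by auto
      then have "card (non_nbrs ?E (P q) x) \<le> 3 * d" "card (non_nbrs ?E (P q) y) \<le> 3 * d"
        using few[OF cx _ V2(1)] few[OF cx _ V2(2)] c V2 eq by auto
      then have "card (P q) \<le> card {z \<in> P q. \<forall>b\<in>{x, y}. (b, z) \<in> ?E} + 6 * d" using common[of q x y] by linarith
      then have "real (card (P q)) \<le> real (card {z \<in> P q. \<forall>b\<in>{x, y}. (b, z) \<in> ?E}) + 6 * real d" by linarith
      then have "real r * real (card (P q)) \<le> real r * (real (card {z \<in> P q. \<forall>b\<in>{x, y}. (b, z) \<in> ?E}) + 6 * real d)"
        by (rule mult_left_mono) simp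
      then have s: "real ?n \<le> real r * real (card {z \<in> P q. \<forall>b\<in>{x, y}. (b, z) \<in> ?E}) + 8 * (real r * real d)"
        using P_ge[of q] q by (simp add: algebra_simps)
      have "3 * (real r * (real r * real d)) < real r * real (card {z \<in> P q. \<forall>b\<in>{x, y}. (b, z) \<in> ?E})"
        using s nlarge rrd by linarith
      then have "real r * (3 * (real r * real d)) < real r * real (card {z \<in> P q. \<forall>b\<in>{x, y}. (b, z) \<in> ?E})"
        by (simp add: mult_ac)
      then have "3 * (real r * real d) < real (card {z \<in> P q. \<forall>b\<in>{x, y}. (b, z) \<in> ?E})"
        using \<open>r \<ge> 2\<close> by (simp add: mult_less_cancel_left_pos)
      moreover have "real ((r - 1) * (3 * d)) = 3 * (real r * real d) - 3 * real d"
        using \<open>r \<ge> 2\<close> by (simp add: of_nat_diff algebra_simps)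
      ultimately have "real ((r - 1) * (3 * d)) < real (card {z \<in> P q. \<forall>b\<in>{x, y}. (b, z) \<in> ?E})" by linarith
      then show "(r - 1) * (3 * d) < card {z \<in> P q. \<forall>b\<in>{x, y}. (b, z) \<in> ?E}"
        by (simp only: of_nat_less_iff)
    qed
  qed
  obtain \<iota> where \<iota>: "bij_betw \<iota> Q {0..<r}" using ex_bij_betw_finite_nat[OF finQ] Q(2) by auto
  have "proper_colouring G r (\<iota> \<circ> c)"
    unfolding proper_colouring_def
  proof (intro conjI)
    show "(\<iota> \<circ> c) ` ?V \<subseteq> {..<r}" using c bij_betwE[OF \<iota>] by auto
    have "\<iota> (c x) \<noteq> \<iota> (c y)" if "(x, y) \<in> ?E" for x y
      using proper[OF that] c parcs_in_pverts[OF G that] \<iota> by (metis bij_betw_def inj_onD)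
    then show "\<forall>(x, y)\<in>?E. (\<iota> \<circ> c) x \<noteq> (\<iota> \<circ> c) y" by auto
  qed
  then show ?thesis by blast
qed

section \<open>Spectral radii of free graphs\<close>

lemma induced_form:
  assumes G: "pair_graph G" and S: "S \<subseteq> pverts G"
  shows "graph_form (induced G S) x = graph_form G (\<lambda>v. if v \<in> S then x v else 0)"
    and "sq_norm S x = sq_norm (pverts G) (\<lambda>v. if v \<in> S then x v else 0)"
proof -
  have "graph_form (induced G S) x = (\<Sum>(u, v)\<in>parcs G \<inter> S \<times> S. x u * x v)"
    using graph_form_arcs[OF pair_graph_induced[OF G S]] by simp
  also have "\<dots> = (\<Sum>(u, v)\<in>parcs G. (if u \<in> S then x u else 0) * (if v \<in> S then x v else 0))"
    using finite_parcs[OF G] by (intro sum.mono_neutral_cong_left) (auto split: if_splits)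
  finally show "graph_form (induced G S) x = graph_form G (\<lambda>v. if v \<in> S then x v else 0)"
    by (simp add: graph_form_arcs[OF G])
  show "sq_norm S x = sq_norm (pverts G) (\<lambda>v. if v \<in> S then x v else 0)"
    unfolding inner_on_def using S finite_pverts[OF G] by (intro sum.mono_neutral_cong_left) auto
qed

lemma inner_on_indicator:
  assumes "finite V" "u \<in> V"
  shows "inner_on V (\<lambda>v. if v = u then 1 else 0) f = f u" "inner_on V f (\<lambda>v. if v = u then 1 else 0) = f u"
  using assms by (simp_all add: inner_on_def if_distrib[of "\<lambda>x. x * _"] if_distrib[of "\<lambda>x. _ * x"] cong: if_cong)

lemma graph_op_indicator:
  assumes "finite (pverts G)" "u \<in> pverts G"
  shows "graph_op G (\<lambda>v. if v = u then 1 else 0) w = adj G w u"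
  using assms by (simp add: kernel_op_def if_distrib[of "\<lambda>x. _ * x"] cong: if_cong)

text \<open>Motzkin and Straus: shifting weight between two non-adjacent vertices does not decrease the form
  in one of the two directions, until the support is a clique.\<close>

lemma motzkin_straus:
  assumes G: "pair_graph G" and "r \<ge> 1"
    and no_clique: "\<And>K. K \<subseteq> pverts G \<Longrightarrow> is_clique (parcs G) K \<Longrightarrow> card K \<le> r"
    and x: "\<And>v. x v \<ge> 0"
  shows "graph_form G x \<le> (1 - 1 / real r) * (\<Sum>v\<in>pverts G. x v)\<^sup>2"
  using x
proof (induction "card {v \<in> pverts G. x v \<noteq> 0}" arbitrary: x rule: less_induct)
  case less
  let ?V = "pverts G" and ?S = "{v \<in> pverts G. x v \<noteq> 0}"
  have V: "finite ?V" by (rule finite_pverts[OF G])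
  have x0: "x v \<ge> 0" for v by (rule less.prems)
  show ?case
  proof (cases "is_clique (parcs G) ?S")
    case True
    have card_le: "card ?S \<le> r" by (rule no_clique[OF _ True]) auto
    have sumS: "(\<Sum>v\<in>?V. f v) = (\<Sum>v\<in>?S. f v)" if "\<And>v. x v = 0 \<Longrightarrow> f v = 0" for f :: "_ \<Rightarrow> real"
      using V that by (intro sum.mono_neutral_right) auto
    have "graph_form G x = (\<Sum>v\<in>?V. x v * (\<Sum>w\<in>?V. adj G v w * x w))" by (simp add: inner_on_def kernel_op_def)
    also have "\<dots> = (\<Sum>v\<in>?S. x v * (\<Sum>w\<in>?S. adj G v w * x w))"
      by (subst sumS) (auto intro!: sum.cong arg_cong2[of _ _ _ _ "(*)"] sumS)
    also have "\<dots> = (\<Sum>v\<in>?S. x v * ((\<Sum>w\<in>?S. x w) - x v))"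
    proof (rule sum.cong[OF refl])
      fix v assume v: "v \<in> ?S"
      have "(\<Sum>w\<in>?S. adj G v w * x w) = (\<Sum>w\<in>?S - {v}. adj G v w * x w)"
        using V parcs_irrefl[OF G] by (intro sum.mono_neutral_right) (auto simp: adj_def)
      also have "\<dots> = (\<Sum>w\<in>?S - {v}. x w)"
        using True v by (intro sum.cong) (auto simp: adj_def is_clique_def)
      also have "\<dots> = (\<Sum>w\<in>?S. x w) - x v" using V v by (simp add: sum_diff1)
      finally show "x v * (\<Sum>w\<in>?S. adj G v w * x w) = x v * ((\<Sum>w\<in>?S. x w) - x v)" by simp
    qed
    also have "\<dots> = (\<Sum>w\<in>?S. x w)\<^sup>2 - (\<Sum>v\<in>?S. (x v)\<^sup>2)"
      by (simp add: right_diff_distrib sum_subtractf power2_eq_square flip: sum_distrib_right)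
    finally have form: "graph_form G x = (\<Sum>w\<in>?S. x w)\<^sup>2 - (\<Sum>v\<in>?S. (x v)\<^sup>2)" .
    have "(\<Sum>v\<in>?S. x v)\<^sup>2 \<le> (\<Sum>v\<in>?S. (x v)\<^sup>2) * real (card ?S)"
      by (rule sum_squared_le_sum_of_squares)
    also have "\<dots> \<le> (\<Sum>v\<in>?S. (x v)\<^sup>2) * real r"
      using card_le by (intro mult_left_mono sum_nonneg) auto
    finally have "(\<Sum>v\<in>?S. x v)\<^sup>2 / real r \<le> (\<Sum>v\<in>?S. (x v)\<^sup>2)"
      using \<open>r \<ge> 1\<close> by (simp add: divide_le_eq)
    moreover have "(\<Sum>v\<in>?V. x v) = (\<Sum>v\<in>?S. x v)" by (rule sumS) simp
    ultimately show ?thesis using form by (simp add: left_diff_distrib)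
  next
    case False
    then obtain u v where uv: "u \<in> ?S" "v \<in> ?S" "u \<noteq> v" "(u, v) \<notin> parcs G"
      and ge: "graph_op G x v \<le> graph_op G x u"
    proof -
      obtain a b where "a \<in> ?S" "b \<in> ?S" "a \<noteq> b" "(a, b) \<notin> parcs G"
        using False unfolding is_clique_def by blast
      moreover from this have "(b, a) \<notin> parcs G" using parcs_sym[OF G] by blast
      ultimately show thesis
        using that[of a b] that[of b a] by (cases "graph_op G x b \<le> graph_op G x a") auto
    qed
    have uvV: "u \<in> ?V" "v \<in> ?V" using uv by auto
    \<comment> \<open>Direction that moves weight from \<open>v\<close> to \<open>u\<close>. Its own
      form is 0 because the two vertices are not adjacent, so the form changes linearly, and moving
      all of \<open>x v\<close> removes \<open>v\<close> from the support.\<close>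
    define y where "y = (\<lambda>w. (if w = u then 1 else 0) - (if w = v then 1 else (0::real)))"
    define x' where "x' = (\<lambda>w. 1 * x w + x v * y w)"
    have y_in: "inner_on ?V y f = f u - f v" for f
      unfolding y_def by (simp add: inner_on_diff inner_on_indicator V uvV)
    have op_y: "graph_op G y w = adj G w u - adj G w v" for w
    proof -
      have "graph_op G y w = graph_op G (\<lambda>w. if w = u then 1 else 0) w - graph_op G (\<lambda>w. if w = v then 1 else 0) w"
        unfolding y_def kernel_op_def by (simp add: right_diff_distrib sum_subtractf)
      then show ?thesis by (simp add: graph_op_indicator V uvV)
    qed
    have "graph_form G y = 0"
      using uv(4) adj_sym[OF G, of u v] parcs_irrefl[OF G] by (simp add: y_in op_y adj_def)
    moreover have "inner_on ?V x (graph_op G y) = graph_op G x u - graph_op G x v"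
      using kernel_op_symmetric[of ?V "adj G" x y] adj_sym[OF G] y_in[of "graph_op G x"]
      by (simp add: inner_on_commute[of _ y])
    ultimately have "graph_form G x' = graph_form G x + 2 * x v * (graph_op G x u - graph_op G x v)"
      unfolding x'_def using quad_form_add[of ?V "adj G" 1 x "x v" y] adj_sym[OF G] by simp
    then have "graph_form G x \<le> graph_form G x'" using ge x0[of v] by simp
    also have "graph_form G x' \<le> (1 - 1 / real r) * (\<Sum>w\<in>?V. x' w)\<^sup>2"
    proof (rule less.hyps)
      have x'v: "x' v = 0" using uv(3) by (simp add: x'_def y_def)
      have "{w \<in> ?V. x' w \<noteq> 0} \<subseteq> ?S - {v}"
      proof
        fix w assume w: "w \<in> {w \<in> ?V. x' w \<noteq> 0}"
        then have "w \<noteq> v" using x'v by auto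
        moreover have "w \<in> ?S" using w uv(1) by (cases "w = u") (auto simp: x'_def y_def split: if_splits)
        ultimately show "w \<in> ?S - {v}" by simp
      qed
      then have "card {w \<in> ?V. x' w \<noteq> 0} \<le> card (?S - {v})" using V by (intro card_mono) auto
      also have "\<dots> < card ?S" using V uv(2) by (intro card_Diff1_less) auto
      finally show "card {w \<in> ?V. x' w \<noteq> 0} < card ?S" .
      show "0 \<le> x' w" for w using x0[of w] x0[of v] by (auto simp: x'_def y_def)
    qed
    also have "(\<Sum>w\<in>?V. x' w) = (\<Sum>w\<in>?V. x w)"
    proof -
      have "(\<Sum>w\<in>?V. y w) = 0" unfolding y_def using V uvV by (simp add: sum_subtractf)
      then show ?thesis by (simp add: x'_def sum.distrib flip: sum_distrib_left)
    qed
    finally show ?thesis .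
  qed
qed

text \<open>Wilf's argument: the Motzkin-Straus bound for the Perron vector, whose squared sum is at
  most the number of vertices by Cauchy-Schwarz.\<close>

lemma spectral_radius_le_of_no_clique:
  assumes G: "pair_graph G" "pverts G \<noteq> {}" and "r \<ge> 1"
    and no_clique: "\<And>K. K \<subseteq> pverts G \<Longrightarrow> is_clique (parcs G) K \<Longrightarrow> card K \<le> r"
  shows "spectral_radius G \<le> (1 - 1 / real r) * real (card (pverts G))"
proof -
  let ?V = "pverts G"
  obtain x where x: "sq_norm ?V x = 1" "\<forall>v. x v \<ge> 0"
    "\<forall>v\<in>?V. graph_op G x v = spectral_radius G * x v"
    using spectral_radius_eigenvector[OF G] .
  have "spectral_radius G = inner_on ?V x (\<lambda>v. spectral_radius G * x v)"
    using x(1) by (simp add: inner_on_scale)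
  also have "\<dots> = graph_form G x" using x(3) by (intro inner_on_cong) auto
  also have "\<dots> \<le> (1 - 1 / real r) * (\<Sum>v\<in>?V. x v)\<^sup>2"
    using x(2) by (intro motzkin_straus[OF G(1) \<open>r \<ge> 1\<close> no_clique]) auto
  also have "\<dots> \<le> (1 - 1 / real r) * real (card ?V)"
  proof (intro mult_left_mono)
    have "(\<Sum>v\<in>?V. x v)\<^sup>2 \<le> (\<Sum>v\<in>?V. (x v)\<^sup>2) * real (card ?V)" by (rule sum_squared_le_sum_of_squares)
    then show "(\<Sum>v\<in>?V. x v)\<^sup>2 \<le> real (card ?V)" using x(1) by (simp add: inner_on_def power2_eq_square)
    show "0 \<le> 1 - 1 / real r" using \<open>r \<ge> 1\<close> by simp
  qed
  finally show ?thesis .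
qed

text \<open>The clique bound with the number of vertices in place of \<open>r\<close>, which every
  clique respects.\<close>

lemma spectral_radius_le_card:
  assumes G: "pair_graph G" "pverts G \<noteq> {}"
  shows "spectral_radius G \<le> real (card (pverts G)) - 1"
proof -
  have n: "card (pverts G) \<ge> 1" using G finite_pverts by (simp add: Suc_le_eq card_gt_0_iff)
  have "spectral_radius G \<le> (1 - 1 / real (card (pverts G))) * real (card (pverts G))"
    using n finite_pverts[OF G(1)] by (intro spectral_radius_le_of_no_clique[OF G]) (auto intro: card_mono)
  also have "\<dots> = real (card (pverts G)) - 1" using n by (simp add: left_diff_distrib)
  finally show ?thesis .
qed

text \<open>The smallest entry of the Perron vector bounds the loss of spectral radius when its vertex is
  deleted, and is itself bounded in terms of any degree.\<close>

lemma degree_bound_of_vertex_deletion: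
  assumes G: "pair_graph G" and n2: "card (pverts G) \<ge> 2" and pos: "spectral_radius G > 0" and "z > 0"
    and del: "\<And>u. u \<in> pverts G \<Longrightarrow>
      spectral_radius (induced G (pverts G - {u})) \<le> (1 - z) * spectral_radius G"
    and w: "w \<in> pverts G" and d: "d = real (card {v. (w, v) \<in> parcs G})"
  shows "(spectral_radius G)\<^sup>2 \<le> d * (d + 1 / z + 1 - real (card (pverts G)))"
proof -
  let ?V = "pverts G" and ?\<rho> = "spectral_radius G"
  let ?n = "real (card ?V)"
  have V: "finite ?V" by (rule finite_pverts[OF G])
  have ne: "?V \<noteq> {}" using w by auto
  obtain x where x: "sq_norm ?V x = 1" "\<forall>v. x v \<ge> 0"
    "\<forall>v\<in>?V. graph_op G x v = ?\<rho> * x v"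
    using spectral_radius_eigenvector[OF G ne] .
  have sum_sq: "(\<Sum>v\<in>?V. (x v)\<^sup>2) = 1" using x(1) by (simp add: inner_on_def power2_eq_square)
  define u where "u = arg_min_on x ?V"
  have u: "u \<in> ?V" "\<And>v. v \<in> ?V \<Longrightarrow> x u \<le> x v"
    unfolding u_def using arg_min_if_finite(1)[OF V ne] arg_min_least[OF V ne] by auto
  define y where "y = (x u)\<^sup>2"
  have y_le: "y \<le> (x v)\<^sup>2" if "v \<in> ?V" for v
    unfolding y_def using u(2)[OF that] x(2) by (intro power_mono) auto
  have "?n * y \<le> 1" using sum_mono[of ?V "\<lambda>_. y" "\<lambda>v. (x v)\<^sup>2"] y_le sum_sq by simp
  moreover have "2 * y \<le> ?n * y" using n2 by (intro mult_right_mono) (auto simp: y_def)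
  ultimately have y1: "2 * y \<le> 1" by simp
  have form_x: "graph_form G x = ?\<rho>"
  proof -
    have "graph_form G x = inner_on ?V x (\<lambda>v. ?\<rho> * x v)" using x(3) by (intro inner_on_cong) auto
    then show ?thesis using x(1) by (simp add: inner_on_scale)
  qed
  define e where "e = (\<lambda>v. if v = u then 1 else (0::real))"
  have e: "inner_on ?V f e = f u" "inner_on ?V e f = f u" for f
    unfolding e_def using inner_on_indicator[OF V u(1)] by simp_all
  have restrict: "(\<lambda>v. if v \<in> ?V - {u} then x v else 0) v = 1 * x v + (- x u) * e v" if "v \<in> ?V" for v
    using that by (simp add: e_def)
  have form_e: "graph_form G e = 0"
    using parcs_irrefl[OF G, of u] graph_op_indicator[OF V u(1), of u] unfolding e by (simp add: e_def adj_def)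
  have cong: "graph_form G f = graph_form G g" if "\<And>v. v \<in> ?V \<Longrightarrow> f v = g v" for f g
    using that kernel_op_cong[of ?V f g "adj G"] by (intro inner_on_cong) auto
  have "graph_form (induced G (?V - {u})) x = graph_form G (\<lambda>v. 1 * x v + (- x u) * e v)"
    unfolding induced_form(1)[OF G Diff_subset] by (rule cong) (rule restrict)
  also have "\<dots> = ?\<rho> - 2 * ?\<rho> * y"
  proof -
    have "inner_on ?V x (graph_op G e) = inner_on ?V (graph_op G x) e"
      using kernel_op_symmetric[of ?V "adj G" x e] adj_sym[OF G] by blast
    also have "\<dots> = ?\<rho> * x u" using x(3) u(1) by (simp add: e)
    finally show ?thesis
      using quad_form_add[of ?V "adj G" 1 x "- x u" e] adj_sym[OF G] form_e form_x
      by (simp add: y_def power2_eq_square)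
  qed
  finally have f1: "graph_form (induced G (?V - {u})) x = ?\<rho> - 2 * ?\<rho> * y" .
  have "sq_norm (?V - {u}) x = 1 - y"
    using sum.remove[OF V u(1), of "\<lambda>v. (x v)\<^sup>2"] sum_sq by (simp add: inner_on_def power2_eq_square y_def)
  moreover have ne': "?V - {u} \<noteq> {}"
  proof
    assume "?V - {u} = {}"
    then have "?V \<subseteq> {u}" by auto
    then have "card ?V \<le> 1" using card_mono[of "{u}" ?V] by simp
    then show False using n2 by simp
  qed
  \<comment> \<open>Rayleigh bound for the Perron vector with its least entry cut off: the form
    drops by 2 \<rho> y and the norm by y. Compared with the deletion hypothesis this bounds y from
    below by z / (1 + z).\<close>
  ultimately have "?\<rho> - 2 * ?\<rho> * y \<le> spectral_radius (induced G (?V - {u})) * (1 - y)"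
    using graph_form_le[OF pair_graph_induced[OF G, of "?V - {u}"], of x] f1 by simp
  also have "\<dots> \<le> (1 - z) * ?\<rho> * (1 - y)" using del[OF u(1)] y1 by (intro mult_right_mono) (auto simp: y_def)
  finally have "?\<rho> * (1 - 2 * y) \<le> ?\<rho> * ((1 - z) * (1 - y))" by (simp add: algebra_simps)
  then have "1 - 2 * y \<le> (1 - z) * (1 - y)" using pos by (simp add: mult_le_cancel_left_pos)
  then have zy: "z \<le> y * (1 + z)" by (simp add: algebra_simps)
  then have "0 < y * (1 + z)" using \<open>z > 0\<close> by linarith
  then have "y > 0" using \<open>z > 0\<close> by (simp add: zero_less_mult_iff)
  define N where "N = {v. (w, v) \<in> parcs G}"
  have N: "N \<subseteq> ?V" "finite N" using parcs_in_pverts[OF G] V finite_subset by (auto simp: N_def intro: finite_subset[OF _ V])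
  have dN: "d = real (card N)" by (simp add: d N_def)
  \<comment> \<open>Cauchy-Schwarz in the eigenvalue equation at \<open>w\<close>; the n - d
    vertices not adjacent to \<open>w\<close> carry at least y of the norm each, which is missing
    from the right side.\<close>
  have "?\<rho> * x w = (\<Sum>v\<in>N. x v)" using x(3) w by (simp add: graph_op_eq[OF G] N_def)
  then have "(?\<rho> * x w)\<^sup>2 \<le> (\<Sum>v\<in>N. (x v)\<^sup>2) * real (card N)"
    using sum_squared_le_sum_of_squares[of x N] by (simp only:)
  also have "\<dots> = d * (\<Sum>v\<in>N. (x v)\<^sup>2)" by (simp add: dN)
  also have "\<dots> \<le> d * (1 - (?n - d) * y)"
  proof (rule mult_left_mono)
    have "(\<Sum>v\<in>?V. (x v)\<^sup>2) = (\<Sum>v\<in>?V - N. (x v)\<^sup>2) + (\<Sum>v\<in>N. (x v)\<^sup>2)"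
      by (rule sum.subset_diff[OF N(1) V])
    moreover have "(\<Sum>v\<in>?V - N. y) \<le> (\<Sum>v\<in>?V - N. (x v)\<^sup>2)" using y_le by (intro sum_mono) auto
    moreover have "real (card (?V - N)) = ?n - d"
      using card_Diff_subset[OF N(2,1)] card_mono[OF V N(1)] by (simp add: dN of_nat_diff)
    ultimately show "(\<Sum>v\<in>N. (x v)\<^sup>2) \<le> 1 - (?n - d) * y" using sum_sq by simp
  qed (simp add: dN)
  finally have "?\<rho>\<^sup>2 * (x w)\<^sup>2 \<le> d * (1 - (?n - d) * y)" by (simp add: power_mult_distrib)
  moreover have "?\<rho>\<^sup>2 * y \<le> ?\<rho>\<^sup>2 * (x w)\<^sup>2" using y_le[OF w] by (intro mult_left_mono) auto
  ultimately have "y * (?\<rho>\<^sup>2 + d * (?n - d)) \<le> d" by (simp add: algebra_simps)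
  also have "d = d * 1" by simp
  also have "d * 1 \<le> d * (y * (1 + 1 / z))"
  proof (rule mult_left_mono)
    have "1 \<le> y * (1 + z) / z" using zy \<open>z > 0\<close> by (simp add: le_divide_eq)
    then show "1 \<le> y * (1 + 1 / z)" using \<open>z > 0\<close> by (simp add: field_simps)
  qed (simp add: dN)
  finally have "y * (?\<rho>\<^sup>2 + d * (?n - d)) \<le> y * (d * (1 + 1 / z))" by (simp add: mult_ac)
  then have "?\<rho>\<^sup>2 + d * (?n - d) \<le> d * (1 + 1 / z)" using \<open>y > 0\<close> by (simp add: mult_le_cancel_left_pos)
  then show ?thesis by (simp add: algebra_simps)
qed

lemma non_nbrs_card:
  assumes G: "pair_graph G" and "w \<in> pverts G"
  shows "real (card (non_nbrs (parcs G) (pverts G) w)) = real (card (pverts G)) - real (card {v. (w, v) \<in> parcs G})"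
proof -
  have "{v. (w, v) \<in> parcs G} \<subseteq> pverts G" using parcs_in_pverts[OF G] by blast
  moreover have "non_nbrs (parcs G) (pverts G) w = pverts G - {v. (w, v) \<in> parcs G}" by auto
  ultimately show ?thesis
    using finite_pverts[OF G] by (simp add: card_Diff_subset card_mono finite_subset of_nat_diff)
qed

section \<open>Dense induced subgraphs of large spectral radius\<close>

text \<open>Weighted arithmetic-geometric mean inequality for (n - 1) / n and 1 with weights 1 -
  \<eta> and \<eta>.\<close>

lemma powr_pred_le:
  assumes "0 < \<eta>" "\<eta> < 1" "n \<ge> (2::real)"
  shows "(n - 1) powr (1 - \<eta>) \<le> (1 - (1 - \<eta>) / n) * n powr (1 - \<eta>)"
proof -
  have "((n - 1) / n) powr (1 - \<eta>) * 1 powr \<eta> \<le> (1 - \<eta>) * ((n - 1) / n) + \<eta> * 1"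
    using assms by (intro Youngs_inequality_0) auto
  also have "\<dots> = 1 - (1 - \<eta>) / n" using assms by (simp add: field_simps)
  finally have "(n - 1) powr (1 - \<eta>) / n powr (1 - \<eta>) \<le> 1 - (1 - \<eta>) / n"
    using assms by (simp add: powr_divide)
  then show ?thesis using assms by (simp add: divide_le_eq)
qed

text \<open>\<open>S\<close> maximizes the spectral radius divided by the power 1 - \<eta> of the
  number of vertices. Comparison with all of \<open>K\<close> shows that \<open>S\<close> is smaller
  by a factor of at most 2^(1 / \<eta>). Comparison with \<open>S\<close> minus a vertex shows that
  each deletion costs a factor of at most 1 - (1 - \<eta>) / n on the right side, and hence forces
  large degrees. The value of \<eta> is a quarter of the excess 1 / (4 r (r + 1)) that the degree
  bound tolerates.\<close>

lemma dense_subgraph_exists: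
  fixes r :: nat
  assumes K: "pair_graph K" "pverts K \<noteq> {}" and "r \<ge> 2"
    and \<rho>: "spectral_radius K > (1 - 1 / real r) * real (card (pverts K))"
  obtains S where "S \<subseteq> pverts K" "S \<noteq> {}"
    "spectral_radius (induced K S) > (1 - 1 / real r) * real (card S)"
    "card (pverts K) \<le> 2 ^ (16 * r * (r + 1)) * card S"
    "8 * r * (r + 1) \<le> card S \<longrightarrow> (\<forall>w\<in>S. 4 * r * (r + 1) * card (non_nbrs (parcs (induced K S)) S w) \<le> (4 * r + 5) * card S)"
proof -
  let ?V = "pverts K"
  define a where "a = 1 - 1 / real r"
  define \<eta> where "\<eta> = 1 / (16 * real r * (real r + 1))"
  have a: "1 / 2 \<le> a" "a < 1" using \<open>r \<ge> 2\<close> by (auto simp: a_def field_simps)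
  have r6: "real r * (real r + 1) \<ge> 6"
    using mult_mono[of 2 "real r" 3 "real r + 1"] \<open>r \<ge> 2\<close> by simp
  have \<eta>: "0 < \<eta>" "\<eta> \<le> 1 / 96" using r6 \<open>r \<ge> 2\<close> by (auto simp: \<eta>_def field_simps)
  have V: "finite ?V" by (rule finite_pverts[OF K(1)])
  define g where "g S = spectral_radius (induced K S) / real (card S) powr (1 - \<eta>)" for S
  have "finite (Pow ?V - {{}})" "Pow ?V - {{}} \<noteq> {}" using V K(2) by auto
  then obtain S where S1: "S \<in> Pow ?V - {{}}" "Max (g ` (Pow ?V - {{}})) = g S"
    by (rule obtains_MAX)
  have S: "S \<in> Pow ?V - {{}}" "g T \<le> g S" if "T \<in> Pow ?V - {{}}" for T
    using S1 V that Max_ge[of "g ` (Pow ?V - {{}})" "g T"] by auto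
  note S = S1(1) S(2)
  have SV: "S \<subseteq> ?V" "S \<noteq> {}" using S(1) by auto
  have finS: "finite S" using SV(1) V finite_subset by blast
  have iS: "pair_graph (induced K S)" by (rule pair_graph_induced[OF K(1) SV(1)])
  define n where "n = real (card S)"
  define M where "M = real (card ?V)"
  have n: "n \<ge> 1" using SV(2) finS by (simp add: n_def Suc_le_eq card_gt_0_iff)
  have nM: "n \<le> M" unfolding n_def M_def using card_mono[OF V SV(1)] by simp
  have "induced K ?V = K" using K(1) by (cases K) (auto simp: induced_def pair_graph_iff)
  then have gV: "g ?V = spectral_radius K / M powr (1 - \<eta>)" by (simp add: g_def M_def)
  have "a * M / M powr (1 - \<eta>) < spectral_radius K / M powr (1 - \<eta>)"
    using \<rho> n nM by (intro divide_strict_right_mono) (auto simp: a_def M_def)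
  also have "\<dots> \<le> g S" using S(2)[of ?V] K(2) gV by simp
  also have "\<dots> = spectral_radius (induced K S) / n powr (1 - \<eta>)" by (simp add: g_def n_def)
  finally have "a * M / M powr (1 - \<eta>) < spectral_radius (induced K S) / n powr (1 - \<eta>)" .
  moreover have "M / M powr (1 - \<eta>) = M powr \<eta>" "n = n powr \<eta> * n powr (1 - \<eta>)"
    using n nM by (simp_all add: powr_diff flip: powr_add)
  ultimately have big: "a * M powr \<eta> * n powr (1 - \<eta>) < spectral_radius (induced K S)"
    using n by (simp add: less_divide_eq flip: times_divide_eq_right)
  have rS: "spectral_radius (induced K S) > a * n"
  proof -
    have "n powr \<eta> \<le> M powr \<eta>" using n nM \<eta> by (intro powr_mono2) auto
    then have "a * n powr \<eta> * n powr (1 - \<eta>) \<le> a * M powr \<eta> * n powr (1 - \<eta>)"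
      using a by (intro mult_right_mono mult_left_mono) auto
    moreover have "a * n = a * n powr \<eta> * n powr (1 - \<eta>)" using n by (simp add: mult.assoc flip: powr_add)
    ultimately show ?thesis using big by linarith
  qed
  \<comment> \<open>As no spectral radius exceeds the order, maximality gives a M^\<eta> \<le>
    n^\<eta>, and a is at least 1 / 2.\<close>
  have size: "M \<le> 2 ^ (16 * r * (r + 1)) * n"
  proof -
    have "spectral_radius (induced K S) \<le> n" using spectral_radius_le_card[OF iS] SV(2) by (simp add: n_def)
    then have "a * M powr \<eta> * n powr (1 - \<eta>) \<le> n powr \<eta> * n powr (1 - \<eta>)"
      using big n by (simp flip: powr_add)
    then have "a * M powr \<eta> \<le> n powr \<eta>" using n by (simp add: mult_le_cancel_right)
    moreover have "1 / 2 * M powr \<eta> \<le> a * M powr \<eta>" using a by (intro mult_right_mono) auto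
    ultimately have "M powr \<eta> \<le> 2 * n powr \<eta>" by simp
    then have "(M powr \<eta>) powr (1 / \<eta>) \<le> (2 * n powr \<eta>) powr (1 / \<eta>)" using \<eta> by (intro powr_mono2) auto
    then have "M \<le> 2 powr (1 / \<eta>) * n" using \<eta> n nM by (simp add: powr_powr powr_mult)
    also have "1 / \<eta> = real (16 * r * (r + 1))" by (simp add: \<eta>_def algebra_simps)
    also have "2 powr real (16 * r * (r + 1)) = 2 ^ (16 * r * (r + 1))" by (rule powr_realpow) simp
    finally show ?thesis .
  qed
  have deg: "4 * r * (r + 1) * card (non_nbrs (parcs (induced K S)) S w) \<le> (4 * r + 5) * card S"
    if large: "8 * r * (r + 1) \<le> card S" and w: "w \<in> S" for w
  proof -
    define \<epsilon> where "\<epsilon> = 1 / (4 * real r * (real r + 1))"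
    define d where "d = real (card {v. (w, v) \<in> parcs (induced K S)})"
    have \<epsilon>: "\<epsilon> = 4 * \<eta>" "0 < \<epsilon>" using r6 \<open>r \<ge> 2\<close> by (simp_all add: \<epsilon>_def \<eta>_def)
    have "real (8 * r * (r + 1)) \<le> n" unfolding n_def using large by (rule of_nat_mono)
    then have n8: "8 * real r * (real r + 1) \<le> n" by (simp add: algebra_simps)
    then have n48: "n \<ge> 48" using r6 by simp
    have inv_n: "1 \<le> \<epsilon> / 2 * n" using n8 r6 \<open>r \<ge> 2\<close> by (simp add: \<epsilon>_def field_simps)
    define z where "z = (1 - \<eta>) / n"
    have "z > 0" using \<eta> n by (simp add: z_def)
    have "(spectral_radius (induced K S))\<^sup>2 \<le> d * (d + 1 / z + 1 - real (card (pverts (induced K S))))"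
    proof (rule degree_bound_of_vertex_deletion[OF iS _ _ \<open>z > 0\<close> _ _ d_def])
      show "2 \<le> card (pverts (induced K S))" using n48 by (simp add: n_def)
      have "0 < a * n" using a n by simp
      then show "0 < spectral_radius (induced K S)" using rS by linarith
      show "w \<in> pverts (induced K S)" using w by simp
      fix u assume u: "u \<in> pverts (induced K S)"
      have cSu: "real (card (S - {u})) = n - 1"
        using u finS n by (simp add: n_def card_Diff_singleton of_nat_diff Suc_le_eq card_gt_0_iff)
      have "S - {u} \<noteq> {}"
      proof
        assume "S - {u} = {}"
        then have "real (card (S - {u})) = 0" by (simp only: card.empty of_nat_0)
        then show False using cSu n48 by linarith
      qed
      then have "g (S - {u}) \<le> g S" by (intro S(2)) (use SV(1) in auto)
      then have "spectral_radius (induced K (S - {u})) / (n - 1) powr (1 - \<eta>)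
          \<le> spectral_radius (induced K S) / n powr (1 - \<eta>)"
        by (simp add: g_def cSu flip: n_def)
      then have "spectral_radius (induced K (S - {u}))
          \<le> spectral_radius (induced K S) / n powr (1 - \<eta>) * (n - 1) powr (1 - \<eta>)"
        using n48 by (simp add: divide_le_eq)
      also have "\<dots> \<le> spectral_radius (induced K S) / n powr (1 - \<eta>) * ((1 - z) * n powr (1 - \<eta>))"
      proof (rule mult_left_mono)
        show "(n - 1) powr (1 - \<eta>) \<le> (1 - z) * n powr (1 - \<eta>)"
          unfolding z_def using \<eta> n48 by (intro powr_pred_le) auto
        have "0 \<le> a * n" using a n by simp
        then show "0 \<le> spectral_radius (induced K S) / n powr (1 - \<eta>)" using rS by simp
      qed
      also have "\<dots> = (1 - z) * spectral_radius (induced K S)" using n by simp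
      finally show "spectral_radius (induced (induced K S) (pverts (induced K S) - {u}))
          \<le> (1 - z) * spectral_radius (induced K S)"
      proof -
        have "induced (induced K S) (S - {u}) = induced K (S - {u})" by (auto simp: induced_def)
        then show ?thesis using \<open>spectral_radius (induced K (S - {u})) \<le> _\<close>
            \<open>spectral_radius (induced K S) / n powr (1 - \<eta>) * (n - 1) powr (1 - \<eta>) \<le> _\<close>
            \<open>_ = (1 - z) * spectral_radius (induced K S)\<close> by simp
      qed
    qed
    moreover have "(a * n)\<^sup>2 < (spectral_radius (induced K S))\<^sup>2"
      using rS a n by (intro power_strict_mono) auto
    ultimately have sq: "(a * n)\<^sup>2 < d * (d + 1 / z + 1 - n)" by (simp add: n_def)
    \<comment> \<open>1 / z = n / (1 - \<eta>) exceeds n by at most 2 \<eta> n, which is half of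
      \<epsilon> n. The other half absorbs the summand 1 of the degree bound.\<close>
    have "1 / z \<le> n + \<epsilon> / 2 * n"
    proof -
      have "1 \<le> (1 + 2 * \<eta>) * (1 - \<eta>)"
        using mult_nonneg_nonneg[of \<eta> "1 - 2 * \<eta>"] \<eta> by (simp add: algebra_simps)
      then have "n * 1 \<le> n * ((1 + 2 * \<eta>) * (1 - \<eta>))" using n by (intro mult_left_mono) auto
      then have "n / (1 - \<eta>) \<le> n * (1 + 2 * \<eta>)" using \<eta> by (simp add: divide_le_eq mult_ac)
      then show ?thesis by (simp add: z_def \<epsilon> algebra_simps)
    qed
    then have "d + 1 / z + 1 - n \<le> d + \<epsilon> * n" using inv_n by (simp add: algebra_simps)
    then have "d * (d + 1 / z + 1 - n) \<le> d * (d + \<epsilon> * n)" by (rule mult_left_mono) (simp add: d_def)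
    with sq have sq': "(a * n)\<^sup>2 < d * (d + \<epsilon> * n)" by simp
    have "(a - \<epsilon>) * n \<le> d"
    proof (rule ccontr)
      assume "\<not> ?thesis"
      then have dl: "d < (a - \<epsilon>) * n" by simp
      then have le: "d + \<epsilon> * n \<le> a * n" "d \<le> a * n"
        using mult_pos_pos[OF \<epsilon>(2), of n] n by (simp_all add: algebra_simps)
      have "d * (d + \<epsilon> * n) \<le> (a * n) * (a * n)"
        using le \<epsilon> n a by (intro mult_mono) (auto simp: d_def)
      then show False using sq' by (simp add: power2_eq_square)
    qed
    moreover have "real (card (non_nbrs (parcs (induced K S)) S w)) = n - d"
      using non_nbrs_card[OF iS, of w] w by (simp add: n_def d_def)
    ultimately have nb: "real (card (non_nbrs (parcs (induced K S)) S w)) \<le> (1 / real r + \<epsilon>) * n"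
      by (simp add: a_def algebra_simps)
    have "real (4 * r * (r + 1) * card (non_nbrs (parcs (induced K S)) S w))
        = 4 * real r * (real r + 1) * real (card (non_nbrs (parcs (induced K S)) S w))"
      by (simp add: algebra_simps)
    also have "\<dots> \<le> 4 * real r * (real r + 1) * ((1 / real r + \<epsilon>) * n)"
      using nb by (intro mult_left_mono) auto
    also have "\<dots> = (4 * real r * (real r + 1) * (1 / real r) + 4 * real r * (real r + 1) * \<epsilon>) * n"
    proof -
      have "c * ((p + q) * n) = (c * p + c * q) * n" for c p q :: real by (simp add: algebra_simps)
      then show ?thesis .
    qed
    also have "4 * real r * (real r + 1) * (1 / real r) = 4 * (real r + 1)" using \<open>r \<ge> 2\<close> by simp
    also have "4 * real r * (real r + 1) * \<epsilon> = 1"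
    proof -
      have "4 * real r * (real r + 1) \<noteq> 0" using \<open>r \<ge> 2\<close> by simp
      then have "4 * real r * (real r + 1) / (4 * real r * (real r + 1)) = 1" by (rule divide_self)
      then show ?thesis unfolding \<epsilon>_def by (simp only: times_divide_eq_right mult_1_right)
    qed
    also have "(4 * (real r + 1) + 1) * n = real ((4 * r + 5) * card S)" by (simp add: n_def)
    finally show ?thesis by (rule of_nat_le_iff[THEN iffD1])
  qed
  have "real (card ?V) \<le> real (2 ^ (16 * r * (r + 1)) * card S)" using size by (simp add: M_def n_def)
  then have "card ?V \<le> 2 ^ (16 * r * (r + 1)) * card S" by (rule of_nat_le_iff[THEN iffD1])
  then show thesis
    using that[OF SV] rS deg by (simp add: a_def n_def)
qed

section \<open>Arithmetic of the threshold\<close>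

text \<open>Serves to replace 24^r, which occurs in F = 2 * 24^r * r^r, by powers of
  \<open>r\<close>.\<close>

lemma pow24_le:
  assumes "(r::nat) \<ge> 2"
  shows "24 ^ r \<le> 6 * r ^ (r + 12)"
  using assms
proof (induction r rule: dec_induct)
  case base
  show ?case by simp
next
  case (step r)
  have "real r ^ (r + 12) * (24 * real r) \<le> real r ^ (r + 12) * ((real r + 1) * (2 * real r + 12))"
  proof (intro mult_left_mono)
    \<comment> \<open>After Bernoulli's inequality the step needs 24 r \<le> (r + 1) (2 r + 12),
      which is this inequality doubled. It holds because \<open>r\<close> is an integer; between 2
      and 3 it would fail.\<close>
    have "0 \<le> (real r - 2) * (real r - 3)"
    proof (cases "r = 2")
      case False
      then show ?thesis using step.hyps by (intro mult_nonneg_nonneg) auto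
    qed simp
    then show "24 * real r \<le> (real r + 1) * (2 * real r + 12)" by (simp add: algebra_simps)
  qed simp
  also have "\<dots> = (real r + 1) * real r * (real r ^ (r + 12) * (1 + real (r + 12) * (1 / real r)))"
    using step.hyps by (simp add: field_simps)
  also have "\<dots> \<le> (real r + 1) * real r * (real r ^ (r + 12) * (1 + 1 / real r) ^ (r + 12))"
  proof (intro mult_left_mono)
    show "1 + real (r + 12) * (1 / real r) \<le> (1 + 1 / real r) ^ (r + 12)"
    proof (rule Bernoulli_inequality)
      have "0 \<le> 1 / real r" by simp
      then show "- 1 \<le> 1 / real r" by linarith
    qed
  qed auto
  also have "real r ^ (r + 12) * (1 + 1 / real r) ^ (r + 12) = (real r + 1) ^ (r + 12)"
    using step.hyps by (simp add: field_simps flip: power_mult_distrib)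
  finally have "real r * (24 * real r ^ (r + 12)) \<le> real r * ((real r + 1) * (real r + 1) ^ (r + 12))"
    by (simp only: mult_ac)
  then have "24 * real r ^ (r + 12) \<le> (real r + 1) * (real r + 1) ^ (r + 12)"
    by (rule mult_left_le_imp_le) (use step.hyps in simp)
  moreover have "real (Suc r) = real r + 1" by simp
  ultimately have "real (24 * r ^ (r + 12)) \<le> real (Suc r * Suc r ^ (r + 12))"
    by (simp only: of_nat_mult of_nat_power of_nat_numeral)
  then have "24 * r ^ (r + 12) \<le> Suc r * Suc r ^ (r + 12)" by (rule of_nat_le_iff[THEN iffD1])
  then have "6 * (24 * r ^ (r + 12)) \<le> 6 * (Suc r * Suc r ^ (r + 12))" by (rule mult_le_mono2)
  moreover have "24 * 24 ^ r \<le> 24 * (6 * r ^ (r + 12))" using step.IH by (rule mult_le_mono2)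
  moreover have "(24::nat) ^ Suc r = 24 * 24 ^ r" "Suc r ^ (Suc r + 12) = Suc r * Suc r ^ (r + 12)"
    by (simp_all only: power_Suc add_Suc)
  ultimately show ?case by linarith
qed

text \<open>With F \<le> 12 r^(2 r + 12) and 4 * 12^(r - 1) \<le> r^(r + 21) the exponents add up to
  (r + 21) + (2 r + 12) (r - 1), which is exactly the exponent of the threshold.\<close>

lemma exponent_bound:
  assumes "(r::nat) \<ge> 2" and F: "F = 2 ^ (r + 1) * (12 * r) ^ r"
  shows "4 * F ^ (r - 1) \<le> r ^ ((2 * r + 9) * (r + 1))"
proof -
  have "F = 2 * 24 ^ r * r ^ r" unfolding F by (simp add: power_mult_distrib flip: power_mult_distrib[of 2 12])
  also have "\<dots> \<le> 2 * (6 * r ^ (r + 12)) * r ^ r" using pow24_le[OF assms(1)] by (intro mult_le_mono) auto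
  also have "\<dots> = 12 * (r ^ (r + 12) * r ^ r)" by (simp only: mult.assoc)
  also have "r ^ (r + 12) * r ^ r = r ^ (2 * r + 12)"
    unfolding power_add[symmetric] by (rule arg_cong[of _ _ "power r"]) simp
  finally have "4 * F ^ (r - 1) \<le> 4 * (12 * r ^ (2 * r + 12)) ^ (r - 1)" by (intro mult_le_mono2 power_mono) auto
  also have "\<dots> = 4 * 12 ^ (r - 1) * r ^ ((2 * r + 12) * (r - 1))" by (simp add: power_mult_distrib power_mult)
  also have "4 * 12 ^ (r - 1) \<le> r ^ (r + 21)"
  proof -
    have "4 * 12 ^ (r - 1) \<le> (24::nat) * 24 ^ (r - 1)" by (intro mult_le_mono power_mono) auto
    also have "\<dots> = 24 ^ r" using assms(1) by (cases r) auto
    also have "\<dots> \<le> 6 * r ^ (r + 12)" by (rule pow24_le[OF assms(1)])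
    also have "\<dots> \<le> r ^ 9 * r ^ (r + 12)"
    proof (rule mult_le_mono1)
      have "(2::nat) ^ 9 \<le> r ^ 9" using assms(1) by (rule power_mono) simp
      then show "6 \<le> r ^ 9" by simp
    qed
    also have "\<dots> = r ^ (r + 21)"
      unfolding power_add[symmetric] by (rule arg_cong[of _ _ "power r"]) simp
    finally show ?thesis .
  qed
  then have "4 * 12 ^ (r - 1) * r ^ ((2 * r + 12) * (r - 1)) \<le> r ^ (r + 21) * r ^ ((2 * r + 12) * (r - 1))"
    by (rule mult_le_mono1)
  also have "\<dots> = r ^ ((r + 21) + (2 * r + 12) * (r - 1))" by (simp only: power_add)
  also have "(r + 21) + (2 * r + 12) * (r - 1) = (2 * r + 9) * (r + 1)"
  proof -
    obtain k where "r = Suc k" using assms(1) by (cases r) auto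
    then show ?thesis by (simp add: algebra_simps)
  qed
  finally show ?thesis .
qed

text \<open>The hypothesis gives m \<ge> 2^(4 Q), and each of 2^(16 r (r + 1) + 1),
  \<open>F\<close>, \<open>Q\<close> and 2^Q is at most 2^Q. The spare factor 2 makes the conclusion
  strict, so that it remains usable with one vertex less than \<open>m\<close>.\<close>

lemma threshold_size:
  fixes r n\<^sub>0 m :: nat
  assumes "r \<ge> 2" "n\<^sub>0 \<ge> 1" and F: "F = 2 ^ (r + 1) * (12 * r) ^ r" and Q: "Q = n\<^sub>0 * F ^ (r - 1)"
    and m: "exp (real n\<^sub>0 * real r ^ ((2 * r + 9) * (r + 1))) \<le> real m"
  shows "2 ^ (16 * r * (r + 1)) * (F * Q * 2 ^ Q) < m" "1152 * r\<^sup>2 \<le> F" "F \<le> Q"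
proof -
  have "(2::nat) ^ 3 * (12 * r) ^ 2 \<le> 2 ^ (r + 1) * (12 * r) ^ r"
    using \<open>r \<ge> 2\<close> by (intro mult_le_mono power_increasing) auto
  then show F_ge: "1152 * r\<^sup>2 \<le> F" unfolding F by (simp add: power_mult_distrib)
  then have F0: "F \<ge> 1" using \<open>r \<ge> 2\<close> by (metis One_nat_def Suc_leI le_trans mult_eq_0_iff not_gr_zero power_eq_0_iff le_zero_eq zero_neq_numeral not_numeral_le_zero)
  have "F ^ 1 \<le> F ^ (r - 1)" using \<open>r \<ge> 2\<close> F0 by (intro power_increasing) auto
  then have "1 * F \<le> n\<^sub>0 * F ^ (r - 1)" using \<open>n\<^sub>0 \<ge> 1\<close> by (intro mult_le_mono) auto
  then show FQ: "F \<le> Q" by (simp add: Q)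
  have "16 * r * (r + 1) + 1 \<le> 1152 * r\<^sup>2"
  proof -
    have "r \<le> r * r" by (rule le_square)
    moreover have "16 * r * (r + 1) + 1 = 16 * (r * r) + 16 * r + 1" by (simp add: algebra_simps)
    ultimately show ?thesis unfolding power2_eq_square using \<open>r \<ge> 2\<close> by linarith
  qed
  then have p: "16 * r * (r + 1) + 1 \<le> Q" using F_ge FQ by linarith
  have Q2: "Q \<le> 2 ^ Q" by (rule less_imp_le) simp
  then have F2: "F \<le> 2 ^ Q" using FQ by linarith
  have "2 ^ (16 * r * (r + 1) + 1) * (F * Q * 2 ^ Q) \<le> 2 ^ Q * (2 ^ Q * 2 ^ Q * 2 ^ Q)"
    using p Q2 F2 by (intro mult_le_mono power_increasing) auto
  also have "\<dots> = 2 ^ (4 * Q)" by (simp add: numeral_eq_Suc power_add)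
  finally have le: "2 * (2 ^ (16 * r * (r + 1)) * (F * Q * 2 ^ Q)) \<le> 2 ^ (4 * Q)" by (simp add: mult_ac)
  have "4 * Q \<le> n\<^sub>0 * r ^ ((2 * r + 9) * (r + 1))"
    using mult_le_mono2[OF exponent_bound[OF \<open>r \<ge> 2\<close> F], of n\<^sub>0] by (simp add: Q mult_ac)
  then have "real (4 * Q) \<le> real (n\<^sub>0 * r ^ ((2 * r + 9) * (r + 1)))" by (rule of_nat_mono)
  then have "real (4 * Q) \<le> real n\<^sub>0 * real r ^ ((2 * r + 9) * (r + 1))"
    by (simp only: of_nat_mult of_nat_power)
  then have "exp (real (4 * Q)) \<le> exp (real n\<^sub>0 * real r ^ ((2 * r + 9) * (r + 1)))"
    by (simp only: exp_le_cancel_iff)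
  then have "exp (real (4 * Q)) \<le> real m" using m by (rule order_trans)
  moreover have "(2::real) ^ (4 * Q) \<le> exp (real (4 * Q))"
  proof -
    have "(2::real) \<le> exp 1" using exp_ge_add_one_self[of 1] by simp
    then have "(2::real) ^ (4 * Q) \<le> exp 1 ^ (4 * Q)" by (rule power_mono) simp
    then show ?thesis by (simp add: exp_of_nat_mult[symmetric] flip: exp_of_nat2_mult)
  qed
  ultimately have "real (2 ^ (4 * Q)) \<le> real m"
    unfolding of_nat_power of_nat_numeral by (meson order_trans)
  then have "2 ^ (4 * Q) \<le> m" by (rule of_nat_le_iff[THEN iffD1])
  moreover have "0 < 2 ^ (16 * r * (r + 1)) * (F * Q * 2 ^ Q)" using F0 FQ by simp
  ultimately show "2 ^ (16 * r * (r + 1)) * (F * Q * 2 ^ Q) < m" using le by linarith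
qed

lemma colour_critical_card_pos:
  assumes "colour_critical r H"
  shows "card (pverts H) \<ge> 1"
proof -
  have H: "pair_graph H" using assms by (simp add: colour_critical_def)
  obtain u v where "(u, v) \<in> parcs H" using assms by (auto simp: colour_critical_def)
  then have "pverts H \<noteq> {}" using parcs_in_pverts[OF H] by blast
  then show ?thesis using finite_pverts[OF H] by (simp add: Suc_le_eq card_gt_0_iff)
qed

section \<open>Spectral bound and stability of free graphs\<close>

lemma contains_critical_of_clique:
  fixes r :: nat
  assumes "r \<ge> 2" and crit: "colour_critical r H" and G: "pair_graph G"
    and sparse: "\<And>v. v \<in> pverts G \<Longrightarrow>
      4 * r * (r + 1) * card (non_nbrs (parcs G) (pverts G) v) \<le> (4 * r + 5) * card (pverts G)"
    and K: "K \<subseteq> pverts G" "card K = r + 1" "is_clique (parcs G) K"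
    and size: "F = 2 ^ (r + 1) * (12 * r) ^ r" "Q = card (pverts H) * F ^ (r - 1)" "F * Q * 2 ^ Q \<le> card (pverts G)"
  shows "contains_copy H G"
proof -
  have V: "finite (pverts G)" "parcs G \<subseteq> pverts G \<times> pverts G" "sym (parcs G)" "irrefl (parcs G)"
    using G by (auto simp: pair_graph_iff)
  have Q: "card (pverts H) * F ^ (r - 1) \<le> Q" using size(2) by simp
  obtain u v A where "(u, v) \<in> parcs G" "finite A" "card A = card (pverts H)" "multipartite_family (parcs G) r A"
    "\<forall>L\<in>A. \<forall>i. 0 < i \<and> i < r \<longrightarrow> (u, L ! i) \<in> parcs G \<and> (v, L ! i) \<in> parcs G"
    by (rule edge_with_multipartite_family[OF V \<open>r \<ge> 2\<close> sparse K size(1) Q size(3)])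
  then show ?thesis by (rule critical_graph_embeds[OF crit G \<open>r \<ge> 2\<close>])
qed

text \<open>A violation passes to a large dense induced subgraph, which has an (r + 1)-clique by
  Wilf's bound and therefore contains \<open>H\<close>. The size condition is on the number of
  vertices plus one, since the bound is applied to vertex-deleted subgraphs and to sets of m - 1
  vertices.\<close>

lemma spectral_radius_le_of_free:
  assumes "r \<ge> 2" and crit: "colour_critical r H" and K: "pair_graph K" "pverts K \<noteq> {}"
    and free: "free_of H K"
    and m: "exp (real (card (pverts H)) * real r ^ ((2 * r + 9) * (r + 1))) \<le> real (card (pverts K) + 1)"
  shows "spectral_radius K \<le> (1 - 1 / real r) * real (card (pverts K))"
proof (rule ccontr)
  assume "\<not> ?thesis"
  then have gt: "spectral_radius K > (1 - 1 / real r) * real (card (pverts K))" by simp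
  define F where "F = 2 ^ (r + 1) * (12 * r) ^ r"
  define Q where "Q = card (pverts H) * F ^ (r - 1)"
  note size = threshold_size[OF \<open>r \<ge> 2\<close> colour_critical_card_pos[OF crit] F_def Q_def m]
  obtain S where S: "S \<subseteq> pverts K" "S \<noteq> {}"
    "spectral_radius (induced K S) > (1 - 1 / real r) * real (card S)"
    "card (pverts K) \<le> 2 ^ (16 * r * (r + 1)) * card S"
    "8 * r * (r + 1) \<le> card S \<longrightarrow> (\<forall>w\<in>S. 4 * r * (r + 1) * card (non_nbrs (parcs (induced K S)) S w) \<le> (4 * r + 5) * card S)"
    by (rule dense_subgraph_exists[OF K \<open>r \<ge> 2\<close> gt])
  have iS: "pair_graph (induced K S)" by (rule pair_graph_induced[OF K(1) S(1)])
  have "2 ^ (16 * r * (r + 1)) * (F * Q * 2 ^ Q) \<le> 2 ^ (16 * r * (r + 1)) * card S" using size(1) S(4) by linarith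
  then have cS: "F * Q * 2 ^ Q \<le> card S" by simp
  have "8 * r * (r + 1) \<le> card S"
  proof -
    have "8 * r * (r + 1) \<le> 1152 * r\<^sup>2" using \<open>r \<ge> 2\<close> by (simp add: power2_eq_square algebra_simps)
    also have "\<dots> \<le> F" by (rule size(2))
    also have "\<dots> \<le> F * Q * 2 ^ Q"
    proof -
      have "F * 1 * 1 \<le> F * Q * 2 ^ Q" using size(2,3) \<open>r \<ge> 2\<close> by (intro mult_le_mono) (auto intro: order_trans[of _ "1152 * r\<^sup>2"])
      then show ?thesis by simp
    qed
    also note cS
    finally show ?thesis .
  qed
  then have sparse: "\<forall>w\<in>S. 4 * r * (r + 1) * card (non_nbrs (parcs (induced K S)) S w) \<le> (4 * r + 5) * card S"
    using S(5) by simp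
  have "\<exists>C\<subseteq>S. is_clique (parcs (induced K S)) C \<and> \<not> card C \<le> r"
  proof (rule ccontr)
    assume "\<not> ?thesis"
    then have "spectral_radius (induced K S) \<le> (1 - 1 / real r) * real (card (pverts (induced K S)))"
      using \<open>r \<ge> 2\<close> S(2) by (intro spectral_radius_le_of_no_clique[OF iS]) auto
    then show False using S(3) by simp
  qed
  then obtain C where C: "C \<subseteq> S" "is_clique (parcs (induced K S)) C" "r + 1 \<le> card C" by auto
  then obtain D where D: "D \<subseteq> C" "card D = r + 1" by (meson obtain_subset_with_card_n)
  have clD: "is_clique (parcs (induced K S)) D" using C(2) D(1) unfolding is_clique_def by blast
  have "contains_copy H (induced K S)"
    by (rule contains_critical_of_clique[OF \<open>r \<ge> 2\<close> crit iS _ _ D(2) clD F_def Q_def])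
      (use sparse C(1) D(1) cS in auto)
  then show False using free_of_induced[OF _ K(1) S(1) free] crit by (simp add: colour_critical_def)
qed

text \<open>Each vertex-deleted subgraph obeys the bound (1 - 1 / r) (n - 1), while \<open>G\<close>
  nearly attains (1 - 1 / r) n. So every deletion is costly, and all degrees are at least \<rho> -
  (4 r + 5). Non-neighbours then number at most n / r plus a constant depending on \<open>r\<close>,
  which excludes (r + 1)-cliques and permits the colouring. The defect (r + 1) / n is what two
  joined Turan graphs leave: r / n from the Turan graph and 1 / n from the joining edge.\<close>

lemma colouring_of_near_extremal:
  assumes "r \<ge> 2" and crit: "colour_critical r H" and G: "pair_graph G"
    and free: "free_of H G"
    and m: "exp (real (card (pverts H)) * real r ^ ((2 * r + 9) * (r + 1))) \<le> real (card (pverts G))"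
    and lower: "spectral_radius G \<ge> (1 - 1 / real r) * real (card (pverts G)) - (real r + 1) / real (card (pverts G))"
  shows "\<exists>c. proper_colouring G r c"
proof -
  let ?V = "pverts G" and ?\<rho> = "spectral_radius G"
  define a where "a = 1 - 1 / real r"
  define F where "F = 2 ^ (r + 1) * (12 * r) ^ r"
  define Q where "Q = card (pverts H) * F ^ (r - 1)"
  define n where "n = real (card ?V)"
  note size = threshold_size[OF \<open>r \<ge> 2\<close> colour_critical_card_pos[OF crit] F_def Q_def m]
  have a: "1 / 2 \<le> a" "a < 1" using \<open>r \<ge> 2\<close> by (auto simp: a_def field_simps)
  have V: "finite ?V" by (rule finite_pverts[OF G])
  have FQ: "F * Q * 2 ^ Q \<le> card ?V"
  proof -
    have "1 * (F * Q * 2 ^ Q) \<le> 2 ^ (16 * r * (r + 1)) * (F * Q * 2 ^ Q)" by (intro mult_le_mono1) simp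
    then show ?thesis using size(1) by linarith
  qed
  have "(1152 * r\<^sup>2) * (1152 * r\<^sup>2) * 1 \<le> F * Q * 2 ^ Q"
    using size(2,3) by (intro mult_le_mono) auto
  then have "1152 * r\<^sup>2 * (1152 * r\<^sup>2) \<le> card ?V" using FQ by simp
  then have n_big: "1152 * (real r)\<^sup>2 * (1152 * (real r)\<^sup>2) \<le> n"
    using of_nat_mono[of "1152 * r\<^sup>2 * (1152 * r\<^sup>2)" "card ?V", where 'a = real]
    by (simp only: n_def of_nat_mult of_nat_power of_nat_numeral)
  have r4: "4 \<le> (real r)\<^sup>2" using power_mono[of 2 "real r" 2] \<open>r \<ge> 2\<close> by simp
  have n_r4: "1000000 * (real r) ^ 4 \<le> n"
  proof -
    have "1000000 * (real r) ^ 4 \<le> 1152 * 1152 * (real r) ^ 4" by (intro mult_right_mono) auto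
    also have "\<dots> = 1152 * (real r)\<^sup>2 * (1152 * (real r)\<^sup>2)" by (simp add: power4_eq_xxxx power2_eq_square)
    finally show ?thesis using n_big by (rule order_trans)
  qed
  have rp: "1 \<le> real r" "real r \<le> (real r) ^ 4" "(real r) ^ 2 \<le> (real r) ^ 4" "(real r) ^ 3 \<le> (real r) ^ 4"
    using \<open>r \<ge> 2\<close> power_increasing[of 1 4 "real r"] power_increasing[of 2 4 "real r"] power_increasing[of 3 4 "real r"] by auto
  have n1: "n \<ge> 1000000" using n_r4 rp by linarith
  have ne: "?V \<noteq> {}" using n1 by (auto simp: n_def)
  have upper: "?\<rho> \<le> a * n"
    unfolding a_def n_def using m by (intro spectral_radius_le_of_free[OF \<open>r \<ge> 2\<close> crit G ne free]) simp
  define \<kappa> where "\<kappa> = (real r + 1) / n"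
  have "4 * (real r + 1) \<le> 8 * real r" using rp(1) by simp
  also have "\<dots> \<le> 8 * real r ^ 4" using rp(2) by (rule mult_left_mono) simp
  also have "\<dots> \<le> 1000000 * real r ^ 4" by (rule mult_right_mono) auto
  also note n_r4
  finally have "4 * (real r + 1) \<le> n" .
  then have \<kappa>: "0 \<le> \<kappa>" "4 * \<kappa> \<le> 1" "\<kappa> * n = real r + 1"
    using n1 by (simp_all add: \<kappa>_def divide_le_eq)
  have lower': "a * n - \<kappa> \<le> ?\<rho>" using lower by (simp add: a_def n_def \<kappa>_def)
  have an: "a * n \<ge> n / 2" using mult_right_mono[OF a(1), of n] n1 by simp
  have \<rho>pos: "?\<rho> > 0" using lower' an n1 \<kappa> by linarith
  \<comment> \<open>Chosen so that (1 - z) \<rho> is exactly the spectral bound for n - 1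
    vertices.\<close>
  define z where "z = 1 - a * (n - 1) / ?\<rho>"
  have z\<rho>: "z * ?\<rho> = ?\<rho> - a * (n - 1)" using \<rho>pos by (simp add: z_def left_diff_distrib)
  have z\<rho>_ge: "a - \<kappa> \<le> z * ?\<rho>" 
  proof -
    have "a * (n - 1) = a * n - a" by (simp add: right_diff_distrib)
    then show ?thesis unfolding z\<rho> using lower' by linarith
  qed
  have ak: "1 / 4 \<le> a - \<kappa>" using a \<kappa> by linarith
  have "0 < z * ?\<rho>" using z\<rho>_ge ak by linarith
  then have z0: "z > 0" using \<rho>pos by (simp add: zero_less_mult_iff)
  have "1 / z = ?\<rho> / (z * ?\<rho>)" using \<rho>pos by simp
  also have "\<dots> \<le> a * n / (a - \<kappa>)" using upper z\<rho>_ge ak a n1 by (intro frac_le) auto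
  also have "\<dots> \<le> n + 4 * (real r + 1)"
  proof -
    have "\<kappa> * n \<le> 4 * (a - \<kappa>) * (real r + 1)"
      using mult_right_mono[of 1 "4 * (a - \<kappa>)" "real r + 1"] ak \<kappa>(3) by simp
    then have "a * n \<le> (n + 4 * (real r + 1)) * (a - \<kappa>)" by (simp add: algebra_simps)
    then show ?thesis using ak by (simp add: divide_le_eq)
  qed
  finally have inv_z: "1 / z \<le> n + 4 * (real r + 1)" .
  have nn: "real (card (non_nbrs (parcs G) ?V w)) \<le> n / real r + 4 * real r + 6" if w: "w \<in> ?V" for w
  proof -
    define d where "d = real (card {v. (w, v) \<in> parcs G})"
    have "?\<rho>\<^sup>2 \<le> d * (d + 1 / z + 1 - real (card ?V))"
    proof (rule degree_bound_of_vertex_deletion[OF G _ \<rho>pos z0 _ w d_def])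
      show "2 \<le> card ?V" using n1 by (simp add: n_def)
      fix u assume u: "u \<in> ?V"
      have c: "card (?V - {u}) + 1 = card ?V" using u V n1 by (simp add: n_def card_Diff_singleton)
      then have cr: "real (card (?V - {u})) = n - 1" by (simp add: n_def flip: c)
      have "spectral_radius (induced G (?V - {u})) \<le> a * real (card (pverts (induced G (?V - {u}))))"
        unfolding a_def
      proof (rule spectral_radius_le_of_free[OF \<open>r \<ge> 2\<close> crit])
        show "pair_graph (induced G (?V - {u}))" using G by (rule pair_graph_induced) auto
        show "pverts (induced G (?V - {u})) \<noteq> {}"
        proof
          assume "pverts (induced G (?V - {u})) = {}"
          then have "real (card (?V - {u})) = 0" by (simp only: induced_simps card.empty of_nat_0)
          then show False using cr n1 by linarith
        qed
        show "free_of H (induced G (?V - {u}))"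
          using crit by (intro free_of_induced[OF _ G _ free]) (auto simp: colour_critical_def)
        show "exp (real (card (pverts H)) * real r ^ ((2 * r + 9) * (r + 1)))
            \<le> real (card (pverts (induced G (?V - {u}))) + 1)" using m c by simp
      qed
      also have "\<dots> = (1 - z) * ?\<rho>" using z\<rho> cr by (simp add: left_diff_distrib)
      finally show "spectral_radius (induced G (?V - {u})) \<le> (1 - z) * ?\<rho>" .
    qed
    also have "\<dots> \<le> d * (d + (4 * real r + 5))"
      using inv_z by (intro mult_left_mono) (auto simp: d_def n_def)
    finally have sq: "?\<rho>\<^sup>2 \<le> d * (d + (4 * real r + 5))" .
    have "?\<rho> - (4 * real r + 5) \<le> d"
    proof (rule ccontr)
      assume "\<not> ?thesis"
      then have "d + (4 * real r + 5) < ?\<rho>" by simp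
      moreover from this have "d < ?\<rho>" by simp
      ultimately have "d * (d + (4 * real r + 5)) < ?\<rho> * ?\<rho>" by (intro mult_strict_mono) (auto simp: d_def \<rho>pos)
      then show False using sq by (simp add: power2_eq_square)
    qed
    then have "a * n - \<kappa> - (4 * real r + 5) \<le> d" using lower' by simp
    then show ?thesis using non_nbrs_card[OF G w] \<kappa> by (simp add: n_def a_def d_def algebra_simps)
  qed
  have bound1: "r * card (non_nbrs (parcs G) ?V w) \<le> card ?V + r * (4 * r + 6)" if "w \<in> ?V" for w
  proof -
    have "real r * real (card (non_nbrs (parcs G) ?V w)) \<le> real r * (n / real r + 4 * real r + 6)"
      using nn[OF that] by (intro mult_left_mono) auto
    also have "\<dots> = real (card ?V + r * (4 * r + 6))" using \<open>r \<ge> 2\<close> by (simp add: n_def algebra_simps)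
    finally have "real (r * card (non_nbrs (parcs G) ?V w)) \<le> real (card ?V + r * (4 * r + 6))" by simp
    then show ?thesis by (rule of_nat_le_iff[THEN iffD1])
  qed
  have bound2: "4 * r * (r + 1) * card (non_nbrs (parcs G) ?V w) \<le> (4 * r + 5) * card ?V" if w: "w \<in> ?V" for w
  proof -
    have "4 * (r + 1) * (r * card (non_nbrs (parcs G) ?V w)) \<le> 4 * (r + 1) * (card ?V + r * (4 * r + 6))"
      using bound1[OF w] by (rule mult_le_mono2)
    moreover have "4 * (r + 1) * (r * (4 * r + 6)) \<le> card ?V"
    proof -
      have "real (4 * (r + 1) * (r * (4 * r + 6))) = 16 * real r ^ 3 + 40 * real r ^ 2 + 24 * real r"
        by (simp add: power3_eq_cube power2_eq_square algebra_simps)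
      also have "\<dots> \<le> n" using n_r4 rp by linarith
      finally show ?thesis by (simp only: n_def of_nat_le_iff)
    qed
    ultimately show ?thesis by (simp add: algebra_simps)
  qed
  have "10 * r * r * (r * (4 * r + 6)) + 8 * r < card ?V"
  proof -
    have "real (10 * r * r * (r * (4 * r + 6)) + 8 * r) = 40 * real r ^ 4 + 60 * real r ^ 3 + 8 * real r"
      by (simp add: power4_eq_xxxx power3_eq_cube algebra_simps)
    also have "\<dots> < n" using n_r4 rp by linarith
    finally show ?thesis by (simp only: n_def of_nat_less_iff)
  qed
  moreover have "card K \<noteq> r + 1" if "K \<subseteq> ?V" "is_clique (parcs G) K" for K
    using contains_critical_of_clique[OF \<open>r \<ge> 2\<close> crit G bound2 that(1) _ that(2) F_def Q_def FQ] free by blast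
  ultimately show ?thesis
    using bound1 by (intro colouring_of_sparse_complement[OF G \<open>r \<ge> 2\<close>]) auto
qed

section \<open>Sign parts of second eigenvectors\<close>

lemma graph_bilinear_arcs:
  assumes "pair_graph G"
  shows "inner_on (pverts G) p (graph_op G q) = (\<Sum>(u, v)\<in>parcs G. p u * q v)"
proof -
  have fin: "finite (pverts G)" using finite_pverts[OF assms] .
  have "inner_on (pverts G) p (graph_op G q) = (\<Sum>u\<in>pverts G. \<Sum>v\<in>pverts G. if (u, v) \<in> parcs G then p u * q v else 0)"
    by (auto simp: inner_on_def kernel_op_def adj_def sum_distrib_left intro!: sum.cong)
  also have "\<dots> = (\<Sum>(u, v)\<in>pverts G \<times> pverts G. if (u, v) \<in> parcs G then p u * q v else 0)"
    by (simp add: sum.cartesian_product)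
  also have "\<dots> = (\<Sum>(u, v)\<in>parcs G. p u * q v)"
    using assms fin by (intro sum.mono_neutral_cong_right) (auto simp: pair_graph_iff)
  finally show ?thesis .
qed

text \<open>For orthonormal \<open>p\<close> and \<open>q\<close> the cross term is at most 2 |s t|
  \<delta>, hence at most \<delta> (s^2 + t^2).\<close>

lemma second_eigenvalue_ge_two_parts:
  assumes G: "pair_graph G" "card (pverts G) \<ge> 2"
    and p: "sq_norm (pverts G) p = 1" "graph_form G p \<ge> \<mu>"
    and q: "sq_norm (pverts G) q = 1" "graph_form G q \<ge> \<mu>"
    and orth: "inner_on (pverts G) p q = 0"
    and c: "\<bar>inner_on (pverts G) p (graph_op G q)\<bar> \<le> \<delta>"
  shows "eigval 2 G \<ge> \<mu> - \<delta>"
proof (rule second_eigenvalue_ge[OF G])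
  fix s t :: real assume st: "(s, t) \<noteq> (0, 0)"
  have norm: "sq_norm (pverts G) (\<lambda>v. s * p v + t * q v) = s\<^sup>2 + t\<^sup>2"
    using p q orth by (simp add: inner_on_add_square)
  then show "sq_norm (pverts G) (\<lambda>v. s * p v + t * q v) > 0"
    using st by (simp add: sum_power2_gt_zero_iff)
  let ?c = "inner_on (pverts G) p (graph_op G q)"
  have "graph_form G (\<lambda>v. s * p v + t * q v) = s\<^sup>2 * graph_form G p + 2 * s * t * ?c + t\<^sup>2 * graph_form G q"
    using quad_form_add[of "pverts G" "adj G" s p t q] adj_sym[OF G(1)] by blast
  moreover have "s\<^sup>2 * \<mu> \<le> s\<^sup>2 * graph_form G p" "t\<^sup>2 * \<mu> \<le> t\<^sup>2 * graph_form G q"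
    using p q by (auto intro!: mult_left_mono)
  moreover have "- (\<delta> * (s\<^sup>2 + t\<^sup>2)) \<le> 2 * s * t * ?c"
  proof -
    have "\<bar>2 * s * t\<bar> \<le> s\<^sup>2 + t\<^sup>2"
      using sum_squares_bound[of s t] sum_squares_bound[of s "- t"] by (simp add: abs_le_iff)
    then have "\<bar>2 * s * t\<bar> * \<bar>?c\<bar> \<le> (s\<^sup>2 + t\<^sup>2) * \<delta>" using c by (intro mult_mono) auto
    then have "\<bar>2 * s * t * ?c\<bar> \<le> \<delta> * (s\<^sup>2 + t\<^sup>2)" by (simp add: abs_mult mult.commute)
    then show ?thesis by linarith
  qed
  ultimately show "graph_form G (\<lambda>v. s * p v + t * q v)
      \<ge> (\<mu> - \<delta>) * sq_norm (pverts G) (\<lambda>v. s * p v + t * q v)"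
    unfolding norm by (simp add: algebra_simps)
qed

lemma graph_connected_cut:
  assumes "pair_graph G" "graph_connected G" "S \<subseteq> pverts G" "S \<noteq> {}" "S \<noteq> pverts G"
  shows "\<exists>u\<in>S. \<exists>v\<in>pverts G - S. (u, v) \<in> parcs G"
proof -
  have "\<forall>S. S \<subseteq> pverts G \<and> S \<noteq> {} \<and> S \<noteq> pverts G \<longrightarrow> (\<exists>u\<in>S. \<exists>v\<in>pverts G - S. (u, v) \<in> parcs G)"
    using assms(2) unfolding graph_connected_iff[OF assms(1)] by (rule conjunct2)
  from spec[OF this, of S] show ?thesis using assms(3-5) by simp
qed

text \<open>At a zero of a non-negative eigenvector the values of the neighbours sum to 0, so no arc
  leaves the zero set.\<close>

lemma connected_eigenvector_pos:
  assumes G: "pair_graph G" and conn: "graph_connected G"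
    and x: "\<forall>v. x v \<ge> 0" "\<forall>v\<in>pverts G. graph_op G x v = \<mu> * x v" and u: "u \<in> pverts G" "x u > 0"
    and v: "v \<in> pverts G"
  shows "x v > 0"
proof (rule ccontr)
  assume "\<not> x v > 0"
  define Z where "Z = {w \<in> pverts G. x w = 0}"
  have "v \<in> Z" using \<open>\<not> x v > 0\<close> x(1) v by (auto simp: Z_def less_le)
  moreover have "u \<notin> Z" using u by (simp add: Z_def)
  ultimately have "Z \<noteq> {}" "Z \<noteq> pverts G" using u by auto
  moreover have "Z \<subseteq> pverts G" by (auto simp: Z_def)
  ultimately have "\<exists>a\<in>Z. \<exists>b\<in>pverts G - Z. (a, b) \<in> parcs G"
    by (intro graph_connected_cut[OF G conn])
  then obtain a b where ab: "a \<in> Z" "b \<in> pverts G" "b \<notin> Z" "(a, b) \<in> parcs G" by blast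
  have "0 = graph_op G x a" using ab(1) x(2) by (simp add: Z_def)
  also have "\<dots> = (\<Sum>w | (a, w) \<in> parcs G. x w)" by (rule graph_op_eq[OF G])
  also have "\<dots> \<ge> x b"
  proof -
    have "finite {w. (a, w) \<in> parcs G}"
      using parcs_in_pverts[OF G] by (auto intro: finite_subset[OF _ finite_pverts[OF G]])
    then show ?thesis using ab(4) x(1) by (intro member_le_sum) auto
  qed
  finally have "x b \<le> 0" .
  then show False using ab x(1) by (auto simp: Z_def intro: antisym)
qed

text \<open>The top eigenvector \<open>y\<close> comes with unknown signs. Its absolute value is
  also a maximizer, hence positive by connectivity. Equality of the two forms then holds arc by arc,
  so \<open>y\<close> keeps its sign along arcs and has constant sign, and a non-zero vector
  orthogonal to it takes both signs.\<close>

lemma second_eigenvector_signs: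
  assumes G: "pair_graph G" and n: "card (pverts G) \<ge> 2" and conn: "graph_connected G"
  obtains x where "\<forall>v\<in>pverts G. graph_op G x v = eigval 2 G * x v"
    "\<exists>v\<in>pverts G. x v > 0" "\<exists>v\<in>pverts G. x v < 0"
proof -
  let ?V = "pverts G"
  have V: "finite ?V" by (rule finite_pverts[OF G])
  have ne: "?V \<noteq> {}" using n by auto
  obtain x y where xy: "sq_norm ?V x = 1" "sq_norm ?V y = 1" "inner_on ?V x y = 0"
    "\<forall>v\<in>?V. graph_op G y v = spectral_radius G * y v"
    "\<forall>v\<in>?V. graph_op G x v = eigval 2 G * x v"
    by (rule second_eigenvector[OF G n])
  define z where "z v = \<bar>y v\<bar>" for v
  have norm_z: "sq_norm ?V z = 1" using xy(2) by (simp add: z_def[abs_def] sq_norm_abs)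
  have "graph_form G y = inner_on ?V y (\<lambda>v. spectral_radius G * y v)" using xy(4) by (intro inner_on_cong) auto
  then have form_y: "graph_form G y = spectral_radius G" using xy(2) by (simp add: inner_on_scale)
  have "graph_form G y \<le> graph_form G z" unfolding z_def[abs_def] by (rule graph_form_mono_abs)
  moreover have "graph_form G z \<le> spectral_radius G" using graph_form_le[OF G ne, of z] norm_z by simp
  ultimately have form_z: "graph_form G z = spectral_radius G" using form_y by simp
  have op_z: "\<forall>v\<in>?V. graph_op G z v = spectral_radius G * z v"
    using maximal_imp_eigenvector[OF G ne, of z] form_z norm_z by simp
  obtain u where u: "u \<in> ?V" "z u > 0"
  proof -
    have "\<not> (\<forall>v\<in>?V. z v = 0)" using norm_z inner_on_self_eq_0_iff[OF V, of z] by simp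
    then show thesis using that by (auto simp: z_def)
  qed
  have z_pos: "z v > 0" if "v \<in> ?V" for v
    by (rule connected_eigenvector_pos[OF G conn _ op_z u that]) (simp add: z_def)
  have "(\<Sum>(a, b)\<in>parcs G. z a * z b - y a * y b) = 0"
    using form_y form_z by (simp add: graph_form_arcs[OF G] case_prod_beta sum_subtractf)
  then have same: "z a * z b = y a * y b" if "(a, b) \<in> parcs G" for a b
  proof -
    have "\<forall>e\<in>parcs G. (case e of (a, b) \<Rightarrow> z a * z b - y a * y b) = 0"
      using \<open>(\<Sum>(a, b)\<in>parcs G. z a * z b - y a * y b) = 0\<close> finite_parcs[OF G]
      by (subst (asm) sum_nonneg_eq_0_iff) (auto simp: z_def abs_mult[symmetric])
    then show ?thesis using that by force
  qed
  define Y where "Y = {v \<in> ?V. y v > 0}"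
  have no_cut: "\<not> (\<exists>a\<in>Y. \<exists>b\<in>?V - Y. (a, b) \<in> parcs G)"
  proof
    assume "\<exists>a\<in>Y. \<exists>b\<in>?V - Y. (a, b) \<in> parcs G"
    then obtain a b where ab: "a \<in> ?V" "y a > 0" "b \<in> ?V" "\<not> y b > 0" "(a, b) \<in> parcs G" by (auto simp: Y_def)
    have "0 < z a * z b" using z_pos ab by simp
    then have "0 < y a * y b" using same[OF ab(5)] by simp
    then show False using ab by (simp add: zero_less_mult_iff)
  qed
  moreover have "Y \<subseteq> ?V" by (auto simp: Y_def)
  ultimately have "Y = {} \<or> Y = ?V" using graph_connected_cut[OF G conn, of Y] by blast
  then have sgn: "(\<forall>v\<in>?V. y v < 0) \<or> (\<forall>v\<in>?V. y v > 0)"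
  proof
    assume "Y = {}"
    have "y v < 0" if "v \<in> ?V" for v
    proof -
      have "\<not> y v > 0" using \<open>Y = {}\<close> that by (auto simp: Y_def)
      then show ?thesis using z_pos[OF that] by (auto simp: z_def)
    qed
    then show ?thesis by blast
  qed (auto simp: Y_def)
  have xn0: "\<exists>v\<in>?V. x v \<noteq> 0" using xy(1) inner_on_self_eq_0_iff[OF V, of x] by auto
  have key: False if "\<forall>v\<in>?V. 0 \<le> \<sigma> * (x v * y v)" "\<sigma> \<noteq> 0" for \<sigma> :: real
  proof -
    have "(\<Sum>v\<in>?V. \<sigma> * (x v * y v)) = 0" using xy(3) by (simp add: inner_on_def flip: sum_distrib_left)
    then have "\<forall>v\<in>?V. \<sigma> * (x v * y v) = 0" using that(1) V by (subst (asm) sum_nonneg_eq_0_iff) auto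
    moreover have "y v \<noteq> 0" if "v \<in> ?V" for v using z_pos[OF that] by (auto simp: z_def)
    ultimately show False using xn0 that(2) by auto
  qed
  have "\<exists>v\<in>?V. x v > 0"
  proof (rule ccontr)
    assume "\<not> ?thesis"
    then have neg: "\<forall>v\<in>?V. x v \<le> 0" by force
    from sgn show False
    proof
      assume "\<forall>v\<in>?V. y v < 0"
      then show False using neg by (intro key[of 1]) (auto intro!: mult_nonpos_nonpos simp: less_imp_le)
    next
      assume "\<forall>v\<in>?V. y v > 0"
      then show False using neg by (intro key[of "- 1"]) (auto intro!: mult_nonpos_nonneg simp: less_imp_le)
    qed
  qed
  moreover have "\<exists>v\<in>?V. x v < 0"
  proof (rule ccontr)
    assume "\<not> ?thesis"
    then have pos: "\<forall>v\<in>?V. x v \<ge> 0" by force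
    from sgn show False
    proof
      assume "\<forall>v\<in>?V. y v < 0"
      then show False using pos by (intro key[of "- 1"]) (auto intro!: mult_nonneg_nonpos simp: less_imp_le)
    next
      assume "\<forall>v\<in>?V. y v > 0"
      then show False using pos by (intro key[of 1]) (auto intro!: mult_nonneg_nonneg simp: less_imp_le)
    qed
  qed
  ultimately show thesis using that xy(5) by blast
qed

text \<open>Neighbours outside \<open>C\<close> contribute non-positive values, so on
  \<open>C\<close> the induced operator maps \<open>x\<close> to at least \<mu> x. The set
  \<open>C\<close> may be a whole sign part or a union of components of it; the second case serves
  to prove sign parts connected.\<close>

lemma sign_component_bound:
  assumes G: "pair_graph G" and ev: "\<forall>v\<in>pverts G. graph_op G x v = \<mu> * x v"
    and C: "C \<subseteq> pverts G" "C \<noteq> {}" "\<forall>v\<in>C. x v > 0"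
    and sep: "\<forall>v\<in>C. \<forall>w\<in>pverts G - C. x w > 0 \<longrightarrow> (v, w) \<notin> parcs G"
  shows "\<mu> * sq_norm C x \<le> graph_form (induced G C) x" "0 < sq_norm C x"
    "\<mu> \<le> spectral_radius (induced G C)"
proof -
  let ?V = "pverts G"
  have V: "finite ?V" by (rule finite_pverts[OF G])
  have finC: "finite C" using C(1) V finite_subset by blast
  have iC: "pair_graph (induced G C)" by (rule pair_graph_induced[OF G C(1)])
  have nb_fin: "finite {w. (v, w) \<in> parcs G}" for v
    using parcs_in_pverts[OF G] by (auto intro: finite_subset[OF _ V])
  have op: "\<mu> * x v \<le> graph_op (induced G C) x v" if v: "v \<in> C" for v
  proof -
    have "\<mu> * x v = (\<Sum>w | (v, w) \<in> parcs G. x w)" using ev v C(1) graph_op_eq[OF G, of x v] by auto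
    also have "\<dots> \<le> (\<Sum>w | (v, w) \<in> parcs G. if w \<in> C then x w else 0)"
    proof (rule sum_mono)
      fix w assume "w \<in> {w. (v, w) \<in> parcs G}"
      then have vw: "(v, w) \<in> parcs G" "w \<in> ?V" using parcs_in_pverts[OF G] by auto
      show "x w \<le> (if w \<in> C then x w else 0)"
        using sep v vw by (auto simp: not_less[symmetric])
    qed
    also have "\<dots> = (\<Sum>w | (v, w) \<in> parcs (induced G C). x w)"
      using nb_fin[of v] v by (intro sum.mono_neutral_cong_right) auto
    also have "\<dots> = graph_op (induced G C) x v" by (rule graph_op_eq[OF iC, symmetric])
    finally show ?thesis .
  qed
  have "\<mu> * sq_norm C x = (\<Sum>v\<in>C. x v * (\<mu> * x v))" by (simp add: inner_on_def sum_distrib_left mult_ac)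
  also have "\<dots> \<le> (\<Sum>v\<in>C. x v * graph_op (induced G C) x v)"
    using op C(3) by (intro sum_mono mult_left_mono) auto
  finally show 1: "\<mu> * sq_norm C x \<le> graph_form (induced G C) x" by (simp add: inner_on_def)
  have "\<not> (\<forall>v\<in>C. x v = 0)" using C(2,3) by fastforce
  then show 2: "0 < sq_norm C x"
    using inner_on_self_eq_0_iff[OF finC, of x] inner_on_self_nonneg[of C x] by (simp add: less_le)
  have "graph_form (induced G C) x \<le> spectral_radius (induced G C) * sq_norm C x"
    using graph_form_le[OF iC, of x] C(2) by simp
  then have "\<mu> * sq_norm C x \<le> spectral_radius (induced G C) * sq_norm C x" using 1 by simp
  then show "\<mu> \<le> spectral_radius (induced G C)" using 2 by simp
qed

lemma spectral_radius_induced_mono: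
  assumes "pair_graph G" "S \<subseteq> T" "T \<subseteq> pverts G" "S \<noteq> {}"
  shows "spectral_radius (induced G S) \<le> spectral_radius (induced G T)"
  using assms by (intro spectral_radius_embeds[OF _ _ _ embeds_induced] pair_graph_induced) auto

text \<open>The graphs in question are infinite in number, but each is isomorphic to one on {..<n}.
  Finiteness is what gives meaning to the \<open>Max\<close> in
  \<open>max_spectral_radius\<close>.\<close>

lemma free_spectral_radii_finite:
  assumes "n \<ge> 1"
  shows "finite {spectral_radius G | G :: nat pair_pre_digraph. pair_graph G \<and> card (pverts G) = n \<and> free_of H G}"
    (is "finite ?R")
proof -
  let ?A = "(\<lambda>E. \<lparr>pverts = {..<n}, parcs = E\<rparr>) ` Pow ({..<n} \<times> {..<n})"
  have "?R \<subseteq> spectral_radius ` ?A"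
  proof
    fix \<rho> assume "\<rho> \<in> ?R"
    then obtain G :: "nat pair_pre_digraph" where G: "pair_graph G" "card (pverts G) = n" "\<rho> = spectral_radius G" by blast
    obtain K :: "nat pair_pre_digraph" and f where K: "pair_graph K" "graph_bij f G K" "pverts K = {..<n}"
      using nat_graph_copy[OF G(1)] G(2) by metis
    have "pverts G \<noteq> {}" using G(2) assms by auto
    then have "\<rho> = spectral_radius K" using spectral_radius_graph_bij[OF G(1) K(1) _ K(2)] G(3) by simp
    moreover have "K = \<lparr>pverts = {..<n}, parcs = parcs K\<rparr>" using K(3) by (cases K) simp
    moreover have "parcs K \<subseteq> {..<n} \<times> {..<n}" using K(1,3) by (simp add: pair_graph_iff)
    ultimately show "\<rho> \<in> spectral_radius ` ?A" by blast
  qed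
  then show ?thesis by (rule finite_subset) simp
qed

lemma spectral_radius_le_max:
  assumes H: "pair_graph H" and G: "pair_graph G" "pverts G \<noteq> {}" "free_of H G"
  shows "spectral_radius G \<le> max_spectral_radius (card (pverts G)) H"
proof -
  obtain K :: "nat pair_pre_digraph" and f where K: "pair_graph K" "graph_bij f G K"
    using nat_graph_copy[OF G(1)] by metis
  have "free_of H K"
    using contains_copy_embeds[OF H K(1) G(1) graph_bij_embeds[OF K(1) graph_bij_sym[OF K(2)]]] G(3) by blast
  moreover have "card (pverts K) = card (pverts G)" using graph_bij_card[OF K(2)] by simp
  moreover have "spectral_radius G = spectral_radius K" by (rule spectral_radius_graph_bij[OF G(1) K(1) G(2) K(2)])
  moreover have "card (pverts G) \<ge> 1" using G finite_pverts by (simp add: Suc_le_eq card_gt_0_iff)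
  ultimately show ?thesis
    unfolding max_spectral_radius_def using K(1) by (intro Max_ge free_spectral_radii_finite) auto
qed

lemma spectral_radius_eq_max_imp_turan:
  assumes H: "pair_graph H" and thr: "nikiforov_threshold r H N" and G: "pair_graph G" "pverts G \<noteq> {}" "free_of H G"
    and n: "card (pverts G) = n" "n \<ge> N"
    and eq: "spectral_radius G = max_spectral_radius n H"
  shows "\<exists>f. graph_bij f G (turan_graph n r)"
proof -
  obtain K :: "nat pair_pre_digraph" and f where K: "pair_graph K" "graph_bij f G K"
    using nat_graph_copy[OF G(1)] by metis
  have "free_of H K"
    using contains_copy_embeds[OF H K(1) G(1) graph_bij_embeds[OF K(1) graph_bij_sym[OF K(2)]]] G(3) by blast
  moreover have "card (pverts K) = n" using graph_bij_card[OF K(2)] n by simp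
  moreover have "spectral_radius K = max_spectral_radius n H"
    using spectral_radius_graph_bij[OF G(1) K(1) G(2) K(2)] eq by simp
  ultimately have "K \<cong>\<^sub>G turan_graph n r" using thr K(1) n(2) unfolding nikiforov_threshold_def by blast
  then obtain g where "graph_bij g K (turan_graph n r)"
    using pair_graph_iso_iff[OF K(1) pair_graph_turan_graph] by blast
  then show ?thesis using graph_bij_trans[OF K(2)] by blast
qed

lemma connected_two_parts:
  assumes G: "pair_graph G" and V: "pverts G = A \<union> B"
    and A: "graph_connected (induced G A)" and B: "graph_connected (induced G B)"
    and e: "a \<in> A" "b \<in> B" "(a, b) \<in> parcs G"
  shows "graph_connected G"
proof -
  have iA: "pair_graph (induced G A)" "pair_graph (induced G B)" using G V by (auto intro: pair_graph_induced)
  show ?thesis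
    unfolding graph_connected_iff[OF G]
  proof (intro conjI allI impI)
    show "pverts G \<noteq> {}" using V e by auto
    fix S assume S: "S \<subseteq> pverts G \<and> S \<noteq> {} \<and> S \<noteq> pverts G"
    have part: "\<exists>u\<in>S. \<exists>v\<in>pverts G - S. (u, v) \<in> parcs G"
      if "pair_graph (induced G X)" "graph_connected (induced G X)" "X \<subseteq> pverts G" "S \<inter> X \<noteq> {}" "S \<inter> X \<noteq> X" for X
    proof -
      have "\<exists>u\<in>S \<inter> X. \<exists>v\<in>X - S \<inter> X. (u, v) \<in> parcs (induced G X)"
        using that unfolding graph_connected_iff[OF that(1)] by (metis Int_lower2 induced_simps(1))
      then show ?thesis using that(3) by auto
    qed
    show "\<exists>u\<in>S. \<exists>v\<in>pverts G - S. (u, v) \<in> parcs G"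
    proof (cases "(S \<inter> A \<noteq> {} \<and> S \<inter> A \<noteq> A) \<or> (S \<inter> B \<noteq> {} \<and> S \<inter> B \<noteq> B)")
      case True
      then show ?thesis using part[OF iA(1) A] part[OF iA(2) B] V by blast
    next
      case False
      then consider "a \<in> S" "b \<notin> S" | "a \<notin> S" "b \<in> S" using S V e by blast
      then show ?thesis
      proof cases
        case 1
        then show ?thesis using e V by blast
      next
        case 2
        then show ?thesis using e V parcs_sym[OF G e(3)] by blast
      qed
    qed
  qed
qed

lemma connected_add_edge:
  assumes G: "pair_graph G" "graph_connected G" and uv: "u \<in> pverts G" "v \<in> pverts G" "u \<noteq> v"
  shows "graph_connected (add_edge G u v)"
  unfolding graph_connected_iff[OF pair_graph_add_edge[OF G(1) uv]]
proof (intro conjI allI impI)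
  have eq: "pverts (add_edge G u v) = pverts G" by (simp add: add_edge_def)
  show "pverts (add_edge G u v) \<noteq> {}" using uv eq by auto
  fix S assume "S \<subseteq> pverts (add_edge G u v) \<and> S \<noteq> {} \<and> S \<noteq> pverts (add_edge G u v)"
  then have "\<exists>u\<in>S. \<exists>v\<in>pverts G - S. (u, v) \<in> parcs G"
    unfolding eq by (intro graph_connected_cut[OF G]) auto
  then show "\<exists>a\<in>S. \<exists>b\<in>pverts (add_edge G u v) - S. (a, b) \<in> parcs (add_edge G u v)"
    unfolding eq by (auto simp: add_edge_def)
qed

lemma connected_free_graph_transfer:
  assumes H: "pair_graph H" and G: "connected_free_graph H n G" and n: "n \<ge> 2"
  obtains K :: "nat pair_pre_digraph" where "connected_free_graph H n K" "eigval 2 K = eigval 2 G"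
proof -
  have pg: "pair_graph G" and card: "card (pverts G) = n" and conn: "graph_connected G" and free: "free_of H G"
    using G by (auto simp: connected_free_graph_def)
  obtain K :: "nat pair_pre_digraph" and f where K: "pair_graph K" "graph_bij f G K"
    using nat_graph_copy[OF pg] by metis
  have "free_of H K"
    using contains_copy_embeds[OF H K(1) pg graph_bij_embeds[OF K(1) graph_bij_sym[OF K(2)]]] free by blast
  moreover have "card (pverts K) = n" using graph_bij_card[OF K(2)] card by simp
  moreover have "graph_connected K" by (rule graph_connected_graph_bij[OF pg K conn])
  moreover have "eigval 2 K = eigval 2 G" using second_eigenvalue_graph_bij[OF pg K(1) _ K(2)] n card by simp
  ultimately show thesis using that[of K] K(1) by (simp add: connected_free_graph_def)
qed

text \<open>Maximizers are compared with graphs on natural numbers by definition; the competitors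
  built later live on a sum type or on the vertex type of \<open>G\<close>.\<close>

lemma maximizes_second_eigenvalue_ge:
  assumes H: "pair_graph H" and G: "maximizes_second_eigenvalue H n G" and K: "connected_free_graph H n K" and n: "n \<ge> 2"
  shows "eigval 2 K \<le> eigval 2 G"
proof -
  obtain L :: "nat pair_pre_digraph" where "connected_free_graph H n L" "eigval 2 L = eigval 2 K"
    by (rule connected_free_graph_transfer[OF H K n])
  then show ?thesis using G unfolding maximizes_second_eigenvalue_def by metis
qed

section \<open>Turan graphs\<close>

lemma turan_graph_simps [simp]: "pverts (turan_graph n k) = {..<n}"
  "(i, j) \<in> parcs (turan_graph n k) \<longleftrightarrow> i < n \<and> j < n \<and> i mod k \<noteq> j mod k"
  by (auto simp: turan_graph_def)

lemma turan_graph_connected: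
  assumes "k \<ge> 2" "n \<ge> 2"
  shows "graph_connected (turan_graph n k)"
  unfolding graph_connected_iff[OF pair_graph_turan_graph]
proof (intro conjI allI impI)
  show "pverts (turan_graph n k) \<noteq> {}" using assms by (auto simp: lessThan_empty_iff)
  fix S assume S: "S \<subseteq> pverts (turan_graph n k) \<and> S \<noteq> {} \<and> S \<noteq> pverts (turan_graph n k)"
  show "\<exists>u\<in>S. \<exists>v\<in>pverts (turan_graph n k) - S. (u, v) \<in> parcs (turan_graph n k)"
  proof (rule ccontr)
    assume "\<not> ?thesis"
    then have no: "u mod k = v mod k" if "u \<in> S" "v < n" "v \<notin> S" for u v using that S by auto
    obtain u v where uv: "u \<in> S" "v < n" "v \<notin> S" using S by auto
    have "w mod k = u mod k" if "w < n" for w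
      using no[OF uv(1) that] no[OF _ uv(2,3), of w] no[OF uv] by (cases "w \<in> S") auto
    from this[of 0] this[of 1] show False using assms by simp
  qed
qed

text \<open>With n = k q + b, the pairs inside residue classes number k q^2 + b (2 q + 1). As n^2
  \<ge> k (k q^2 + 2 b q) and b < k, this is at most n^2 / k + k.\<close>

lemma turan_graph_arcs_ge:
  assumes "k \<ge> 1"
  shows "(1 - 1 / real k) * (real n)\<^sup>2 - real k \<le> real (card (parcs (turan_graph n k)))"
proof -
  let ?T = "turan_graph n k"
  let ?A = "\<lambda>p. {i \<in> pverts ?T. i mod k = p}"
  define q where "q = n div k"
  define b where "b = n mod k"
  have bk: "b < k" using assms by (simp add: b_def)
  have n: "real n = real k * real q + real b"
    unfolding q_def b_def by (metis mult_div_mod_eq of_nat_add of_nat_mult)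
  have "{..<n} \<times> {..<n} \<subseteq> parcs ?T \<union> (\<Union>p<k. ?A p \<times> ?A p)"
    using assms by (auto simp: turan_graph_def)
  then have "card ({..<n} \<times> {..<n}) \<le> card (parcs ?T \<union> (\<Union>p<k. ?A p \<times> ?A p))"
    using finite_parcs[OF pair_graph_turan_graph] by (intro card_mono) auto
  also have "\<dots> \<le> card (parcs ?T) + card (\<Union>p<k. ?A p \<times> ?A p)" by (rule card_Un_le)
  also have "card (\<Union>p<k. ?A p \<times> ?A p) \<le> (\<Sum>p<k. card (?A p \<times> ?A p))" by (rule card_UN_le) simp
  also have "(\<Sum>p<k. card (?A p \<times> ?A p)) = (\<Sum>p<k. q * q + (if p < b then 2 * q + 1 else 0))"
  proof (rule sum.cong[OF refl])
    fix p assume "p \<in> {..<k}"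
    then have "card (?A p) = q + (if p < b then 1 else 0)" unfolding q_def b_def by (intro turan_part_card) simp
    then show "card (?A p \<times> ?A p) = q * q + (if p < b then 2 * q + 1 else 0)"
      unfolding card_cartesian_product by simp
  qed
  also have "\<dots> = k * (q * q) + b * (2 * q + 1)"
  proof -
    have "{..<k} \<inter> {p. p < b} = {..<b}" using bk by auto
    then show ?thesis by (simp add: sum.distrib sum.If_cases)
  qed
  finally have "n * n \<le> card (parcs ?T) + (k * (q * q) + b * (2 * q + 1))" by simp
  then have "real (n * n) \<le> real (card (parcs ?T) + (k * (q * q) + b * (2 * q + 1)))" by (rule of_nat_mono)
  then have "(real n)\<^sup>2 \<le> real (card (parcs ?T)) + (real k * (real q)\<^sup>2 + real b * (2 * real q + 1))"
    by (simp add: power2_eq_square algebra_simps)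
  moreover have "real k * (real q)\<^sup>2 + 2 * real b * real q \<le> (real n)\<^sup>2 / real k"
  proof -
    have "(real k * (real q)\<^sup>2 + 2 * real b * real q) * real k \<le> (real n)\<^sup>2"
      unfolding n by (simp add: power2_eq_square algebra_simps)
    then show ?thesis using assms by (simp add: le_divide_eq)
  qed
  moreover have "real b \<le> real k" using bk by simp
  ultimately show ?thesis by (simp add: algebra_simps)
qed

text \<open>The constant test vector bounds the spectral radius from below by the average
  degree.\<close>

lemma turan_graph_spectral_radius_ge:
  assumes "k \<ge> 1" "n \<ge> 1"
  shows "(1 - 1 / real k) * real n - real k / real n \<le> spectral_radius (turan_graph n k)"
proof -
  let ?T = "turan_graph n k"
  have "graph_form ?T (\<lambda>_. 1) \<le> spectral_radius ?T * sq_norm (pverts ?T) (\<lambda>_. 1)"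
    using assms by (intro graph_form_le pair_graph_turan_graph) (auto simp: lessThan_empty_iff)
  moreover have "graph_form ?T (\<lambda>_. 1) = real (card (parcs ?T))"
    by (subst graph_form_arcs[OF pair_graph_turan_graph]) (simp add: case_prod_beta)
  moreover have "sq_norm (pverts ?T) (\<lambda>_. 1) = real n" by (simp add: inner_on_def)
  ultimately have "real (card (parcs ?T)) \<le> spectral_radius ?T * real n" by simp
  then have "(1 - 1 / real k) * (real n)\<^sup>2 - real k \<le> spectral_radius ?T * real n"
    using turan_graph_arcs_ge[OF assms(1), of n] by simp
  then have "((1 - 1 / real k) * (real n)\<^sup>2 - real k) / real n \<le> spectral_radius ?T"
    using assms by (simp add: divide_le_eq)
  then show ?thesis using assms by (simp add: diff_divide_distrib power2_eq_square)
qed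

lemma disjoint_union_simps [simp]:
  "pverts (disjoint_union A B) = pverts A <+> pverts B"
  "(Inl a, Inl a') \<in> parcs (disjoint_union A B) \<longleftrightarrow> (a, a') \<in> parcs A"
  "(Inr b, Inr b') \<in> parcs (disjoint_union A B) \<longleftrightarrow> (b, b') \<in> parcs B"
  "(Inl a, Inr b) \<notin> parcs (disjoint_union A B)" "(Inr b, Inl a) \<notin> parcs (disjoint_union A B)"
  by (auto simp: disjoint_union_def)

lemma pair_graph_disjoint_union:
  assumes "pair_graph A" "pair_graph B"
  shows "pair_graph (disjoint_union A B)"
  unfolding pair_graph_iff
proof (intro conjI)
  show "finite (pverts (disjoint_union A B))" using assms by (simp add: finite_pverts)
  show "parcs (disjoint_union A B) \<subseteq> pverts (disjoint_union A B) \<times> pverts (disjoint_union A B)"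
    using parcs_in_pverts[OF assms(1)] parcs_in_pverts[OF assms(2)] by (auto simp: disjoint_union_def)
  show "sym (parcs (disjoint_union A B))"
  proof (rule symI)
    fix x y assume "(x, y) \<in> parcs (disjoint_union A B)"
    then show "(y, x) \<in> parcs (disjoint_union A B)"
      using parcs_sym[OF assms(1)] parcs_sym[OF assms(2)] by (cases x; cases y) simp_all
  qed
  show "irrefl (parcs (disjoint_union A B))"
    using parcs_irrefl[OF assms(1)] parcs_irrefl[OF assms(2)] by (auto simp: disjoint_union_def irrefl_def)
qed

text \<open>Joining two Turan graphs by an edge at vertices of least Perron weight costs at most \<open>1 / m\<close>.\<close>

lemma two_turan_graphs:
  fixes r m :: nat
  assumes "r \<ge> 2" "m \<ge> 2" and crit: "colour_critical r H"
  obtains J :: "(nat + nat) pair_pre_digraph" where "connected_free_graph H (2 * m) J"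
    "eigval 2 J \<ge> spectral_radius (turan_graph m r) - 1 / real m"
proof -
  let ?T = "turan_graph m r"
  have T: "pair_graph ?T" by (rule pair_graph_turan_graph)
  have T_ne: "pverts ?T \<noteq> {}" using \<open>m \<ge> 2\<close> by (auto simp: lessThan_empty_iff)
  obtain x where x: "sq_norm (pverts ?T) x = 1" "\<forall>v. x v \<ge> 0"
    "\<forall>v\<in>pverts ?T. graph_op ?T x v = spectral_radius ?T * x v"
    using spectral_radius_eigenvector[OF T T_ne] .
  have form_x: "graph_form ?T x = spectral_radius ?T"
  proof -
    have "graph_form ?T x = inner_on (pverts ?T) x (\<lambda>v. spectral_radius ?T * x v)" using x(3) by (intro inner_on_cong) auto
    then show ?thesis using x(1) by (simp add: inner_on_scale)
  qed
  define a where "a = arg_min_on x {..<m}"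
  have fin_m: "finite {..<m}" "{..<m} \<noteq> {}" using \<open>m \<ge> 2\<close> by (auto simp: lessThan_empty_iff)
  have a: "a < m" "\<And>v. v < m \<Longrightarrow> x a \<le> x v"
    unfolding a_def using arg_min_if_finite(1)[OF fin_m, of x] arg_min_least[OF fin_m, of _ x] by auto
  have xa: "x a * x a \<le> 1 / real m"
  proof -
    have "(\<Sum>v<m. x a * x a) \<le> (\<Sum>v<m. x v * x v)" using a x(2) by (intro sum_mono mult_mono) auto
    also have "\<dots> = 1" using x(1) by (simp add: inner_on_def)
    finally show ?thesis using \<open>m \<ge> 2\<close> by (simp add: le_divide_eq mult.commute)
  qed
  define D where "D = disjoint_union ?T ?T"
  define J where "J = add_edge D (Inl a) (Inr a)"
  have D: "pair_graph D" unfolding D_def using T by (intro pair_graph_disjoint_union)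
  have J: "pair_graph J" unfolding J_def using a D by (intro pair_graph_add_edge) (auto simp: D_def)
  have J_verts: "pverts J = {..<m} <+> {..<m}" by (simp add: J_def add_edge_def D_def)
  have J_arcs: "(Inl i, Inl j) \<in> parcs J \<longleftrightarrow> (i, j) \<in> parcs ?T" "(Inr i, Inr j) \<in> parcs J \<longleftrightarrow> (i, j) \<in> parcs ?T"
    "(Inl i, Inr j) \<in> parcs J \<longleftrightarrow> i = a \<and> j = a" "(Inr i, Inl j) \<in> parcs J \<longleftrightarrow> i = a \<and> j = a" for i j
    unfolding J_def add_edge_def D_def by (simp_all del: turan_graph_simps)
  have cardJ: "card (pverts J) = 2 * m" by (simp add: J_verts card_Plus)
  have embl: "embeds Inl ?T J" "embeds Inr ?T J"
    by (auto simp: embeds_def J_verts J_arcs simp del: turan_graph_simps(2)) 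
  obtain p where p: "\<forall>w. p w \<ge> 0" "\<forall>v\<in>pverts ?T. p (Inl v) = x v" "\<forall>w. w \<notin> Inl ` pverts ?T \<longrightarrow> p w = 0"
    "sq_norm (pverts J) p = sq_norm (pverts ?T) x" "graph_form ?T x \<le> graph_form J p"
    by (rule embeds_extension[OF T J embl(1) x(2)])
  obtain q where q: "\<forall>w. q w \<ge> 0" "\<forall>v\<in>pverts ?T. q (Inr v) = x v" "\<forall>w. w \<notin> Inr ` pverts ?T \<longrightarrow> q w = 0"
    "sq_norm (pverts J) q = sq_norm (pverts ?T) x" "graph_form ?T x \<le> graph_form J q"
    by (rule embeds_extension[OF T J embl(2) x(2)])
  have pr: "p (Inr i) = 0" "q (Inl i) = 0" for i using p(3) q(3) by auto
  have "inner_on (pverts J) p q = 0"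
    unfolding inner_on_def
  proof (rule sum.neutral, rule ballI)
    fix w show "p w * q w = 0" by (cases w) (simp_all add: pr)
  qed
  moreover have "inner_on (pverts J) p (graph_op J q) = x a * x a"
  proof -
    have "inner_on (pverts J) p (graph_op J q) = (\<Sum>(u, v)\<in>parcs J. p u * q v)" by (rule graph_bilinear_arcs[OF J])
    also have "\<dots> = (\<Sum>(u, v)\<in>{(Inl a, Inr a)}. p u * q v)"
    proof (rule sum.mono_neutral_right[OF finite_parcs[OF J]])
      show "{(Inl a, Inr a)} \<subseteq> parcs J" by (simp add: J_arcs)
      show "\<forall>e\<in>parcs J - {(Inl a, Inr a)}. (case e of (u, v) \<Rightarrow> p u * q v) = 0"
      proof
        fix e assume e: "e \<in> parcs J - {(Inl a, Inr a)}"
        obtain u v where uv: "e = (u, v)" by (cases e)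
        show "(case e of (u, v) \<Rightarrow> p u * q v) = 0"
          using e unfolding uv by (cases u; cases v) (auto simp: pr J_arcs simp del: turan_graph_simps)
      qed
    qed
    also have "\<dots> = x a * x a" using p(2) q(2) a by simp
    finally show ?thesis .
  qed
  ultimately have "eigval 2 J \<ge> spectral_radius ?T - 1 / real m"
    using p q x(1) form_x xa x(2) cardJ \<open>m \<ge> 2\<close>
    by (intro second_eigenvalue_ge_two_parts[OF J, of p _ q]) simp_all
  moreover have "graph_connected J"
  proof (rule connected_two_parts[OF J])
    show "pverts J = Inl ` {..<m} \<union> Inr ` {..<m}" by (auto simp: J_verts)
    have conn: "graph_connected ?T" by (rule turan_graph_connected[OF \<open>r \<ge> 2\<close> \<open>m \<ge> 2\<close>])
    have bij: "graph_bij Inl ?T (induced J (Inl ` {..<m}))" "graph_bij Inr ?T (induced J (Inr ` {..<m}))"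
      by (auto simp: graph_bij_def bij_betw_def J_arcs simp del: turan_graph_simps(2))
    have pg: "pair_graph (induced J (Inl ` {..<m}))" "pair_graph (induced J (Inr ` {..<m}))"
      by (auto intro!: pair_graph_induced[OF J] simp: J_verts)
    show "graph_connected (induced J (Inl ` {..<m}))" "graph_connected (induced J (Inr ` {..<m}))"
      using graph_connected_graph_bij[OF T pg(1) bij(1) conn] graph_connected_graph_bij[OF T pg(2) bij(2) conn] by auto
    show "Inl a \<in> Inl ` {..<m}" "Inr a \<in> Inr ` {..<m}" "(Inl a, Inr a) \<in> parcs J"
      using a by (auto simp: J_arcs)
  qed
  moreover have "free_of H J"
  proof (rule free_of_if_colourable[OF crit J])
    \<comment> \<open>The second copy is coloured one residue further, so that the two joined
      vertices, both with index \<open>a\<close>, get different colours.\<close>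
    define c where "c w = (case w of Inl i \<Rightarrow> i mod r | Inr i \<Rightarrow> Suc i mod r)" for w :: "nat + nat"
    have succ: "Suc i mod r \<noteq> i mod r" for i using \<open>r \<ge> 2\<close> by (simp add: mod_Suc)
    have succ_inj: "i mod r = j mod r" if "Suc i mod r = Suc j mod r" for i j
      using that \<open>r \<ge> 2\<close> by (auto simp: mod_Suc split: if_splits)
    show "proper_colouring J r c"
      unfolding proper_colouring_def
    proof (intro conjI)
      show "c ` pverts J \<subseteq> {..<r}" using \<open>r \<ge> 2\<close> by (auto simp: c_def J_verts)
      have "c u \<noteq> c v" if "(u, v) \<in> parcs J" for u v
      proof (cases u)
        case (Inl i)
        note i = Inl
        show ?thesis
        proof (cases v)
          case (Inl j)
          then show ?thesis using that i by (simp add: c_def J_arcs)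
        next
          case (Inr j)
          then show ?thesis using that i succ[of a] by (simp add: c_def J_arcs)
        qed
      next
        case (Inr i)
        note i = Inr
        show ?thesis
        proof (cases v)
          case (Inl j)
          then show ?thesis using that i succ[of a] by (simp add: c_def J_arcs)
        next
          case (Inr j)
          then have "i mod r \<noteq> j mod r" using that i by (simp add: J_arcs)
          then show ?thesis using succ_inj[of i j] i Inr by (auto simp: c_def)
        qed
      qed
      then show "\<forall>(u, v)\<in>parcs J. c u \<noteq> c v" by blast
    qed
  qed
  ultimately show thesis using that[of J] J cardJ by (simp add: connected_free_graph_def)
qed

section \<open>Odd order\<close>

lemma eigen_equation_uminus:
  "\<forall>v\<in>pverts G. graph_op G x v = \<mu> * x v \<Longrightarrow> \<forall>v\<in>pverts G. graph_op G (\<lambda>v. - x v) v = \<mu> * - x v"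
  by (simp add: kernel_op_def sum_negf)

lemma subset_extension_exists:
  assumes "finite V" "P \<subseteq> V" "card P \<le> m" "m \<le> card V"
  obtains S where "P \<subseteq> S" "S \<subseteq> V" "card S = m"
proof -
  have finP: "finite P" using assms finite_subset by blast
  have "card (V - P) = card V - card P" using assms finP by (simp add: card_Diff_subset)
  then have "m - card P \<le> card (V - P)" using assms by simp
  then obtain T where T: "T \<subseteq> V - P" "card T = m - card P" "finite T" by (rule obtain_subset_with_card_n)
  have "card (P \<union> T) = card P + card T" using T finP by (intro card_Un_disjoint) auto
  then show thesis using T assms by (intro that[of "P \<union> T"]) auto
qed

text \<open>Extremality is known for exactly \<open>m\<close> vertices, so \<open>P\<close> is
  filled up to a set \<open>S\<close> of that size. In case of equality, \<open>x\<close> cut off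
  outside \<open>P\<close> is a maximizer on the connected Turan graph induced by \<open>S\<close>,
  hence positive on \<open>S\<close>, so nothing was added. The eigenvalue equations in
  \<open>G\<close> and in the part then differ only by neighbours with negative value, and none can
  exist.\<close>

lemma small_sign_part:
  fixes r m :: nat
  assumes H: "pair_graph H" and thr: "nikiforov_threshold r H N" and "r \<ge> 2" "m \<ge> N" "m \<ge> 2"
    and G: "pair_graph G" "free_of H G" and ev: "\<forall>v\<in>pverts G. graph_op G x v = \<mu> * x v"
    and P: "P = {v \<in> pverts G. x v > 0}" "P \<noteq> {}" and card: "card P \<le> m" "m \<le> card (pverts G)"
  shows "\<mu> \<le> max_spectral_radius m H"
    and "\<mu> = max_spectral_radius m H \<Longrightarrow> card P = m \<and> (\<exists>f. graph_bij f (induced G P) (turan_graph m r)) \<and>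
      (\<forall>v\<in>P. \<forall>w. x w < 0 \<longrightarrow> (v, w) \<notin> parcs G)"
proof -
  let ?V = "pverts G"
  have V: "finite ?V" by (rule finite_pverts[OF G(1)])
  have PV: "P \<subseteq> ?V" by (auto simp: P)
  obtain S where S: "P \<subseteq> S" "S \<subseteq> ?V" "card S = m"
    by (rule subset_extension_exists[OF V PV card])
  have iS: "pair_graph (induced G S)" by (rule pair_graph_induced[OF G(1) S(2)])
  have S_ne: "pverts (induced G S) \<noteq> {}" using P S by auto
  have sep: "\<forall>v\<in>P. \<forall>w\<in>?V - P. x w > 0 \<longrightarrow> (v, w) \<notin> parcs G" by (auto simp: P)
  have posP: "\<forall>v\<in>P. x v > 0" by (auto simp: P)
  note comp = sign_component_bound[OF G(1) ev PV P(2) posP sep]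
  have le1: "\<mu> \<le> spectral_radius (induced G S)"
    using comp(3) spectral_radius_induced_mono[OF G(1) S(1,2) P(2)] by simp
  have freeS: "free_of H (induced G S)" by (rule free_of_induced[OF H G(1) S(2) G(2)])
  have le2: "spectral_radius (induced G S) \<le> max_spectral_radius m H"
    using spectral_radius_le_max[OF H iS S_ne freeS] S(3) by simp
  show "\<mu> \<le> max_spectral_radius m H" using le1 le2 by simp
  assume eq: "\<mu> = max_spectral_radius m H"
  then have \<mu>: "spectral_radius (induced G S) = \<mu>" using le1 le2 by simp
  have "\<exists>f. graph_bij f (induced G S) (turan_graph m r)"
    by (rule spectral_radius_eq_max_imp_turan[OF H thr iS S_ne freeS _ \<open>m \<ge> N\<close>]) (use S eq \<mu> in simp_all)
  then obtain f where f: "graph_bij f (induced G S) (turan_graph m r)" by blast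
  have conn: "graph_connected (induced G S)"
    by (rule graph_connected_graph_bij[OF pair_graph_turan_graph iS graph_bij_sym[OF f]])
      (rule turan_graph_connected[OF \<open>r \<ge> 2\<close> \<open>m \<ge> 2\<close>])
  define p where "p v = (if v \<in> P then x v else 0)" for v
  have pS: "(\<lambda>v. if v \<in> S then p v else 0) = p"
    by (rule ext) (use S(1) in \<open>auto simp: p_def\<close>)
  have form: "graph_form (induced G S) p = graph_form (induced G P) x"
    unfolding induced_form(1)[OF G(1) S(2)] induced_form(1)[OF G(1) PV] pS by (simp add: p_def[abs_def])
  have norm: "sq_norm S p = sq_norm P x"
    unfolding induced_form(2)[OF G(1) S(2)] induced_form(2)[OF G(1) PV] pS by (simp add: p_def[abs_def])
  have op: "\<forall>v\<in>pverts (induced G S). graph_op (induced G S) p v = \<mu> * p v"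
    using maximal_imp_eigenvector[OF iS S_ne, of p] comp(1) form norm \<mu> by simp
  obtain u where u: "u \<in> P" using P(2) by blast
  have "p v > 0" if "v \<in> S" for v
  proof (rule connected_eigenvector_pos[OF iS conn _ op])
    show "\<forall>v. 0 \<le> p v" by (auto simp: p_def P)
    show "u \<in> pverts (induced G S)" "p u > 0" using u S posP by (auto simp: p_def)
    show "v \<in> pverts (induced G S)" using that by simp
  qed
  then have SP: "S = P" using S(1) by (fastforce simp: p_def split: if_splits)
  have "(v, w) \<notin> parcs G" if v: "v \<in> P" and w: "x w < 0" for v w
  proof
    assume vw: "(v, w) \<in> parcs G"
    have fin: "finite {w. (v, w) \<in> parcs G}"
      using parcs_in_pverts[OF G(1)] by (auto intro: finite_subset[OF _ V])
    have iP: "pair_graph (induced G P)" by (rule pair_graph_induced[OF G(1) PV])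
    have "(\<Sum>w | (v, w) \<in> parcs G. x w) = \<mu> * x v" using ev v PV graph_op_eq[OF G(1), of x v] by auto
    also have "\<dots> = \<mu> * p v" using v by (simp add: p_def)
    also have "\<dots> = graph_op (induced G P) p v" using op v by (simp add: SP)
    also have "\<dots> = (\<Sum>w | (v, w) \<in> parcs (induced G P). p w)" by (rule graph_op_eq[OF iP])
    also have "\<dots> = (\<Sum>w | (v, w) \<in> parcs G. p w)"
      using fin v by (intro sum.mono_neutral_left) (auto simp: p_def)
    finally have "(\<Sum>w | (v, w) \<in> parcs G. p w - x w) = 0" by (simp add: sum_subtractf)
    moreover have "\<forall>w\<in>{w. (v, w) \<in> parcs G}. 0 \<le> p w - x w"
      using parcs_in_pverts[OF G(1)] by (auto simp: p_def P)
    ultimately have "\<forall>w\<in>{w. (v, w) \<in> parcs G}. p w - x w = 0"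
      using sum_nonneg_eq_0_iff[OF fin, of "\<lambda>w. p w - x w"] by simp
    then have "p w = x w" using vw by simp
    then show False using w by (simp add: p_def P split: if_splits)
  qed
  then show "card P = m \<and> (\<exists>f. graph_bij f (induced G P) (turan_graph m r)) \<and>
      (\<forall>v\<in>P. \<forall>w. x w < 0 \<longrightarrow> (v, w) \<notin> parcs G)"
    using S(3) SP f by blast
qed

lemma add_vertex_simps [simp]:
  "pverts (add_vertex G N) = insert None (Some ` pverts G)"
  "(None, None) \<notin> parcs (add_vertex G N)"
  "(None, Some w) \<in> parcs (add_vertex G N) \<longleftrightarrow> w \<in> N"
  "(Some w, None) \<in> parcs (add_vertex G N) \<longleftrightarrow> w \<in> N"
  "(Some u, Some v) \<in> parcs (add_vertex G N) \<longleftrightarrow> (u, v) \<in> parcs G"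
  by (auto simp: add_vertex_def)

lemma parcs_add_vertex_subset:
  "pair_graph G \<Longrightarrow> N \<subseteq> pverts G \<Longrightarrow>
    parcs (add_vertex G N) \<subseteq> pverts (add_vertex G N) \<times> pverts (add_vertex G N)"
  using parcs_in_pverts[of G] unfolding add_vertex_def by auto

lemma vertex_joined_of_small_sign_part:
  fixes r m :: nat
  assumes H: "pair_graph H" and thr: "nikiforov_threshold r H N" and "r \<ge> 2" "m \<ge> N" "m \<ge> 2"
    and G: "pair_graph G" "free_of H G" and conn: "graph_connected G" and card: "card (pverts G) = 2 * m + 1"
    and ev: "\<forall>v\<in>pverts G. graph_op G x v = max_spectral_radius m H * x v"
    and x: "\<exists>v\<in>pverts G. x v > 0" "\<exists>v\<in>pverts G. x v < 0"
    and P: "card {v \<in> pverts G. x v > 0} \<le> m"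
  shows "G \<in> vertex_joined (turan_graph m r) (turan_graph m r)"
proof -
  let ?V = "pverts G" and ?T = "turan_graph m r"
  have V: "finite ?V" by (rule finite_pverts[OF G(1)])
  define A where "A = {v \<in> ?V. x v > 0}"
  define B where "B = {v \<in> ?V. - x v > 0}"
  have AB: "A \<subseteq> ?V" "B \<subseteq> ?V" "A \<inter> B = {}" "A \<noteq> {}" "B \<noteq> {}" using x by (auto simp: A_def B_def)
  have fin: "finite A" "finite B" using finite_subset[OF AB(1) V] finite_subset[OF AB(2) V] by simp_all
  have A: "card A = m" "\<exists>f. graph_bij f (induced G A) ?T" "\<forall>v\<in>A. \<forall>w. x w < 0 \<longrightarrow> (v, w) \<notin> parcs G"
    using small_sign_part(2)[OF H thr \<open>r \<ge> 2\<close> \<open>m \<ge> N\<close> \<open>m \<ge> 2\<close> G ev A_def AB(4)] P card by (auto simp: A_def)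
  then have no_arc: "(v, w) \<notin> parcs G" "(w, v) \<notin> parcs G" if "v \<in> A" "w \<in> B" for v w
    using that parcs_sym[OF G(1)] by (auto simp: B_def)
  have cardAB: "card (A \<union> B) = m + card B" using A(1) AB fin by (simp add: card_Un_disjoint)
  have "card (A \<union> B) \<le> 2 * m + 1" using card_mono[OF V, of "A \<union> B"] AB card by simp
  \<comment> \<open>With m + 1 negative vertices there would be no vertex left to connect the two
    sign parts.\<close>
  have "card B \<le> m"
  proof (rule ccontr)
    assume "\<not> card B \<le> m"
    then have "card (A \<union> B) = card ?V" using cardAB card \<open>card (A \<union> B) \<le> 2 * m + 1\<close> by simp
    then have "A \<union> B = ?V" using card_subset_eq[OF V, of "A \<union> B"] AB by simp
    moreover have "\<exists>u\<in>A. \<exists>v\<in>?V - A. (u, v) \<in> parcs G"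
      using AB by (intro graph_connected_cut[OF G(1) conn]) auto
    ultimately show False using no_arc by blast
  qed
  then have B: "card B = m" "\<exists>f. graph_bij f (induced G B) ?T"
    using small_sign_part(2)[OF H thr \<open>r \<ge> 2\<close> \<open>m \<ge> N\<close> \<open>m \<ge> 2\<close> G eigen_equation_uminus[OF ev] B_def AB(5)] card
    by auto
  obtain f1 f2 where f1: "graph_bij f1 (induced G A) ?T" and f2: "graph_bij f2 (induced G B) ?T" using A B by blast
  have "card (?V - (A \<union> B)) = 1"
    using card_Diff_subset[of "A \<union> B" ?V] fin AB cardAB card B(1) by simp
  then obtain z where z: "?V - (A \<union> B) = {z}" by (rule card_1_singletonE)
  have zV: "z \<in> ?V" "z \<notin> A" "z \<notin> B" and Vz: "?V = insert z (A \<union> B)" using z AB by auto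
  have b1: "bij_betw f1 A {..<m}" "\<And>u v. u \<in> A \<Longrightarrow> v \<in> A \<Longrightarrow> (u, v) \<in> parcs G \<longleftrightarrow> (f1 u, f1 v) \<in> parcs ?T"
    using f1 by (simp_all add: graph_bij_def del: turan_graph_simps(2))
  have b2: "bij_betw f2 B {..<m}" "\<And>u v. u \<in> B \<Longrightarrow> v \<in> B \<Longrightarrow> (u, v) \<in> parcs G \<longleftrightarrow> (f2 u, f2 v) \<in> parcs ?T"
    using f2 by (simp_all add: graph_bij_def del: turan_graph_simps(2))
  define S1 where "S1 = f1 ` {v \<in> A. (z, v) \<in> parcs G}"
  define S2 where "S2 = f2 ` {v \<in> B. (z, v) \<in> parcs G}"
  define J where "J = add_vertex (disjoint_union ?T ?T) (S1 <+> S2)"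
  define F where "F v = (if v \<in> A then Some (Inl (f1 v)) else if v \<in> B then Some (Inr (f2 v)) else None)" for v
  have S1: "f1 v \<in> S1 \<longleftrightarrow> (z, v) \<in> parcs G" if "v \<in> A" for v
    using that b1(1) by (auto simp: S1_def bij_betw_def inj_on_def)
  have S2: "f2 v \<in> S2 \<longleftrightarrow> (z, v) \<in> parcs G" if "v \<in> B" for v
    using that b2(1) by (auto simp: S2_def bij_betw_def inj_on_def)
  have Fv: "v \<in> A \<Longrightarrow> F v = Some (Inl (f1 v))" "v \<in> B \<Longrightarrow> F v = Some (Inr (f2 v))" "F z = None" for v
    using AB zV by (auto simp: F_def)
  have S_sub: "S1 \<subseteq> {..<m}" "S2 \<subseteq> {..<m}"
    using b1(1) b2(1) by (auto simp: S1_def S2_def bij_betw_def)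
  have S_ne: "S1 \<noteq> {}" "S2 \<noteq> {}"
  proof -
    have "\<exists>u\<in>A. \<exists>v\<in>?V - A. (u, v) \<in> parcs G"
      using AB by (intro graph_connected_cut[OF G(1) conn]) auto
    then obtain u v where uv: "u \<in> A" "v \<in> ?V - A" "(u, v) \<in> parcs G" by blast
    then have "v = z" using no_arc(1)[OF uv(1)] z by blast
    with uv show "S1 \<noteq> {}" using S1 parcs_sym[OF G(1)] by blast
    have "\<exists>u\<in>B. \<exists>v\<in>?V - B. (u, v) \<in> parcs G"
      using AB by (intro graph_connected_cut[OF G(1) conn]) auto
    then obtain u v where uv: "u \<in> B" "v \<in> ?V - B" "(u, v) \<in> parcs G" by blast
    then have "v = z" using no_arc(2)[OF _ uv(1)] z by blast
    with uv show "S2 \<noteq> {}" using S2 parcs_sym[OF G(1)] by blast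
  qed
  have sym: "(u, v) \<in> parcs G \<longleftrightarrow> (v, u) \<in> parcs G" for u v using parcs_sym[OF G(1)] by blast
  have "graph_bij F G J"
    unfolding graph_bij_def
  proof (intro conjI ballI)
    have "inj_on F ?V"
    proof (rule inj_onI)
      fix u v assume uv: "u \<in> ?V" "v \<in> ?V" "F u = F v"
      then consider "u \<in> A" "v \<in> A" | "u \<in> B" "v \<in> B" | "u = z" "v = z"
        unfolding Vz by (auto simp: Fv)
      then show "u = v"
        using uv(3) b1(1) b2(1) by cases (auto simp: Fv bij_betw_def inj_on_def)
    qed
    moreover have "F ` ?V = pverts J"
    proof -
      have "F ` ?V = insert None (F ` A \<union> F ` B)" unfolding Vz by (simp add: Fv(3) image_Un)
      also have "F ` A = Some ` Inl ` f1 ` A" using Fv(1) by (auto simp: image_iff)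
      also have "F ` B = Some ` Inr ` f2 ` B" using Fv(2) by (auto simp: image_iff)
      finally show ?thesis using b1(1) b2(1) by (auto simp: J_def bij_betw_def)
    qed
    ultimately show "bij_betw F ?V (pverts J)" by (simp add: bij_betw_def)
    fix u v assume uv: "u \<in> ?V" "v \<in> ?V"
    have cases3: "w \<in> A \<or> w \<in> B \<or> w = z" if "w \<in> ?V" for w using that Vz by blast
    have zz: "(z, z) \<notin> parcs G" by (rule parcs_irrefl[OF G(1)])
    have plus: "Inl i \<in> S1 <+> S2 \<longleftrightarrow> i \<in> S1" "Inr i \<in> S1 <+> S2 \<longleftrightarrow> i \<in> S2" for i by auto
    have J_arcs: "(Some (Inl i), Some (Inl j)) \<in> parcs J \<longleftrightarrow> (i, j) \<in> parcs ?T"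
      "(Some (Inr i), Some (Inr j)) \<in> parcs J \<longleftrightarrow> (i, j) \<in> parcs ?T"
      "(Some (Inl i), Some (Inr j)) \<notin> parcs J" "(Some (Inr i), Some (Inl j)) \<notin> parcs J"
      "(None, Some (Inl i)) \<in> parcs J \<longleftrightarrow> i \<in> S1" "(Some (Inl i), None) \<in> parcs J \<longleftrightarrow> i \<in> S1"
      "(None, Some (Inr i)) \<in> parcs J \<longleftrightarrow> i \<in> S2" "(Some (Inr i), None) \<in> parcs J \<longleftrightarrow> i \<in> S2"
      "(None, None) \<notin> parcs J" for i j
      by (simp_all add: J_def plus del: turan_graph_simps(2))
    from cases3[OF uv(1)] cases3[OF uv(2)] show "(u, v) \<in> parcs G \<longleftrightarrow> (F u, F v) \<in> parcs J"
    proof (elim disjE)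
      show ?thesis if "u \<in> A" "v \<in> A" using that by (simp only: Fv J_arcs b1(2))
      show ?thesis if "u \<in> B" "v \<in> B" using that by (simp only: Fv J_arcs b2(2))
      show ?thesis if "u \<in> A" "v \<in> B" using no_arc that by (simp only: Fv J_arcs simp_thms)
      show ?thesis if "u \<in> B" "v \<in> A" using no_arc that by (simp only: Fv J_arcs simp_thms)
      show ?thesis if "u \<in> A" "v = z" using that sym[of u z] by (simp only: Fv J_arcs S1)
      show ?thesis if "u \<in> B" "v = z" using that sym[of u z] by (simp only: Fv J_arcs S2)
      show ?thesis if "u = z" "v \<in> A" using that by (simp only: Fv J_arcs S1)
      show ?thesis if "u = z" "v \<in> B" using that by (simp only: Fv J_arcs S2)
      show ?thesis if "u = z" "v = z" using that zz by (simp only: Fv J_arcs simp_thms)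
    qed
  qed
  moreover have "parcs J \<subseteq> pverts J \<times> pverts J"
    unfolding J_def using S_sub
    by (intro parcs_add_vertex_subset pair_graph_disjoint_union pair_graph_turan_graph) auto
  ultimately have "G \<cong>\<^sub>G J" using graph_iso_iff[of G J] G(1) unfolding pair_graph_iff by blast
  then show ?thesis
    unfolding vertex_joined_def J_def turan_graph_simps(1) using G(1) conn S_sub S_ne by blast
qed

text \<open>The Perron vectors of the two copies have disjoint supports with no arc between them, so
  the cross term on their plane is 0.\<close>

lemma vertex_joined_second_eigenvalue_ge:
  fixes m r :: nat
  assumes "m \<ge> 1" and G: "G \<in> vertex_joined (turan_graph m r) (turan_graph m r)"
  shows "eigval 2 G \<ge> spectral_radius (turan_graph m r)"
proof -
  let ?T = "turan_graph m r"
  have pg: "pair_graph G" using G by (simp add: vertex_joined_def)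
  have T: "pair_graph ?T" by (rule pair_graph_turan_graph)
  have T_ne: "pverts ?T \<noteq> {}" using \<open>m \<ge> 1\<close> by (auto simp: lessThan_empty_iff)
  obtain S1 S2 where S: "S1 \<subseteq> {..<m}" "S2 \<subseteq> {..<m}"
    and iso: "G \<cong>\<^sub>G add_vertex (disjoint_union ?T ?T) (S1 <+> S2)"
    using G by (auto simp: vertex_joined_def)
  define J where "J = add_vertex (disjoint_union ?T ?T) (S1 <+> S2)"
  have "parcs J \<subseteq> pverts J \<times> pverts J"
    unfolding J_def using S by (intro parcs_add_vertex_subset pair_graph_disjoint_union T) auto
  then obtain f where "graph_bij f G J"
    using graph_iso_iff[of G J] iso pg unfolding J_def pair_graph_iff by blast
  then obtain g where g: "graph_bij g J G" using graph_bij_sym by blast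
  have g_inj: "inj_on g (pverts J)" "g ` pverts J = pverts G"
    and g_arc: "\<And>u v. u \<in> pverts J \<Longrightarrow> v \<in> pverts J \<Longrightarrow> (u, v) \<in> parcs J \<longleftrightarrow> (g u, g v) \<in> parcs G"
    using g by (simp_all add: graph_bij_def bij_betw_def)
  define g1 where "g1 i = g (Some (Inl i))" for i
  define g2 where "g2 i = g (Some (Inr i))" for i
  have inJ: "Some (Inl i) \<in> pverts J" "Some (Inr i) \<in> pverts J" if "i < m" for i
    using that by (auto simp: J_def)
  have emb: "embeds g1 ?T G" "embeds g2 ?T G"
  proof -
    have "inj_on g1 {..<m}" "inj_on g2 {..<m}"
      using inj_onD[OF g_inj(1)] inJ by (auto simp: inj_on_def g1_def g2_def)
    moreover have "g1 ` {..<m} \<subseteq> pverts G" "g2 ` {..<m} \<subseteq> pverts G"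
      using g_inj(2) inJ by (auto simp: g1_def g2_def)
    moreover have "(g1 i, g1 j) \<in> parcs G" "(g2 i, g2 j) \<in> parcs G" if "(i, j) \<in> parcs ?T" for i j
      using that g_arc[of "Some (Inl i)" "Some (Inl j)"] g_arc[of "Some (Inr i)" "Some (Inr j)"] inJ
      by (auto simp: g1_def g2_def J_def)
    ultimately show "embeds g1 ?T G" "embeds g2 ?T G" by (auto simp: embeds_def simp del: turan_graph_simps(2))
  qed
  have no_arc: "(g1 i, g2 j) \<notin> parcs G" "g1 i \<noteq> g2 j" if "i < m" "j < m" for i j
    using g_arc[OF inJ(1)[OF that(1)] inJ(2)[OF that(2)]] inj_onD[OF g_inj(1) _ inJ(1)[OF that(1)] inJ(2)[OF that(2)]]
    by (auto simp: g1_def g2_def J_def)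
  obtain x where x: "sq_norm (pverts ?T) x = 1" "\<forall>v. x v \<ge> 0"
    "\<forall>v\<in>pverts ?T. graph_op ?T x v = spectral_radius ?T * x v"
    using spectral_radius_eigenvector[OF T T_ne] .
  have form_x: "graph_form ?T x = spectral_radius ?T"
  proof -
    have "graph_form ?T x = inner_on (pverts ?T) x (\<lambda>v. spectral_radius ?T * x v)" using x(3) by (intro inner_on_cong) auto
    then show ?thesis using x(1) by (simp add: inner_on_scale)
  qed
  obtain p where p: "\<forall>w. w \<notin> g1 ` pverts ?T \<longrightarrow> p w = 0"
    "sq_norm (pverts G) p = sq_norm (pverts ?T) x" "graph_form ?T x \<le> graph_form G p"
    by (rule embeds_extension[OF T pg emb(1) x(2)])
  obtain q where q: "\<forall>w. w \<notin> g2 ` pverts ?T \<longrightarrow> q w = 0"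
    "sq_norm (pverts G) q = sq_norm (pverts ?T) x" "graph_form ?T x \<le> graph_form G q"
    by (rule embeds_extension[OF T pg emb(2) x(2)])
  have "p w * q w = 0" for w
  proof (cases "w \<in> g1 ` {..<m}")
    case True
    then have "w \<notin> g2 ` {..<m}" using no_arc(2) by auto
    then show ?thesis using q(1) by simp
  qed (use p(1) in simp)
  then have "inner_on (pverts G) p q = 0" unfolding inner_on_def by (intro sum.neutral ballI)
  moreover have "p u * q v = 0" if "(u, v) \<in> parcs G" for u v
  proof (cases "u \<in> g1 ` {..<m}")
    case True
    then have "v \<notin> g2 ` {..<m}" using no_arc(1) that by auto
    then show ?thesis using q(1) by simp
  qed (use p(1) in simp)
  then have "inner_on (pverts G) p (graph_op G q) = 0"
    unfolding graph_bilinear_arcs[OF pg] by (intro sum.neutral) auto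
  moreover have "card (pverts G) \<ge> 2"
  proof -
    have "card {g1 0, g2 0} \<le> card (pverts G)"
      using emb \<open>m \<ge> 1\<close> by (intro card_mono finite_pverts[OF pg]) (auto simp: embeds_def)
    then show ?thesis using no_arc(2)[of 0 0] \<open>m \<ge> 1\<close> by simp
  qed
  ultimately have "eigval 2 G \<ge> spectral_radius ?T - 0"
    using p q x(1) form_x by (intro second_eigenvalue_ge_two_parts[OF pg, of p _ q]) simp_all
  then show ?thesis by simp
qed

section \<open>Even order\<close>

text \<open>On the plane of the positive and negative parts of an eigenvector, the form minus \<mu>
  times the norm degenerates at (1, -1), where the combination is \<open>x\<close> itself. So it is
  a multiple of (s + t)^2, and the factor \<open>c\<close> is the total weight of the edges between
  the parts.\<close>

lemma sign_form:
  assumes G: "pair_graph G" and ev: "\<forall>v\<in>pverts G. graph_op G x v = \<mu> * x v"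
    and p: "p = (\<lambda>v. max (x v) 0)" and q: "q = (\<lambda>v. max (- x v) 0)"
    and c: "c = inner_on (pverts G) p (graph_op G q)"
  shows "graph_form G (\<lambda>v. s * p v + t * q v)
      = \<mu> * sq_norm (pverts G) (\<lambda>v. s * p v + t * q v) + c * (s + t)\<^sup>2"
proof -
  let ?V = "pverts G"
  have x: "x = (\<lambda>v. p v - q v)" and pq: "\<And>v. p v * q v = 0" by (auto simp: p q max_def fun_eq_iff)
  have orth: "inner_on ?V p q = 0" "inner_on ?V q p = 0" 
  proof -
    show "inner_on ?V p q = 0" unfolding inner_on_def by (rule sum.neutral) (use pq in blast)
    then show "inner_on ?V q p = 0" by (simp only: inner_on_commute)
  qed
  have op: "graph_op G x v = graph_op G p v - graph_op G q v" for v
    unfolding x kernel_op_def by (simp add: right_diff_distrib sum_subtractf)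
  have opx: "inner_on ?V f (\<lambda>v. graph_op G p v - graph_op G q v) = \<mu> * inner_on ?V f (\<lambda>v. p v - q v)" for f
  proof -
    have "inner_on ?V f (\<lambda>v. graph_op G p v - graph_op G q v) = inner_on ?V f (\<lambda>v. \<mu> * (p v - q v))"
      using ev op by (intro inner_on_cong) (auto simp: x)
    then show ?thesis by (simp add: inner_on_scale)
  qed
  have qp: "inner_on ?V q (graph_op G p) = c"
    unfolding c using kernel_op_symmetric[of ?V "adj G" q p] adj_sym[OF G] by (metis inner_on_commute)
  have 1: "graph_form G p = \<mu> * sq_norm ?V p + c" using opx[of p] orth by (simp add: inner_on_diff c)
  have 2: "graph_form G q = \<mu> * sq_norm ?V q + c" using opx[of q] orth qp by (simp add: inner_on_diff)
  have "graph_form G (\<lambda>v. s * p v + t * q v) = s\<^sup>2 * graph_form G p + 2 * s * t * c + t\<^sup>2 * graph_form G q"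
    using quad_form_add[of ?V "adj G" s p t q] adj_sym[OF G] unfolding c by blast
  then show ?thesis
    unfolding 1 2 inner_on_add_square orth by (simp add: power2_eq_square algebra_simps)
qed

lemma graph_form_add_edge:
  assumes G: "pair_graph G" and uv: "u \<in> pverts G" "v \<in> pverts G" "u \<noteq> v" "(u, v) \<notin> parcs G"
  shows "graph_form (add_edge G u v) z = graph_form G z + 2 * z u * z v"
proof -
  have "(v, u) \<notin> parcs G" using uv(4) parcs_sym[OF G] by blast
  moreover have "parcs (add_edge G u v) = insert (u, v) (insert (v, u) (parcs G))" by (auto simp: add_edge_def)
  ultimately show ?thesis
    using uv finite_parcs[OF G]
    by (simp add: graph_form_arcs[OF G] graph_form_arcs[OF pair_graph_add_edge[OF G uv(1-3)]])
qed

lemma add_delete_edge: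
  assumes "pair_graph G" "(u, v) \<in> parcs G"
  shows "add_edge (delete_edge G u v) u v = G"
  using assms(2) parcs_sym[OF assms] by (cases G) (auto simp: add_edge_def delete_edge_def)

text \<open>Deleting the edge subtracts 2 s t e, where e is its weight and \<open>c\<close> is at
  least e. What remains of c (s + t)^2 equals (c - e) (s + t)^2 + e (s^2 + t^2), which is positive
  even on the line s = - t where the form was tight.\<close>

lemma second_eigenvalue_delete_edge:
  assumes G: "pair_graph G" "card (pverts G) \<ge> 2" and ev: "\<forall>v\<in>pverts G. graph_op G x v = \<mu> * x v"
    and ab: "(a, b) \<in> parcs G" "x a > 0" "x b < 0"
    and ab': "(a', b') \<in> parcs G" "x a' > 0" "x b' < 0" "(a, b) \<noteq> (a', b')"
  shows "eigval 2 (delete_edge G a b) > \<mu>"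
proof -
  let ?D = "delete_edge G a b"
  define p where "p = (\<lambda>v. max (x v) 0)"
  define q where "q = (\<lambda>v. max (- x v) 0)"
  define c where "c = inner_on (pverts G) p (graph_op G q)"
  have D: "pair_graph ?D" by (rule pair_graph_delete_edge[OF G(1)])
  have vD: "pverts ?D = pverts G" by (simp add: delete_edge_def)
  have abV: "a \<in> pverts ?D" "b \<in> pverts ?D" "a \<noteq> b"
    using parcs_in_pverts[OF G(1) ab(1)] ab by (auto simp: vD)
  have not: "(a, b) \<notin> parcs ?D" by (simp add: delete_edge_def)
  have "(\<Sum>(u, v)\<in>{(a, b), (a', b')}. p u * q v) \<le> (\<Sum>(u, v)\<in>parcs G. p u * q v)"
    using ab(1) ab'(1) finite_parcs[OF G(1)] by (intro sum_mono2) (auto simp: p_def q_def)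
  then have c_ge: "p a * q b + p a' * q b' \<le> c"
    using ab'(4) by (simp add: c_def graph_bilinear_arcs[OF G(1)])
  define e where "e = p a * q b"
  have e: "e > 0" "p a' * q b' > 0"
  proof -
    have "p a = x a" "q b = - x b" "p a' = x a'" "q b' = - x b'" using ab ab' by (simp_all add: p_def q_def)
    then show "e > 0" "p a' * q b' > 0" using ab ab' by (simp_all add: e_def mult_pos_neg)
  qed
  have zero: "p b = 0" "q a = 0" using ab by (auto simp: p_def q_def)
  show ?thesis
  proof (rule second_eigenvalue_gt[OF D, where p = p and q = q])
    show "2 \<le> card (pverts ?D)" using G(2) vD by simp
    fix s t :: real assume st: "(s, t) \<noteq> (0, 0)"
    have "graph_form G (\<lambda>v. s * p v + t * q v) = graph_form ?D (\<lambda>v. s * p v + t * q v) + 2 * (s * p a) * (t * q b)"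
      using graph_form_add_edge[OF D abV not, of "\<lambda>v. s * p v + t * q v"]
      unfolding add_delete_edge[OF G(1) ab(1)] by (simp add: zero)
    then have "graph_form ?D (\<lambda>v. s * p v + t * q v)
        = \<mu> * sq_norm (pverts G) (\<lambda>v. s * p v + t * q v) + (c * (s + t)\<^sup>2 - 2 * s * t * e)"
      using sign_form[OF G(1) ev p_def q_def c_def, of s t] by (simp add: e_def mult_ac)
    moreover have "c * (s + t)\<^sup>2 - 2 * s * t * e > 0"
    proof -
      have "c * (s + t)\<^sup>2 - 2 * s * t * e = (c - e) * (s + t)\<^sup>2 + e * (s\<^sup>2 + t\<^sup>2)"
        by (simp add: power2_eq_square algebra_simps)
      moreover have "(c - e) * (s + t)\<^sup>2 \<ge> 0" using c_ge e by (simp add: e_def)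
      moreover have "e * (s\<^sup>2 + t\<^sup>2) > 0" using e st by (simp add: sum_power2_gt_zero_iff)
      ultimately show ?thesis by simp
    qed
    ultimately show "\<mu> * sq_norm (pverts ?D) (\<lambda>v. s * p v + t * q v) < graph_form ?D (\<lambda>v. s * p v + t * q v)"
      by (simp add: vD)
  qed
qed

text \<open>The new edge adds 2 s^2 times \<open>x u * x v\<close>, which vanishes only for s = 0;
  there c t^2 is positive because of the edge between the sign parts.\<close>

lemma second_eigenvalue_add_edge:
  assumes G: "pair_graph G" "card (pverts G) \<ge> 2" and ev: "\<forall>v\<in>pverts G. graph_op G x v = \<mu> * x v"
    and nz: "\<forall>v\<in>pverts G. x v \<noteq> 0"
    and ab: "(a, b) \<in> parcs G" "x a > 0" "x b < 0"
    and uv: "u \<in> pverts G" "v \<in> pverts G" "u \<noteq> v" "(u, v) \<notin> parcs G" "x u > 0" "x v > 0"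
  shows "eigval 2 (add_edge G u v) > \<mu>"
proof -
  let ?D = "add_edge G u v"
  define p where "p = (\<lambda>v. max (x v) 0)"
  define q where "q = (\<lambda>v. max (- x v) 0)"
  define c where "c = inner_on (pverts G) p (graph_op G q)"
  have D: "pair_graph ?D" by (rule pair_graph_add_edge[OF G(1) uv(1-3)])
  have vD: "pverts ?D = pverts G" by (simp add: add_edge_def)
  have "(\<Sum>(u, v)\<in>{(a, b)}. p u * q v) \<le> (\<Sum>(u, v)\<in>parcs G. p u * q v)"
    using ab(1) finite_parcs[OF G(1)] by (intro sum_mono2) (auto simp: p_def q_def)
  then have "p a * q b \<le> c" by (simp add: c_def graph_bilinear_arcs[OF G(1)])
  moreover have "p a * q b > 0"
  proof -
    have "p a = x a" "q b = - x b" using ab by (simp_all add: p_def q_def)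
    then show ?thesis using ab by (simp add: mult_pos_neg)
  qed
  ultimately have c: "c > 0" by simp
  have puv: "p u = x u" "p v = x v" "q u = 0" "q v = 0" using uv by (auto simp: p_def q_def)
  show ?thesis
  proof (rule second_eigenvalue_gt[OF D, where p = p and q = q])
    show "2 \<le> card (pverts ?D)" using G(2) vD by simp
    fix s t :: real assume st: "(s, t) \<noteq> (0, 0)"
    have "graph_form ?D (\<lambda>v. s * p v + t * q v)
        = \<mu> * sq_norm (pverts G) (\<lambda>v. s * p v + t * q v) + (c * (s + t)\<^sup>2 + 2 * s\<^sup>2 * (x u * x v))"
      using graph_form_add_edge[OF G(1) uv(1-4), of "\<lambda>v. s * p v + t * q v"]
        sign_form[OF G(1) ev p_def q_def c_def, of s t]
      by (simp add: puv power2_eq_square mult_ac)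
    moreover have "c * (s + t)\<^sup>2 + 2 * s\<^sup>2 * (x u * x v) > 0"
    proof (cases "s = 0")
      case True
      then show ?thesis using st c by simp
    next
      case False
      then have "2 * s\<^sup>2 * (x u * x v) > 0" using uv by simp
      moreover have "c * (s + t)\<^sup>2 \<ge> 0" using c by simp
      ultimately show ?thesis by linarith
    qed
    ultimately show "\<mu> * sq_norm (pverts ?D) (\<lambda>v. s * p v + t * q v) < graph_form ?D (\<lambda>v. s * p v + t * q v)"
      by (simp add: vD)
  qed
qed

text \<open>The two colourings can clash only at a b. A cyclic shift of the colours on
  \<open>B\<close> keeps them proper and, with at least two colours, removes the clash.\<close>

lemma colouring_across_bridge:
  assumes "r \<ge> 2" and G: "pair_graph G" and V: "pverts G = A \<union> B" "A \<inter> B = {}"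
    and c: "proper_colouring (induced G A) r c1" "proper_colouring (induced G B) r c2"
    and cross: "\<And>u v. u \<in> A \<Longrightarrow> v \<in> B \<Longrightarrow> (u, v) \<in> parcs G \<Longrightarrow> u = a \<and> v = b"
  shows "\<exists>c. proper_colouring G r c"
proof -
  define d where "d v = (if c2 b = c1 a then Suc (c2 v) mod r else c2 v)" for v
  define c where "c v = (if v \<in> A then c1 v else d v)" for v
  have c1: "c1 v < r" if "v \<in> A" for v using c(1) that by (auto simp: proper_colouring_def)
  have c2: "c2 v < r" if "v \<in> B" for v using c(2) that by (auto simp: proper_colouring_def)
  have d_less: "d v < r" if "v \<in> B" for v using c2[OF that] \<open>r \<ge> 2\<close> by (simp add: d_def)
  have d_inj: "d u \<noteq> d v" if "u \<in> B" "v \<in> B" "c2 u \<noteq> c2 v" for u v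
    using c2[OF that(1)] c2[OF that(2)] that(3) \<open>r \<ge> 2\<close> by (auto simp: d_def mod_Suc split: if_splits)
  have d_ne: "d b \<noteq> c1 a" if "b \<in> B" using c2[OF that] \<open>r \<ge> 2\<close> by (auto simp: d_def mod_Suc split: if_splits)
  have "c u \<noteq> c v" if uv: "(u, v) \<in> parcs G" for u v
  proof -
    have "u \<in> A \<union> B" "v \<in> A \<union> B" using parcs_in_pverts[OF G uv] V by auto
    then consider "u \<in> A" "v \<in> A" | "u \<in> B" "v \<in> B" | "u \<in> A" "v \<in> B" | "u \<in> B" "v \<in> A" by blast
    then show ?thesis
    proof cases
      case 1
      then have "c1 u \<noteq> c1 v" using c(1) uv by (auto simp: proper_colouring_def)
      then show ?thesis using 1 by (simp add: c_def)
    next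
      case 2
      then have "c2 u \<noteq> c2 v" using c(2) uv by (auto simp: proper_colouring_def)
      then have "d u \<noteq> d v" using d_inj 2 by blast
      moreover have "u \<notin> A" "v \<notin> A" using 2 V(2) by auto
      ultimately show ?thesis by (simp add: c_def)
    next
      case 3
      then have "u = a" "v = b" using cross[OF 3 uv] by simp_all
      moreover have "v \<notin> A" using 3 V(2) by auto
      ultimately show ?thesis using 3 d_ne by (auto simp: c_def)
    next
      case 4
      then have "v = a" "u = b" using cross[OF 4(2,1) parcs_sym[OF G uv]] by simp_all
      moreover have "u \<notin> A" using 4 V(2) by auto
      ultimately show ?thesis using 4 d_ne by (auto simp: c_def)
    qed
  qed
  moreover have "c ` pverts G \<subseteq> {..<r}" using V c1 d_less by (auto simp: c_def)
  ultimately show ?thesis by (intro exI[of _ c]) (auto simp: proper_colouring_def)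
qed

section \<open>Sign parts of a maximizer\<close>

text \<open>A smaller part fits into m - 1 vertices, where the spectral bound is (1 - 1 / r) (m -
  1). This lies at least 1 / 2 below (1 - 1 / r) m, whereas \<mu> lies at most (r + 1) / m \<le> 1 /
  8 below it.\<close>

lemma sign_part_card_ge:
  fixes r m :: nat
  assumes "r \<ge> 2" and crit: "colour_critical r H" and G: "pair_graph G" "free_of H G" and "m \<le> card (pverts G)"
    and m: "exp (real (card (pverts H)) * real r ^ ((2 * r + 9) * (r + 1))) \<le> real m" and m8: "8 * (r + 1) \<le> m"
    and ev: "\<forall>v\<in>pverts G. graph_op G x v = \<mu> * x v" and \<mu>: "\<mu> \<ge> (1 - 1 / real r) * real m - (real r + 1) / real m"
    and P: "P = {v \<in> pverts G. x v > 0}" "P \<noteq> {}"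
  shows "m \<le> card P"
proof (rule ccontr)
  assume "\<not> m \<le> card P"
  then have "card P \<le> m - 1" "m - 1 \<le> card (pverts G)" using assms(5) by auto
  moreover have PV: "P \<subseteq> pverts G" by (auto simp: P)
  ultimately obtain S where S: "P \<subseteq> S" "S \<subseteq> pverts G" "card S = m - 1"
    using subset_extension_exists[OF finite_pverts[OF G(1)]] by metis
  have H: "pair_graph H" using crit by (simp add: colour_critical_def)
  have "\<mu> \<le> spectral_radius (induced G P)"
    by (rule sign_component_bound(3)[OF G(1) ev PV P(2)]) (auto simp: P)
  also have "\<dots> \<le> spectral_radius (induced G S)" by (rule spectral_radius_induced_mono[OF G(1) S(1,2) P(2)])
  also have "\<dots> \<le> (1 - 1 / real r) * real (card (pverts (induced G S)))"
  proof (rule spectral_radius_le_of_free[OF \<open>r \<ge> 2\<close> crit])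
    show "pair_graph (induced G S)" by (rule pair_graph_induced[OF G(1) S(2)])
    show "pverts (induced G S) \<noteq> {}" using S(1) P(2) by auto
    show "free_of H (induced G S)" by (rule free_of_induced[OF H G(1) S(2) G(2)])
    show "exp (real (card (pverts H)) * real r ^ ((2 * r + 9) * (r + 1))) \<le> real (card (pverts (induced G S)) + 1)"
      using m m8 S(3) by simp
  qed
  also have "\<dots> = (1 - 1 / real r) * real m - (1 - 1 / real r)" using S(3) m8 by (simp add: of_nat_diff right_diff_distrib)
  finally have "1 - 1 / real r \<le> (real r + 1) / real m" using \<mu> by linarith
  moreover have "(real r + 1) / real m \<le> 1 / 8"
  proof -
    have "real (8 * (r + 1)) \<le> real m" using m8 by (rule of_nat_mono)
    then show ?thesis using m8 by (simp add: divide_le_eq)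
  qed
  moreover have "1 / real r \<le> 1 / 2" using \<open>r \<ge> 2\<close> by (simp add: field_simps)
  ultimately show False by linarith
qed

text \<open>Any non-empty union of components of \<open>P\<close> has spectral radius at least
  \<mu>, which is m / 2 up to a small error, and so has more than m / 2 vertices; two disjoint ones
  do not fit into \<open>P\<close>. Connected parts are what allows deleting an edge between them
  while another one remains.\<close>

lemma sign_part_connected:
  fixes r m :: nat
  assumes "r \<ge> 2" and G: "pair_graph G" and m8: "8 * (r + 1) \<le> m"
    and ev: "\<forall>v\<in>pverts G. graph_op G x v = \<mu> * x v" and \<mu>: "\<mu> \<ge> (1 - 1 / real r) * real m - (real r + 1) / real m"
    and P: "P = {v \<in> pverts G. x v > 0}" "card P = m"
  shows "graph_connected (induced G P)"
proof -
  have PV: "P \<subseteq> pverts G" by (auto simp: P)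
  have iP: "pair_graph (induced G P)" by (rule pair_graph_induced[OF G PV])
  have finP: "finite P" by (rule finite_subset[OF PV finite_pverts[OF G]])
  have big: "m < 2 * card C" if C: "C \<subseteq> P" "C \<noteq> {}" "\<And>u v. u \<in> C \<Longrightarrow> v \<in> P - C \<Longrightarrow> (u, v) \<notin> parcs G" for C
  proof -
    have CV: "C \<subseteq> pverts G" using C PV by auto
    have "\<mu> \<le> spectral_radius (induced G C)"
      by (rule sign_component_bound(3)[OF G ev CV C(2)]) (use C P in auto)
    also have "\<dots> \<le> real (card C) - 1"
      using spectral_radius_le_card[OF pair_graph_induced[OF G CV]] C(2) by simp
    finally have "(1 - 1 / real r) * real m - (real r + 1) / real m \<le> real (card C) - 1" using \<mu> by simp
    moreover have "(real r + 1) / real m \<le> 1 / 8"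
    proof -
      have "real (8 * (r + 1)) \<le> real m" using m8 by (rule of_nat_mono)
      then show ?thesis using m8 by (simp add: divide_le_eq)
    qed
    moreover have "1 / 2 * real m \<le> (1 - 1 / real r) * real m"
      using \<open>r \<ge> 2\<close> by (intro mult_right_mono) (auto simp: field_simps)
    ultimately show ?thesis by linarith
  qed
  show ?thesis
    unfolding graph_connected_iff[OF iP]
  proof (intro conjI allI impI)
    show "pverts (induced G P) \<noteq> {}" using P(2) m8 by auto
    fix C assume C: "C \<subseteq> pverts (induced G P) \<and> C \<noteq> {} \<and> C \<noteq> pverts (induced G P)"
    show "\<exists>u\<in>C. \<exists>v\<in>pverts (induced G P) - C. (u, v) \<in> parcs (induced G P)"
    proof (rule ccontr)
      assume "\<not> ?thesis"
      then have no: "(u, v) \<notin> parcs G" if "u \<in> C" "v \<in> P - C" for u v using that C by auto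
      have "m < 2 * card C" by (rule big) (use C no in auto)
      moreover have "m < 2 * card (P - C)"
      proof (rule big)
        show "(u, v) \<notin> parcs G" if "u \<in> P - C" "v \<in> P - (P - C)" for u v
          using no[of v u] that parcs_sym[OF G] by blast
      qed (use C in auto)
      moreover have "card (P - C) = card P - card C" "card C \<le> card P"
        using C finP by (auto intro: card_Diff_subset card_mono finite_subset)
      ultimately show False using P(2) by linarith
    qed
  qed
qed

lemma sign_part_saturated:
  fixes r m :: nat
  assumes "r \<ge> 2" and crit: "colour_critical r H"
    and m: "exp (real (card (pverts H)) * real r ^ ((2 * r + 9) * (r + 1))) \<le> real m" and m8: "8 * (r + 1) \<le> m"
    and G: "maximizes_second_eigenvalue H (2 * m) G"
    and ev: "\<forall>v\<in>pverts G. graph_op G x v = eigval 2 G * x v"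
    and \<mu>: "eigval 2 G \<ge> (1 - 1 / real r) * real m - (real r + 1) / real m"
    and nz: "\<forall>v\<in>pverts G. x v \<noteq> 0"
    and A: "A = {v \<in> pverts G. x v > 0}" "card A = m" and B: "B = {v \<in> pverts G. x v < 0}" "card B = m"
    and ab: "(a, b) \<in> parcs G" "a \<in> A" "b \<in> B"
    and unique: "\<And>u v. u \<in> A \<Longrightarrow> v \<in> B \<Longrightarrow> (u, v) \<in> parcs G \<Longrightarrow> u = a \<and> v = b"
    and uv: "u \<in> A" "v \<in> A" "u \<noteq> v" "(u, v) \<notin> parcs G"
  shows "contains_copy H (add_edge (induced G A) u v)"
proof (rule ccontr)
  assume free': "free_of H (add_edge (induced G A) u v)"
  have H: "pair_graph H" using crit by (simp add: colour_critical_def)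
  have pg: "pair_graph G" and conn: "graph_connected G" and card: "card (pverts G) = 2 * m" and free: "free_of H G"
    using G by (auto simp: maximizes_second_eigenvalue_def connected_free_graph_def)
  have m2: "m \<ge> 2" using m8 by simp
  have AV: "A \<subseteq> pverts G" and BV: "B \<subseteq> pverts G" by (auto simp: A B)
  have iA: "pair_graph (induced G A)" by (rule pair_graph_induced[OF pg AV])
  have iB: "pair_graph (induced G B)" by (rule pair_graph_induced[OF pg BV])
  have uvV: "u \<in> pverts G" "v \<in> pverts G" using uv AV by auto
  define G' where "G' = add_edge G u v"
  define F where "F = add_edge (induced G A) u v"
  have G': "pair_graph G'" unfolding G'_def by (rule pair_graph_add_edge[OF pg uvV uv(3)])
  have F: "pair_graph F" unfolding F_def using uv by (intro pair_graph_add_edge[OF iA]) auto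
  have Fv: "pverts F = A" by (simp add: F_def add_edge_def)
  have G'v: "pverts G' = pverts G" by (simp add: G'_def add_edge_def)
  have VAB: "pverts G = A \<union> B" "A \<inter> B = {}" using nz by (auto simp: A B)
  have rA: "eigval 2 G \<le> spectral_radius (induced G A)"
    by (rule sign_component_bound(3)[OF pg ev AV]) (use ab in \<open>auto simp: A\<close>)
  have rB: "eigval 2 G \<le> spectral_radius (induced G B)"
    by (rule sign_component_bound(3)[OF pg eigen_equation_uminus[OF ev] BV]) (use ab in \<open>auto simp: B\<close>)
  \<comment> \<open>The added edge does not lower the spectral radius and the enlarged part is free
    by assumption, so it is still near-extremal and colourable.\<close>
  have "spectral_radius (induced G A) \<le> spectral_radius F"
    by (rule spectral_radius_embeds[OF iA F, of id]) (use ab in \<open>auto simp: embeds_def F_def add_edge_def\<close>)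
  then have "\<exists>c. proper_colouring F r c"
    using rA \<mu> free' Fv A(2) m
    by (intro colouring_of_near_extremal[OF \<open>r \<ge> 2\<close> crit F]) (auto simp: F_def[symmetric])
  moreover have "F = induced G' A" using uv AV by (auto simp: F_def G'_def add_edge_def induced_def)
  ultimately obtain c1 where c1: "proper_colouring (induced G' A) r c1" by auto
  have "\<exists>c. proper_colouring (induced G B) r c"
    using rB \<mu> B(2) m free_of_induced[OF H pg BV free]
    by (intro colouring_of_near_extremal[OF \<open>r \<ge> 2\<close> crit iB]) auto
  moreover have "induced G B = induced G' B" using uv VAB by (auto simp: G'_def add_edge_def induced_def)
  ultimately obtain c2 where c2: "proper_colouring (induced G' B) r c2" by auto
  have "\<exists>c. proper_colouring G' r c"
  proof (rule colouring_across_bridge[OF \<open>r \<ge> 2\<close> G' _ VAB(2) c1 c2])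
    show "pverts G' = A \<union> B" using G'v VAB by simp
    show "w = a \<and> z = b" if "w \<in> A" "z \<in> B" "(w, z) \<in> parcs G'" for w z
    proof -
      have "(w, z) \<in> parcs G" using that uv VAB(2) by (auto simp: G'_def add_edge_def)
      then show ?thesis using unique that by blast
    qed
  qed
  then have "free_of H G'" using free_of_if_colourable[OF crit G'] by blast
  then have "connected_free_graph H (2 * m) G'"
    using G' connected_add_edge[OF pg conn uvV uv(3)] card G'v by (simp add: connected_free_graph_def G'_def)
  then have "eigval 2 G' \<le> eigval 2 G" using maximizes_second_eigenvalue_ge[OF H G] m2 by simp
  moreover have "eigval 2 G' > eigval 2 G"
    unfolding G'_def
    by (rule second_eigenvalue_add_edge[OF pg _ ev nz ab(1) _ _ uvV uv(3,4)]) (use ab uv card m2 in \<open>auto simp: A B\<close>)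
  ultimately show False by simp
qed

lemma saturated_graph_bij:
  assumes H: "pair_graph H" and G: "pair_graph G" and K: "pair_graph K" and f: "graph_bij f G K"
    and sat: "saturated H G"
  shows "saturated H K"
  unfolding saturated_def
proof (intro conjI ballI impI K)
  have g: "graph_bij (the_inv_into (pverts G) f) K G" by (rule graph_bij_sym[OF f])
  show "free_of H K"
    using contains_copy_embeds[OF H K G graph_bij_embeds[OF K g]] sat by (auto simp: saturated_def)
  fix i j assume ij: "i \<in> pverts K" "j \<in> pverts K" "i \<noteq> j \<and> (i, j) \<notin> parcs K"
  have bij: "bij_betw f (pverts G) (pverts K)" using f by (simp add: graph_bij_def)
  have "i \<in> f ` pverts G" "j \<in> f ` pverts G" using ij bij by (simp_all add: bij_betw_def)
  then obtain u v where uv: "u \<in> pverts G" "v \<in> pverts G" "f u = i" "f v = j" by blast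
  have "(u, v) \<notin> parcs G" "u \<noteq> v" using f uv ij by (auto simp: graph_bij_def)
  then have "contains_copy H (add_edge G u v)" using sat uv by (auto simp: saturated_def)
  moreover have "embeds f (add_edge G u v) (add_edge K i j)"
    using graph_bij_embeds[OF G f] uv by (auto simp: embeds_def add_edge_def)
  ultimately show "contains_copy H (add_edge K i j)"
    using contains_copy_embeds[OF H pair_graph_add_edge[OF G uv(1,2) \<open>u \<noteq> v\<close>]
        pair_graph_add_edge[OF K ij(1,2)]] ij(3) by blast
qed

lemma maximizer_structure:
  fixes r m :: nat
  assumes "r \<ge> 2" and crit: "colour_critical r H" and thr: "nikiforov_threshold r H N" and "m \<ge> N"
    and G: "maximizes_second_eigenvalue H (2 * m) G"
  shows "spectral_radius (turan_graph m r) - 1 / real m \<le> eigval 2 G"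
    and "eigval 2 G \<le> spectral_radius (turan_graph m r)"
    and "\<exists>(H\<^sub>1 :: nat pair_pre_digraph) (H\<^sub>2 :: nat pair_pre_digraph).
      saturated H H\<^sub>1 \<and> card (pverts H\<^sub>1) = m \<and> saturated H H\<^sub>2 \<and> card (pverts H\<^sub>2) = m \<and> G \<in> edge_joined H\<^sub>1 H\<^sub>2"
proof -
  let ?T = "turan_graph m r" and ?V = "pverts G" and ?\<mu> = "eigval 2 G"
  have H: "pair_graph H" using crit by (simp add: colour_critical_def)
  have pg: "pair_graph G" and conn: "graph_connected G" and card: "card ?V = 2 * m" and free: "free_of H G"
    using G by (auto simp: maximizes_second_eigenvalue_def connected_free_graph_def)
  have V: "finite ?V" by (rule finite_pverts[OF pg])
  have "exp (real (card (pverts H)) * real r ^ ((2 * r + 9) * (r + 1))) \<le> real N"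
    using thr by (simp add: nikiforov_threshold_def)
  also have "\<dots> \<le> real m" using \<open>m \<ge> N\<close> by simp
  finally have m: "exp (real (card (pverts H)) * real r ^ ((2 * r + 9) * (r + 1))) \<le> real m" .
  have m8: "8 * (r + 1) \<le> m"
  proof -
    define F where "F = 2 ^ (r + 1) * (12 * r) ^ r"
    define Q where "Q = card (pverts H) * F ^ (r - 1)"
    note size = threshold_size[OF \<open>r \<ge> 2\<close> colour_critical_card_pos[OF crit] F_def Q_def m]
    have "8 * (r + 1) \<le> 1152 * k" if "2 * r \<le> k" for k using that \<open>r \<ge> 2\<close> by simp
    from this[OF mult_le_mono1[OF \<open>r \<ge> 2\<close>]] have "8 * (r + 1) \<le> 1152 * r\<^sup>2" by (simp only: power2_eq_square)
    then have F8: "8 * (r + 1) \<le> F" using size(2) by linarith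
    have "1 * (F * 1 * 1) \<le> 2 ^ (16 * r * (r + 1)) * (F * Q * 2 ^ Q)"
      using size(3) F8 by (intro mult_le_mono) auto
    then show ?thesis using size(1) F8 by linarith
  qed
  have m2: "m \<ge> 2" using m8 by simp
  obtain J :: "(nat + nat) pair_pre_digraph" where J: "connected_free_graph H (2 * m) J"
    "eigval 2 J \<ge> spectral_radius ?T - 1 / real m"
    by (rule two_turan_graphs[OF \<open>r \<ge> 2\<close> m2 crit])
  show lower: "spectral_radius ?T - 1 / real m \<le> ?\<mu>"
    using maximizes_second_eigenvalue_ge[OF H G J(1)] J(2) m2 by simp
  \<comment> \<open>The defects r / m of the Turan graph and 1 / m of the joining edge add up to (r
    + 1) / m.\<close>
  have \<mu>: "?\<mu> \<ge> (1 - 1 / real r) * real m - (real r + 1) / real m"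
    using lower turan_graph_spectral_radius_ge[of r m] \<open>r \<ge> 2\<close> m2 by (simp add: add_divide_distrib)
  have card2: "card ?V \<ge> 2" using card m2 by simp
  obtain x where ev: "\<forall>v\<in>?V. graph_op G x v = ?\<mu> * x v" and x: "\<exists>v\<in>?V. x v > 0" "\<exists>v\<in>?V. x v < 0"
    by (rule second_eigenvector_signs[OF pg card2 conn])
  define A where "A = {v \<in> ?V. x v > 0}"
  define B where "B = {v \<in> ?V. x v < 0}"
  have B': "B = {v \<in> ?V. - x v > 0}" by (auto simp: B_def)
  note ev' = eigen_equation_uminus[OF ev]
  have AB: "A \<subseteq> ?V" "B \<subseteq> ?V" "A \<inter> B = {}" "A \<noteq> {}" "B \<noteq> {}" using x by (auto simp: A_def B_def)
  have fin: "finite A" "finite B" using finite_subset[OF AB(1) V] finite_subset[OF AB(2) V] by simp_all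
  have mV: "m \<le> card ?V" using card by simp
  have "m \<le> card A" by (rule sign_part_card_ge[OF \<open>r \<ge> 2\<close> crit pg free mV m m8 ev \<mu> A_def AB(4)])
  moreover have "m \<le> card B" by (rule sign_part_card_ge[OF \<open>r \<ge> 2\<close> crit pg free mV m m8 ev' \<mu> B' AB(5)])
  moreover have cAB: "card (A \<union> B) = card A + card B" using AB fin by (simp add: card_Un_disjoint)
  moreover have "card (A \<union> B) \<le> 2 * m" using card_mono[OF V, of "A \<union> B"] AB card by simp
  ultimately have cards: "card A = m \<and> card B = m" by linarith
  then have cA: "card A = m" and cB: "card B = m" by simp_all
  then have VAB: "?V = A \<union> B" using card_subset_eq[OF V, of "A \<union> B"] AB cAB card by simp
  have nz: "\<forall>v\<in>?V. x v \<noteq> 0" unfolding VAB by (auto simp: A_def B_def)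
  have maxT: "max_spectral_radius m H = spectral_radius ?T"
    using thr \<open>m \<ge> N\<close> by (simp add: nikiforov_threshold_def)
  show "?\<mu> \<le> spectral_radius ?T"
    using small_sign_part(1)[OF H thr \<open>r \<ge> 2\<close> \<open>m \<ge> N\<close> m2 pg free ev A_def AB(4) _ mV] cA maxT by simp
  have connA: "graph_connected (induced G A)" by (rule sign_part_connected[OF \<open>r \<ge> 2\<close> pg m8 ev \<mu> A_def cA])
  have connB: "graph_connected (induced G B)" by (rule sign_part_connected[OF \<open>r \<ge> 2\<close> pg m8 ev' \<mu> B' cB])
  have "\<exists>u\<in>A. \<exists>v\<in>?V - A. (u, v) \<in> parcs G" using AB by (intro graph_connected_cut[OF pg conn]) auto
  then obtain a b where ab: "(a, b) \<in> parcs G" "a \<in> A" "b \<in> B" using VAB by blast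
  have unique: "u = a \<and> v = b" if uv: "u \<in> A" "v \<in> B" "(u, v) \<in> parcs G" for u v
  proof (rule ccontr)
    assume ne: "\<not> (u = a \<and> v = b)"
    define D where "D = delete_edge G a b"
    have D: "pair_graph D" unfolding D_def by (rule pair_graph_delete_edge[OF pg])
    have Dv: "pverts D = ?V" by (simp add: D_def delete_edge_def)
    have "induced D A = induced G A" "induced D B = induced G B"
      using ab AB(3) by (auto simp: D_def delete_edge_def induced_def)
    moreover have "(u, v) \<in> parcs D" using uv ne ab AB(3) by (auto simp: D_def delete_edge_def)
    \<comment> \<open>The remaining edge u v still links the two connected parts, which makes
      \<open>D\<close> a competitor.\<close>
    ultimately have "graph_connected D"
      using connected_two_parts[OF D _ _ _ uv(1,2)] Dv VAB connA connB by simp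
    moreover have "free_of H D"
    proof -
      have "embeds id D G" using Dv by (auto simp: embeds_def D_def delete_edge_def)
      then show ?thesis using contains_copy_embeds[OF H D pg] free by blast
    qed
    ultimately have "connected_free_graph H (2 * m) D" using D Dv card by (simp add: connected_free_graph_def)
    then have "eigval 2 D \<le> ?\<mu>" using maximizes_second_eigenvalue_ge[OF H G] m2 by simp
    moreover have "eigval 2 D > ?\<mu>"
      unfolding D_def
      by (rule second_eigenvalue_delete_edge[OF pg card2 ev ab(1) _ _ uv(3)]) (use ab uv ne in \<open>auto simp: A_def B_def\<close>)
    ultimately show False by simp
  qed
  have iA: "pair_graph (induced G A)" by (rule pair_graph_induced[OF pg AB(1)])
  have iB: "pair_graph (induced G B)" by (rule pair_graph_induced[OF pg AB(2)])
  have satA: "saturated H (induced G A)"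
    unfolding saturated_def
  proof (intro conjI ballI impI iA)
    show "free_of H (induced G A)" by (rule free_of_induced[OF H pg AB(1) free])
    fix u v assume "u \<in> pverts (induced G A)" "v \<in> pverts (induced G A)" "u \<noteq> v \<and> (u, v) \<notin> parcs (induced G A)"
    then show "contains_copy H (add_edge (induced G A) u v)"
      by (intro sign_part_saturated[OF \<open>r \<ge> 2\<close> crit m m8 G ev \<mu> nz A_def cA B_def cB ab unique]) auto
  qed
  have A': "A = {v \<in> ?V. - x v < 0}" by (auto simp: A_def)
  have nz': "\<forall>v\<in>?V. - x v \<noteq> 0" using nz by simp
  have ba: "(b, a) \<in> parcs G" by (rule parcs_sym[OF pg ab(1)])
  have unique': "u = b \<and> v = a" if "u \<in> B" "v \<in> A" "(u, v) \<in> parcs G" for u v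
    using unique[OF that(2,1) parcs_sym[OF pg that(3)]] by simp
  have satB: "saturated H (induced G B)"
    unfolding saturated_def
  proof (intro conjI ballI impI iB)
    show "free_of H (induced G B)" by (rule free_of_induced[OF H pg AB(2) free])
    fix u v assume "u \<in> pverts (induced G B)" "v \<in> pverts (induced G B)" "u \<noteq> v \<and> (u, v) \<notin> parcs (induced G B)"
    then show "contains_copy H (add_edge (induced G B) u v)"
      by (intro sign_part_saturated[OF \<open>r \<ge> 2\<close> crit m m8 G ev' \<mu> nz' B' cB A' cA ba ab(3,2) unique']) auto
  qed
  \<comment> \<open>The saturated graphs are required on natural numbers, so both sign parts are
    renumbered before they are joined again.\<close>
  obtain K1 :: "nat pair_pre_digraph" and f1 where K1: "pair_graph K1" "graph_bij f1 (induced G A) K1"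
    using nat_graph_copy[OF iA] by metis
  obtain K2 :: "nat pair_pre_digraph" and f2 where K2: "pair_graph K2" "graph_bij f2 (induced G B) K2"
    using nat_graph_copy[OF iB] by metis
  have b1: "bij_betw f1 A (pverts K1)" "\<And>u v. u \<in> A \<Longrightarrow> v \<in> A \<Longrightarrow> (u, v) \<in> parcs G \<longleftrightarrow> (f1 u, f1 v) \<in> parcs K1"
    using K1(2) by (simp_all add: graph_bij_def)
  have b2: "bij_betw f2 B (pverts K2)" "\<And>u v. u \<in> B \<Longrightarrow> v \<in> B \<Longrightarrow> (u, v) \<in> parcs G \<longleftrightarrow> (f2 u, f2 v) \<in> parcs K2"
    using K2(2) by (simp_all add: graph_bij_def)
  define E where "E = add_edge (disjoint_union K1 K2) (Inl (f1 a)) (Inr (f2 b))"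
  define F where "F v = (if v \<in> A then Inl (f1 v) else Inr (f2 v))" for v
  have fab: "f1 a \<in> pverts K1" "f2 b \<in> pverts K2" using ab b1(1) b2(1) by (auto dest: bij_betwE)
  have E: "pair_graph E"
    unfolding E_def using fab by (intro pair_graph_add_edge pair_graph_disjoint_union K1 K2) auto
  have Ev: "pverts E = pverts K1 <+> pverts K2" by (simp add: E_def add_edge_def)
  have E_arcs: "(Inl i, Inl j) \<in> parcs E \<longleftrightarrow> (i, j) \<in> parcs K1" "(Inr i', Inr j') \<in> parcs E \<longleftrightarrow> (i', j') \<in> parcs K2"
    "(Inl i, Inr j') \<in> parcs E \<longleftrightarrow> i = f1 a \<and> j' = f2 b" "(Inr i', Inl j) \<in> parcs E \<longleftrightarrow> i' = f2 b \<and> j = f1 a" for i j i' j'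
    by (auto simp: E_def add_edge_def)
  have Fv: "v \<in> A \<Longrightarrow> F v = Inl (f1 v)" "v \<in> B \<Longrightarrow> F v = Inr (f2 v)" for v
    using AB(3) by (auto simp: F_def)
  have eq1: "f1 u = f1 a \<longleftrightarrow> u = a" if "u \<in> A" for u using b1(1) that ab(2) by (auto simp: bij_betw_def inj_on_def)
  have eq2: "f2 u = f2 b \<longleftrightarrow> u = b" if "u \<in> B" for u using b2(1) that ab(3) by (auto simp: bij_betw_def inj_on_def)
  have cross: "(u, v) \<in> parcs G \<longleftrightarrow> u = a \<and> v = b" "(v, u) \<in> parcs G \<longleftrightarrow> u = a \<and> v = b" if "u \<in> A" "v \<in> B" for u v
    using unique[OF that] unique'[OF that(2,1)] ab(1) ba by (blast, blast)
  have "graph_bij F G E"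
    unfolding graph_bij_def
  proof (intro conjI ballI)
    have "inj_on F ?V"
    proof (rule inj_onI)
      fix u v assume uv: "u \<in> ?V" "v \<in> ?V" "F u = F v"
      then consider "u \<in> A" "v \<in> A" | "u \<in> B" "v \<in> B" unfolding VAB by (auto simp: Fv)
      then show "u = v" using uv(3) b1(1) b2(1) by cases (auto simp: Fv bij_betw_def inj_on_def)
    qed
    moreover have "F ` ?V = pverts E"
    proof -
      have "F ` ?V = F ` A \<union> F ` B" unfolding VAB by (rule image_Un)
      also have "F ` A = Inl ` f1 ` A" using Fv(1) by (auto simp: image_iff)
      also have "F ` B = Inr ` f2 ` B" using Fv(2) by (auto simp: image_iff)
      finally show ?thesis using b1(1) b2(1) by (auto simp: Ev bij_betw_def)
    qed
    ultimately show "bij_betw F ?V (pverts E)" by (simp add: bij_betw_def)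
    fix u v assume uv: "u \<in> ?V" "v \<in> ?V"
    then have "u \<in> A \<or> u \<in> B" "v \<in> A \<or> v \<in> B" using VAB by auto
    then show "(u, v) \<in> parcs G \<longleftrightarrow> (F u, F v) \<in> parcs E"
      by (elim disjE) (simp_all add: Fv E_arcs b1(2) b2(2) cross eq1 eq2 conj_commute)
  qed
  then have "G \<cong>\<^sub>G E" using pair_graph_iso_iff[OF pg E] by blast
  then have "G \<in> edge_joined K1 K2" unfolding edge_joined_def E_def using pg fab by blast
  moreover have "saturated H K1" by (rule saturated_graph_bij[OF H iA K1 satA])
  moreover have "saturated H K2" by (rule saturated_graph_bij[OF H iB K2 satB])
  moreover have "card (pverts K1) = m" "card (pverts K2) = m"
    using graph_bij_card[OF K1(2)] graph_bij_card[OF K2(2)] cA cB by simp_all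
  ultimately show "\<exists>(H\<^sub>1 :: nat pair_pre_digraph) (H\<^sub>2 :: nat pair_pre_digraph).
      saturated H H\<^sub>1 \<and> card (pverts H\<^sub>1) = m \<and> saturated H H\<^sub>2 \<and> card (pverts H\<^sub>2) = m \<and> G \<in> edge_joined H\<^sub>1 H\<^sub>2"
    by blast
qed

lemma second_eigenvalue_odd:
  fixes r m :: nat
  assumes "r \<ge> 2" and crit: "colour_critical r H" and thr: "nikiforov_threshold r H N" and "m \<ge> N" "m \<ge> 2"
    and G: "connected_free_graph H (2 * m + 1) G"
  shows "eigval 2 G \<le> max_spectral_radius m H"
    and "eigval 2 G = max_spectral_radius m H \<longleftrightarrow> G \<in> vertex_joined (turan_graph m r) (turan_graph m r)"
proof -
  let ?V = "pverts G" and ?\<mu> = "eigval 2 G"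
  have H: "pair_graph H" using crit by (simp add: colour_critical_def)
  have pg: "pair_graph G" and conn: "graph_connected G" and card: "card ?V = 2 * m + 1" and free: "free_of H G"
    using G by (auto simp: connected_free_graph_def)
  have V: "finite ?V" by (rule finite_pverts[OF pg])
  have card2: "card ?V \<ge> 2" using card \<open>m \<ge> 2\<close> by simp
  obtain x where ev: "\<forall>v\<in>?V. graph_op G x v = ?\<mu> * x v" and x: "\<exists>v\<in>?V. x v > 0" "\<exists>v\<in>?V. x v < 0"
    by (rule second_eigenvector_signs[OF pg card2 conn])
  \<comment> \<open>Of the two disjoint sign parts among 2 m + 1 vertices one has at most
    \<open>m\<close>; passing to the negative of \<open>x\<close> if necessary makes it the positive
    one.\<close>
  obtain y where ev: "\<forall>v\<in>?V. graph_op G y v = ?\<mu> * y v" and y: "\<exists>v\<in>?V. y v > 0" "\<exists>v\<in>?V. y v < 0"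
    and small: "card {v \<in> ?V. y v > 0} \<le> m"
  proof -
    let ?A = "{v \<in> ?V. x v > 0}" and ?B = "{v \<in> ?V. - x v > 0}"
    have "card (?A \<union> ?B) = card ?A + card ?B" using V by (intro card_Un_disjoint) auto
    moreover have "card (?A \<union> ?B) \<le> card ?V" using V by (intro card_mono) auto
    ultimately have "card ?A \<le> m \<or> card ?B \<le> m" using card by linarith
    then show thesis
    proof
      assume "card ?A \<le> m"
      then show thesis by (rule that[OF ev x])
    next
      assume "card ?B \<le> m"
      then show thesis by (intro that[OF eigen_equation_uminus[OF ev]]) (use x in auto)
    qed
  qed
  have ne: "{v \<in> ?V. y v > 0} \<noteq> {}" using y(1) by auto
  have mV: "m \<le> card ?V" using card by simp
  show le: "?\<mu> \<le> max_spectral_radius m H"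
    by (rule small_sign_part(1)[OF H thr \<open>r \<ge> 2\<close> \<open>m \<ge> N\<close> \<open>m \<ge> 2\<close> pg free ev refl ne small mV])
  show "?\<mu> = max_spectral_radius m H \<longleftrightarrow> G \<in> vertex_joined (turan_graph m r) (turan_graph m r)"
  proof
    assume "?\<mu> = max_spectral_radius m H"
    then show "G \<in> vertex_joined (turan_graph m r) (turan_graph m r)"
      using vertex_joined_of_small_sign_part[OF H thr \<open>r \<ge> 2\<close> \<open>m \<ge> N\<close> \<open>m \<ge> 2\<close> pg free conn card _ y small] ev by simp
  next
    assume "G \<in> vertex_joined (turan_graph m r) (turan_graph m r)"
    then have "spectral_radius (turan_graph m r) \<le> ?\<mu>"
      using \<open>m \<ge> 2\<close> by (intro vertex_joined_second_eigenvalue_ge) auto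
    moreover have "max_spectral_radius m H = spectral_radius (turan_graph m r)"
      using thr \<open>m \<ge> N\<close> by (simp add: nikiforov_threshold_def)
    ultimately show "?\<mu> = max_spectral_radius m H" using le by simp
  qed
qed

theorem theorem3p5:
  fixes H :: "'h pair_pre_digraph" and \<chi> n\<^sub>H :: nat
  assumes "\<chi> \<ge> 2"
    and "colour_critical \<chi> H"
    and "nikiforov_threshold \<chi> H n\<^sub>H"
  shows "(\<forall>n (G :: 'a pair_pre_digraph).
            n \<ge> 2 * n\<^sub>H \<and> odd n \<and> connected_free_graph H n G \<longrightarrow>
              eigval 2 G \<le> max_spectral_radius ((n - 1) div 2) H \<and>
              (eigval 2 G = max_spectral_radius ((n - 1) div 2) H \<longleftrightarrow>
                 G \<in> vertex_joined (turan_graph ((n - 1) div 2) \<chi>) (turan_graph ((n - 1) div 2) \<chi>) \<and>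
                 free_of H G))
       \<and> (\<exists>f :: nat \<Rightarrow> real. f \<in> o(\<lambda>_. 1) \<and>
            (\<forall>n (G :: 'a pair_pre_digraph).
               n \<ge> 2 * n\<^sub>H \<and> even n \<and> maximizes_second_eigenvalue H n G \<longrightarrow>
                 eigval 2 G = spectral_radius (turan_graph (n div 2) \<chi>) - f n \<and>
                 (\<exists>(H\<^sub>1 :: nat pair_pre_digraph) (H\<^sub>2 :: nat pair_pre_digraph).
                    saturated H H\<^sub>1 \<and> card (pverts H\<^sub>1) = n div 2 \<and>
                    saturated H H\<^sub>2 \<and> card (pverts H\<^sub>2) = n div 2 \<and>
                    G \<in> edge_joined H\<^sub>1 H\<^sub>2)))"
proof (intro conjI allI impI)
  have N2: "n\<^sub>H \<ge> 2"
  proof -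
    have "1 \<le> real (card (pverts H)) * real \<chi> ^ ((2 * \<chi> + 9) * (\<chi> + 1))"
      using colour_critical_card_pos[OF assms(2)] assms(1)
        mult_mono[of 1 "real (card (pverts H))" 1 "real \<chi> ^ ((2 * \<chi> + 9) * (\<chi> + 1))"] by simp
    then have "exp 1 \<le> exp (real (card (pverts H)) * real \<chi> ^ ((2 * \<chi> + 9) * (\<chi> + 1)))" by simp
    also have "\<dots> \<le> real n\<^sub>H" using assms(3) by (simp add: nikiforov_threshold_def)
    finally have "2 \<le> real n\<^sub>H" using exp_ge_add_one_self[of 1] by linarith
    then show ?thesis by simp
  qed
  have H: "pair_graph H" using assms(2) by (simp add: colour_critical_def)
  {
    fix n and G :: "'a pair_pre_digraph"
    assume n: "n \<ge> 2 * n\<^sub>H \<and> odd n \<and> connected_free_graph H n G"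
    define m where "m = (n - 1) div 2"
    have nm: "n = 2 * m + 1" using n by (auto simp: m_def elim!: oddE)
    then have m: "m \<ge> n\<^sub>H" "m \<ge> 2" using n N2 by auto
    have G: "connected_free_graph H (2 * m + 1) G" using n nm by simp
    then have free: "free_of H G" by (simp add: connected_free_graph_def)
    note odd = second_eigenvalue_odd[OF assms m G]
    show "eigval 2 G \<le> max_spectral_radius ((n - 1) div 2) H"
      using odd(1) by (simp only: m_def)
    show "eigval 2 G = max_spectral_radius ((n - 1) div 2) H \<longleftrightarrow>
        G \<in> vertex_joined (turan_graph ((n - 1) div 2) \<chi>) (turan_graph ((n - 1) div 2) \<chi>) \<and> free_of H G"
      using odd(2) free by (simp only: m_def simp_thms)
  }
  define M where "M n G \<longleftrightarrow> n \<ge> 2 * n\<^sub>H \<and> even n \<and> maximizes_second_eigenvalue H n G"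
    for n and G :: "'a pair_pre_digraph"
  \<comment> \<open>All maximizers of order \<open>n\<close> share one second eigenvalue, so the
    error term can be read off an arbitrary one. The value 0 for orders without a maximizer keeps
    the bound 2 / n valid for every \<open>n\<close>.\<close>
  define f where "f n = (if \<exists>G. M n G then spectral_radius (turan_graph (n div 2) \<chi>) - eigval 2 (SOME G. M n G) else 0)" for n
  have struct: "spectral_radius (turan_graph (n div 2) \<chi>) - 1 / real (n div 2) \<le> eigval 2 G"
      "eigval 2 G \<le> spectral_radius (turan_graph (n div 2) \<chi>)"
      "\<exists>(H\<^sub>1 :: nat pair_pre_digraph) (H\<^sub>2 :: nat pair_pre_digraph).
        saturated H H\<^sub>1 \<and> card (pverts H\<^sub>1) = n div 2 \<and> saturated H H\<^sub>2 \<and> card (pverts H\<^sub>2) = n div 2 \<and> G \<in> edge_joined H\<^sub>1 H\<^sub>2"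
    if "M n G" for n G
  proof -
    have n: "n = 2 * (n div 2)" "n div 2 \<ge> n\<^sub>H" using that by (auto simp: M_def)
    have "maximizes_second_eigenvalue H (2 * (n div 2)) G" using that n(1) by (simp add: M_def)
    note max = maximizer_structure[OF assms n(2) this]
    show "spectral_radius (turan_graph (n div 2) \<chi>) - 1 / real (n div 2) \<le> eigval 2 G"
      "eigval 2 G \<le> spectral_radius (turan_graph (n div 2) \<chi>)"
      by (rule max(1), rule max(2))
    show "\<exists>(H\<^sub>1 :: nat pair_pre_digraph) (H\<^sub>2 :: nat pair_pre_digraph).
        saturated H H\<^sub>1 \<and> card (pverts H\<^sub>1) = n div 2 \<and> saturated H H\<^sub>2 \<and> card (pverts H\<^sub>2) = n div 2 \<and> G \<in> edge_joined H\<^sub>1 H\<^sub>2"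
      by (rule max(3))
  qed
  have same: "eigval 2 (SOME G. M n G) = eigval 2 G" if MG: "M n G" for n G
  proof -
    have MS: "M n (SOME G. M n G)" using MG by (rule someI)
    have n2: "n \<ge> 2" using MG N2 by (simp add: M_def)
    have "eigval 2 K' \<le> eigval 2 K" if "M n K" "M n K'" for K K'
      by (rule maximizes_second_eigenvalue_ge[OF H _ _ n2])
        (use that in \<open>simp_all add: M_def maximizes_second_eigenvalue_def\<close>)
    from this[OF MG MS] this[OF MS MG] show ?thesis by (rule antisym)
  qed
  have f_eq: "f n = spectral_radius (turan_graph (n div 2) \<chi>) - eigval 2 G" if "M n G" for n G
    using that same[OF that] by (auto simp: f_def)
  have f_bound: "norm (f n) \<le> 2 / real n" for n
  proof (cases "\<exists>G. M n G")
    case True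
    then obtain G where MG: "M n G" by blast
    have "n = 2 * (n div 2)" using MG by (simp add: M_def)
    then have "real n = 2 * real (n div 2)" by (metis of_nat_mult of_nat_numeral)
    then have "1 / real (n div 2) = 2 / real n" by simp
    then show ?thesis using struct(1,2)[OF MG] f_eq[OF MG] by simp
  qed (simp add: f_def)
  have "f \<longlonglongrightarrow> 0"
  proof (rule tendsto_0_le)
    show "(\<lambda>n. 2 / real n) \<longlonglongrightarrow> 0" by (rule lim_const_over_n)
    show "\<forall>\<^sub>F n in sequentially. norm (f n) \<le> norm (2 / real n) * 1" using f_bound by simp
  qed
  then have small: "f \<in> o(\<lambda>_. 1)" by (intro smalloI_tendsto) simp_all
  show "\<exists>f :: nat \<Rightarrow> real. f \<in> o(\<lambda>_. 1) \<and>
      (\<forall>n (G :: 'a pair_pre_digraph).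
         n \<ge> 2 * n\<^sub>H \<and> even n \<and> maximizes_second_eigenvalue H n G \<longrightarrow>
           eigval 2 G = spectral_radius (turan_graph (n div 2) \<chi>) - f n \<and>
           (\<exists>(H\<^sub>1 :: nat pair_pre_digraph) (H\<^sub>2 :: nat pair_pre_digraph).
              saturated H H\<^sub>1 \<and> card (pverts H\<^sub>1) = n div 2 \<and>
              saturated H H\<^sub>2 \<and> card (pverts H\<^sub>2) = n div 2 \<and>
              G \<in> edge_joined H\<^sub>1 H\<^sub>2))"
  proof (intro exI[of _ f] conjI small allI impI)
    fix n and G :: "'a pair_pre_digraph"
    assume "n \<ge> 2 * n\<^sub>H \<and> even n \<and> maximizes_second_eigenvalue H n G"
    then have MG: "M n G" by (simp add: M_def)
    show "eigval 2 G = spectral_radius (turan_graph (n div 2) \<chi>) - f n" using f_eq[OF MG] by simp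
    show "\<exists>(H\<^sub>1 :: nat pair_pre_digraph) (H\<^sub>2 :: nat pair_pre_digraph).
        saturated H H\<^sub>1 \<and> card (pverts H\<^sub>1) = n div 2 \<and> saturated H H\<^sub>2 \<and> card (pverts H\<^sub>2) = n div 2 \<and> G \<in> edge_joined H\<^sub>1 H\<^sub>2"
      by (rule struct(3)[OF MG])
  qed
qed

end
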